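(* Let $k>0$, let $\sigma>0$ and $\alpha\ge 0$ (or $\alpha>0$ and $\sigma\ge 0$), and let $\epsilon_2>-1$. Assume $\Delta t<\tau$ for some sufficiently small constant $\tau>0$. Then the approximations $(\mathbf d_h,\mathbf w_h,\varphi_h)$ defined by the scheme (S) and the interpolations described in the context satisfy, for all $M\in\mathbb N$ (with $t^M\le T$), $$\begin{aligned} &\frac{k}{2}\|\nabla_h\mathbf d_h(t^M)\|_{L^2}^2+\frac{\sigma}{2}\|\mathbf w_h(t^M)\|_{L^2}^2+\|\nabla\varphi_h(t^M)\|_{L^2}^2\\ &\le C\left(\|\widetilde g_h(t^M)\|_{H^1}^2+\|f(t^M)\|_{L^2}^2\right)+C\exp(Ct^M)\Delta t\sum_{m=0}^{M-1}\|f(t^m)\|_{L^2}^2\\ &\quad+C(t^M\exp(Ct^M)+1)\left(\|\nabla\mathbf d_0\|_{L^2}^2+\|\mathbf w_0\|_{L^2}^2+\|\nabla\varphi_h^0\|_{L^2}^2+\|f(0)\|_{L^2}^2+\|\widetilde g_h^0\|_{H^1}^2\right)\\ &\quad+C(1+t^M\exp(Ct^M))\Delta t\left(\sum_{m=0}^{M-1}\|D_tf(t^m)\|_{L^2}^2+\sum_{m=0}^{M-1}\|D_t\nabla\widetilde g_h(t^m)\|_{L^2}^2\right)\\ &\quad+C\exp(Ct^M)(1+t^M)\Delta t\sum_{m=0}^{M}\|\widetilde g_h(t^m)\|_{H^1}^2-2\alpha\|\widehat{\mathbf w}_h\|_{L^2([0,t^M)\times\Omega)}^2 \end{aligned}$$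 for some constant $C>0$ depending on the domain and the parameters $\epsilon_1,\epsilon_2$ but not on $h$ or $\Delta t$ (the coefficients $k,\sigma,\alpha$ being fixed).
   Context: Setting: $n\in\{1,2,3\}$, $\Omega=[0,1]^n$, $T>0$, $\Delta t>0$ with $N_T=T/\Delta t\in\mathbb N$, $t^m=m\Delta t$, $N\in\mathbb N$, $h=1/N$. Multi-indices $\underline i\in\mathcal I_N=\{0,\dots,N+1\}^n$; cells $\mathcal C_{\underline i}=((i_1-1)h,i_1h]\times\dots\times((i_n-1)h,i_nh]$; interior indices $\{1,\dots,N\}^n$; $\mathbf e_j$ is the $j$th unit vector. The physical parameters satisfy $\epsilon_1=\epsilon_0\epsilon_a$ and $\epsilon_2=\epsilon_a\epsilon_\perp^{-1}$, where $\epsilon_0>0$ is the permittivity of free space, $\epsilon_\perp\ne0$ and $\epsilon_a\in\mathbb R$ are dielectric constants (in particular $\epsilon_1=0$ iff $\epsilon_2=0$). For $n<3$, gradients in $\mathbb R^n$ are regarded as vectors in $\mathbb R^3$ (extended by zeros) when multiplied with $\mathbf d$. Data: $f\in W^{1,2}([0,T];L^2(\Omega))$; boundary data $g$ with an extension $\widetilde g\in L^\infty(0,T;H^1(\Omega))\cap W^{1,2}(0,T;H^1(\Omega))$ whose pointwise values at mesh nodes are meaningful; $\mathbf d_0\in H^1(\Omega;\mathbb R^3)$ with $|\mathbf d_0|=1$ a.e., $\mathbf d_1\in L^2(\Omega;\mathbb R^3)$, $\mathbf w_0=\mathbf d_1\times\mathbf d_0$. Notation: $D_ta^m=(a^{m+1}-a^m)/\Delta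 t$ (also $D_tf(t^m)=(f(t^{m+1})-f(t^m))/\Delta t$, and similarly for $\widetilde g_h$), $a^{m+1/2}=(a^m+a^{m+1})/2$; $D_j^\pm a_{\underline i}=\pm(a_{\underline i\pm\mathbf e_j}-a_{\underline i})/h$, $\nabla_h=\nabla_h^\pm=(D_1^\pm,\dots,D_n^\pm)^\top$ (either sign), $\Delta_h=\sum_jD_j^\pm D_j^\mp$. Norms without indicated domain are over $\Omega$. $\mathcal T$ is a simplicial uniformly shape-regular triangulation of $\Omega$ with mesh size comparable to $h$, with nodes $w_i$ and continuous piecewise linear hat functions $b_i$; $V_h$ is the span of the hat functions of interior nodes; $\widetilde g_h^m=\sum_i\widetilde g(t^m,w_i)b_i$ (all nodes). $a_h^m(u,v)=\int_\Omega[\nabla u\cdot\nabla v+\epsilon_2(\mathbf d_h^m\cdot\nabla u)(\mathbf d_h^m\cdot\nabla v)]dx$, $F^m(v)=\int_\Omega f(t^m,x)v(x)dx$. Scheme (S): unknowns $\mathbf d^m_{\underline i},\mathbf w^m_{\underline i}\in\mathbb R^3$ and $\varphi_h^m$; for $m=0,1,\dots$ and $\underline i\in\{1,\dots,N\}^n$, $$D_t\mathbf d^m_{\underline i}=\mathbf d^{m+1/2}_{\underline i}\times\mathbf w^{m+1/2}_{\underline i},$$ $$\sigma D_t\mathbf w^m_{\underline i}=k\Delta_h\mathbf d^{m+1/2}_{\underline i}\times\mathbf d^{m+1/2}_{\underline i}-\alpha\mathbf w^{m+1/2}_{\underline i}+\frac{\epsilon_1}{2|\mathcal C_{\underline i}|}\int_{\mathcal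 C_{\underline i}}\Big((\nabla\varphi_h^{m+1}\cdot\mathbf d^{m+1/2}_{\underline i})\nabla\varphi_h^m+(\nabla\varphi_h^m\cdot\mathbf d^{m+1/2}_{\underline i})\nabla\varphi_h^{m+1}\Big)dx\times\mathbf d^{m+1/2}_{\underline i},$$ $$u_{0,h}^m\in V_h\ \text{ s.t. }\ a_h^m(u_{0,h}^m,v)=F^m(v)-a_h^m(\widetilde g_h^m,v)\ \ \forall v\in V_h,\qquad\varphi_h^m:=u_{0,h}^m+\widetilde g_h^m,$$ with $\mathbf d^m_{\underline i}=\mathbf d^m_{\underline i+\mathbf e_j}$ if $i_j=0$, $\mathbf d^m_{\underline i+\mathbf e_j}=\mathbf d^m_{\underline i}$ if $i_j=N$, and initial values $\mathbf d^0_{\underline i}=|\mathcal C_{\underline i}|^{-1}\int_{\mathcal C_{\underline i}}\mathbf d_0\,dx$, $\mathbf w^0_{\underline i}=|\mathcal C_{\underline i}|^{-1}\int_{\mathcal C_{\underline i}}\mathbf w_0\,dx$. Interpolations: $\mathbf d_h^m(x)=\mathbf d_{\underline i}^m$, $\mathbf w_h^m(x)=\mathbf w_{\underline i}^m$ for $x\in\mathcal C_{\underline i}$; for $t\in[t^m,t^{m+1})$: $\mathbf d_h(t,\cdot)=\mathbf d_h^m$, $\mathbf w_h(t,\cdot)=\mathbf w_h^m$, $\widehat{\mathbf w}_h(t,\cdot)=\mathbf w_h^{m+1/2}$, $\varphi_h(t,\cdot)=\varphi_h^m$, $\widetilde g_h(t,\cdot)=\widetilde g_h^m$. *)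

theory Defs
  imports "HOL-Analysis.Analysis"
begin

section \<open>Function spaces\<close>

abbreviation Omega :: "(real ^ 'n) set"
  where "Omega \<equiv> cbox 0 1"

definition square_integrable :: "'a::euclidean_space set \<Rightarrow> ('a \<Rightarrow> 'b::euclidean_space) \<Rightarrow> bool"
  where "square_integrable S u \<longleftrightarrow>
    u \<in> borel_measurable (lebesgue_on S) \<and> integrable (lebesgue_on S) (\<lambda>x. (norm (u x))\<^sup>2)"

definition L2_norm :: "'a::euclidean_space set \<Rightarrow> ('a \<Rightarrow> 'b::euclidean_space) \<Rightarrow> real"
  where "L2_norm S u = sqrt (\<integral>x. (norm (u x))\<^sup>2 \<partial>lebesgue_on S)"

definition dir_deriv :: "'a::euclidean_space \<Rightarrow> ('a \<Rightarrow> real) \<Rightarrow> 'a \<Rightarrow> real"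
  where "dir_deriv b u = (\<lambda>x. frechet_derivative u (at x) b)"

text \<open>\<open>C\<^sub>c\<^sup>\<infinity>(U)\<close> for open \<open>U\<close>: all iterated partial derivatives exist and are
  differentiable everywhere, and the support is a compact subset of \<open>U\<close>.\<close>

definition test_function :: "'a::euclidean_space set \<Rightarrow> ('a \<Rightarrow> real) \<Rightarrow> bool"
  where "test_function U \<psi> \<longleftrightarrow>
    (\<forall>bs x. set bs \<subseteq> Basis \<longrightarrow> foldr dir_deriv bs \<psi> differentiable (at x)) \<and>
    compact (closure {x. \<psi> x \<noteq> 0}) \<and> closure {x. \<psi> x \<noteq> 0} \<subseteq> U"

text \<open>\<open>u \<in> H\<^sup>1(Omega)\<close> with weak gradient \<open>G\<close>, whose \<open>j\<close>-th entry is the weak partial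
  derivative of \<open>u\<close> in direction \<open>j\<close>. The norm on \<open>'b ^ 'n\<close> is the Frobenius norm when \<open>u\<close> is
  vector valued.\<close>

definition H1_with_gradient ::
    "(real ^ 'n \<Rightarrow> 'b::euclidean_space) \<Rightarrow> (real ^ 'n \<Rightarrow> 'b ^ 'n) \<Rightarrow> bool"
  where "H1_with_gradient u G \<longleftrightarrow>
    square_integrable Omega u \<and> square_integrable Omega G \<and>
    (\<forall>\<psi> j. test_function (interior Omega) \<psi> \<longrightarrow>
      (\<integral>x. dir_deriv (axis j 1) \<psi> x *\<^sub>R u x \<partial>lebesgue_on Omega) =
      - (\<integral>x. \<psi> x *\<^sub>R (G x $ j) \<partial>lebesgue_on Omega))"

text \<open>A time dependent function is a map \<open>u t x\<close>. Elements of \<open>L\<^sup>2(0,T;L\<^sup>2(Omega))\<close> are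
  represented by jointly measurable functions on the space-time cylinder.\<close>

definition L2_L2 :: "real \<Rightarrow> (real \<Rightarrow> real ^ 'n \<Rightarrow> 'b::euclidean_space) \<Rightarrow> bool"
  where "L2_L2 T u \<longleftrightarrow> square_integrable ({0..T} \<times> Omega) (\<lambda>(t, x). u t x)"

definition L2_H1 ::
    "real \<Rightarrow> (real \<Rightarrow> real ^ 'n \<Rightarrow> real) \<Rightarrow> (real \<Rightarrow> real ^ 'n \<Rightarrow> real ^ 'n) \<Rightarrow> bool"
  where "L2_H1 T u G \<longleftrightarrow> L2_L2 T u \<and> L2_L2 T G \<and>
    (AE t in lebesgue_on {0..T}. H1_with_gradient (u t) (G t))"

definition weak_time_deriv ::
    "real \<Rightarrow> (real \<Rightarrow> real ^ 'n \<Rightarrow> 'b::euclidean_space) \<Rightarrow> (real \<Rightarrow> real ^ 'n \<Rightarrow> 'b) \<Rightarrow> bool"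
  where "weak_time_deriv T u u' \<longleftrightarrow>
    (\<forall>\<psi>. test_function {0<..<T} \<psi> \<longrightarrow>
      (AE x in lebesgue_on Omega.
        (\<integral>t. deriv \<psi> t *\<^sub>R u t x \<partial>lebesgue_on {0..T}) =
        - (\<integral>t. \<psi> t *\<^sub>R u' t x \<partial>lebesgue_on {0..T})))"

definition continuous_in_L2 :: "real \<Rightarrow> (real \<Rightarrow> real ^ 'n \<Rightarrow> 'b::euclidean_space) \<Rightarrow> bool"
  where "continuous_in_L2 T u \<longleftrightarrow>
    (\<forall>t\<in>{0..T}. square_integrable Omega (u t)) \<and>
    (\<forall>s\<in>{0..T}. ((\<lambda>t. L2_norm Omega (\<lambda>x. u t x - u s x)) \<longlongrightarrow> 0) (at s within {0..T}))"

text \<open>\<open>W\<^sup>1\<^sup>,\<^sup>2\<close> in time embeds into the continuous functions in time; the predicates below select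
  the continuous representative, since the scheme uses the values at the times \<open>m * dt\<close>.\<close>

definition W12_L2 :: "real \<Rightarrow> (real \<Rightarrow> real ^ 'n \<Rightarrow> real) \<Rightarrow> bool"
  where "W12_L2 T u \<longleftrightarrow> L2_L2 T u \<and> continuous_in_L2 T u \<and>
    (\<exists>u'. L2_L2 T u' \<and> weak_time_deriv T u u')"

definition W12_H1 :: "real \<Rightarrow> (real \<Rightarrow> real ^ 'n \<Rightarrow> real) \<Rightarrow> bool"
  where "W12_H1 T u \<longleftrightarrow>
    (\<exists>G. L2_H1 T u G \<and> continuous_in_L2 T u \<and> continuous_in_L2 T G \<and>
      (\<forall>t\<in>{0..T}. H1_with_gradient (u t) (G t)) \<and>
      (\<exists>u' G'. L2_H1 T u' G' \<and> weak_time_deriv T u u'))"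

definition Linf_H1 :: "real \<Rightarrow> (real \<Rightarrow> real ^ 'n \<Rightarrow> real) \<Rightarrow> bool"
  where "Linf_H1 T u \<longleftrightarrow>
    (\<exists>G B. L2_H1 T u G \<and>
      (AE t in lebesgue_on {0..T}. (L2_norm Omega (u t))\<^sup>2 + (L2_norm Omega (G t))\<^sup>2 \<le> B))"


section \<open>Finite elements\<close>

definition nodes :: "(real ^ 'n) set set \<Rightarrow> (real ^ 'n) set"
  where "nodes \<T> = (\<Union>S\<in>\<T>. {v. v extreme_point_of S})"

definition mesh_size :: "(real ^ 'n) set set \<Rightarrow> real"
  where "mesh_size \<T> = Max (diameter ` \<T>)"

text \<open>A family of triangulations of \<open>Omega\<close>, indexed by \<open>N = 1/h\<close>, with constants for shape
  regularity and for the comparison of the mesh size with \<open>h\<close> that are uniform in \<open>N\<close>.\<close>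

definition uniform_triangulations :: "(nat \<Rightarrow> (real ^ 'n) set set) \<Rightarrow> bool"
  where "uniform_triangulations \<T> \<longleftrightarrow>
    (\<forall>N\<ge>1. triangulation (\<T> N) \<and> (\<forall>S\<in>\<T> N. int CARD('n) simplex S) \<and> \<Union>(\<T> N) = Omega) \<and>
    (\<exists>\<kappa>>0. \<forall>N\<ge>1. \<forall>S\<in>\<T> N. \<exists>x r. r > 0 \<and> ball x r \<subseteq> S \<and> diameter S \<le> \<kappa> * r) \<and>
    (\<exists>c\<^sub>1>0. \<exists>c\<^sub>2>0. \<forall>N\<ge>1. c\<^sub>1 / real N \<le> mesh_size (\<T> N) \<and> mesh_size (\<T> N) \<le> c\<^sub>2 / real N)"

text \<open>Hat functions are defined on \<open>Omega\<close> only; the value 0 outside makes them unique as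
  functions on the whole space.\<close>

definition is_hat :: "(real ^ 'n) set set \<Rightarrow> real ^ 'n \<Rightarrow> (real ^ 'n \<Rightarrow> real) \<Rightarrow> bool"
  where "is_hat \<T> p b \<longleftrightarrow>
    continuous_on (\<Union>\<T>) b \<and>
    (\<forall>S\<in>\<T>. \<exists>a c. \<forall>x\<in>S. b x = a \<bullet> x + c) \<and>
    (\<forall>q\<in>nodes \<T>. b q = (if q = p then 1 else 0)) \<and>
    (\<forall>x. x \<notin> \<Union>\<T> \<longrightarrow> b x = 0)"

definition hat :: "(real ^ 'n) set set \<Rightarrow> real ^ 'n \<Rightarrow> real ^ 'n \<Rightarrow> real"
  where "hat \<T> p = (THE b. is_hat \<T> p b)"

definition V :: "(real ^ 'n) set set \<Rightarrow> (real ^ 'n \<Rightarrow> real) set"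
  where "V \<T> = {v. \<exists>c. v = (\<lambda>x. \<Sum>p\<in>nodes \<T> \<inter> interior Omega. c p * hat \<T> p x)}"

definition interpolant :: "(real ^ 'n) set set \<Rightarrow> (real ^ 'n \<Rightarrow> real) \<Rightarrow> real ^ 'n \<Rightarrow> real"
  where "interpolant \<T> u = (\<lambda>x. \<Sum>p\<in>nodes \<T>. u p * hat \<T> p x)"

text \<open>The gradient of a piecewise linear function; it is meaningful off the null set formed by the
  boundaries of the simplices.\<close>

definition grad :: "(real ^ 'n \<Rightarrow> real) \<Rightarrow> real ^ 'n \<Rightarrow> real ^ 'n"
  where "grad u x = (\<chi> j. frechet_derivative u (at x) (axis j 1))"

definition H1_norm :: "(real ^ 'n \<Rightarrow> real) \<Rightarrow> real"
  where "H1_norm u = sqrt ((L2_norm Omega u)\<^sup>2 + (L2_norm Omega (grad u))\<^sup>2)"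


section \<open>Finite differences\<close>

abbreviation step :: "nat \<Rightarrow> real"  (* the grid size h *)
  where "step N \<equiv> 1 / real N"

text \<open>Multi-indices are functions \<open>i :: 'n \<Rightarrow> nat\<close>.\<close>

definition all_indices :: "nat \<Rightarrow> ('n \<Rightarrow> nat) set"
  where "all_indices N = {i. \<forall>j. i j \<le> N + 1}"

definition interior_indices :: "nat \<Rightarrow> ('n \<Rightarrow> nat) set"
  where "interior_indices N = {i. \<forall>j. 1 \<le> i j \<and> i j \<le> N}"

definition cell :: "nat \<Rightarrow> ('n::finite \<Rightarrow> nat) \<Rightarrow> (real ^ 'n) set"
  where "cell N i = {x. \<forall>j. (real (i j) - 1) * step N < x $ j \<and> x $ j \<le> real (i j) * step N}"

definition cell_average ::
    "nat \<Rightarrow> (real ^ 'n \<Rightarrow> 'b::euclidean_space) \<Rightarrow> ('n::finite \<Rightarrow> nat) \<Rightarrow> 'b"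
  where "cell_average N u i =
    (1 / measure lebesgue (cell N i)) *\<^sub>R (\<integral>x. u x \<partial>lebesgue_on (cell N i))"

text \<open>The piecewise constant function with value \<open>a i\<close> on \<open>cell N i\<close> for interior \<open>i\<close>. The cells
  cover \<open>Omega\<close> up to a null set, on which the value is 0.\<close>

definition piecewise_const ::
    "nat \<Rightarrow> (('n::finite \<Rightarrow> nat) \<Rightarrow> 'b::real_vector) \<Rightarrow> real ^ 'n \<Rightarrow> 'b"
  where "piecewise_const N a x = (\<Sum>i\<in>interior_indices N. indicator (cell N i) x *\<^sub>R a i)"

definition forward_diff ::
    "nat \<Rightarrow> 'n \<Rightarrow> (('n \<Rightarrow> nat) \<Rightarrow> 'b::real_vector) \<Rightarrow> ('n \<Rightarrow> nat) \<Rightarrow> 'b"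
  where "forward_diff N j a i = (1 / step N) *\<^sub>R (a (i(j := i j + 1)) - a i)"

definition backward_diff ::
    "nat \<Rightarrow> 'n \<Rightarrow> (('n \<Rightarrow> nat) \<Rightarrow> 'b::real_vector) \<Rightarrow> ('n \<Rightarrow> nat) \<Rightarrow> 'b"
  where "backward_diff N j a i = (1 / step N) *\<^sub>R (a i - a (i(j := i j - 1)))"

text \<open>On interior indices \<open>D\<^sup>+D\<^sup>-\<close> and \<open>D\<^sup>-D\<^sup>+\<close> coincide.\<close>

definition discrete_laplacian ::
    "nat \<Rightarrow> (('n::finite \<Rightarrow> nat) \<Rightarrow> 'b::real_vector) \<Rightarrow> ('n \<Rightarrow> nat) \<Rightarrow> 'b"
  where "discrete_laplacian N a i =
    (\<Sum>j\<in>UNIV. forward_diff N j (\<lambda>i'. backward_diff N j a i') i)"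

definition time_diff :: "real \<Rightarrow> (nat \<Rightarrow> 'b::real_vector) \<Rightarrow> nat \<Rightarrow> 'b"
  where "time_diff dt a m = (1 / dt) *\<^sub>R (a (m + 1) - a m)"

definition midpoint_avg :: "(nat \<Rightarrow> 'b::real_vector) \<Rightarrow> nat \<Rightarrow> 'b"
  where "midpoint_avg a m = (1 / 2) *\<^sub>R (a m + a (m + 1))"

text \<open>The function of time equal to \<open>a m\<close> on \<open>[m * dt, (m + 1) * dt)\<close>.\<close>

definition piecewise_in_time :: "real \<Rightarrow> (nat \<Rightarrow> 'b) \<Rightarrow> real \<Rightarrow> 'b"
  where "piecewise_in_time dt a t = a (nat \<lfloor>t / dt\<rfloor>)"


section \<open>The scheme\<close>

text \<open>Extension of vectors of dimension \<open>n\<close> by zeros to three dimensions. The injection \<open>e\<close> says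
  which coordinate of the three-dimensional space each of the \<open>n\<close> coordinates is; for \<open>n = 3\<close> it is
  a bijection.\<close>

definition embed :: "('n \<Rightarrow> 3) \<Rightarrow> real ^ 'n \<Rightarrow> real ^ 3"
  where "embed e v = (\<Sum>j\<in>UNIV. (v $ j) *\<^sub>R axis (e j) 1)"

definition a_form ::
    "('n \<Rightarrow> 3) \<Rightarrow> real \<Rightarrow> (real ^ 'n \<Rightarrow> real ^ 3) \<Rightarrow> (real ^ 'n \<Rightarrow> real) \<Rightarrow> (real ^ 'n \<Rightarrow> real) \<Rightarrow> real"
  where "a_form e \<epsilon>\<^sub>2 dh u v =
    (\<integral>x. grad u x \<bullet> grad v x
        + \<epsilon>\<^sub>2 * (dh x \<bullet> embed e (grad u x)) * (dh x \<bullet> embed e (grad v x)) \<partial>lebesgue_on Omega)"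

text \<open>\<open>d\<close>, \<open>w\<close>, \<open>\<phi>\<close> solve the scheme on the time steps \<open>0, \<dots>, N\<^sub>T\<close>. The boundary data enter only
  through the nodal values of the extension \<open>g\<close>, which is an everywhere defined function.\<close>

definition scheme_solution ::
    "('n \<Rightarrow> 3) \<Rightarrow> real \<Rightarrow> real \<Rightarrow> real \<Rightarrow> real \<Rightarrow> real \<Rightarrow>
     real \<Rightarrow> nat \<Rightarrow> nat \<Rightarrow> (real ^ 'n) set set \<Rightarrow>
     (real \<Rightarrow> real ^ 'n \<Rightarrow> real) \<Rightarrow> (real \<Rightarrow> real ^ 'n \<Rightarrow> real) \<Rightarrow>
     (real ^ 'n \<Rightarrow> real ^ 3) \<Rightarrow> (real ^ 'n \<Rightarrow> real ^ 3) \<Rightarrow>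
     (nat \<Rightarrow> ('n \<Rightarrow> nat) \<Rightarrow> real ^ 3) \<Rightarrow> (nat \<Rightarrow> ('n \<Rightarrow> nat) \<Rightarrow> real ^ 3) \<Rightarrow>
     (nat \<Rightarrow> real ^ 'n \<Rightarrow> real) \<Rightarrow> bool"
  where "scheme_solution e k \<sigma> \<alpha> \<epsilon>\<^sub>1 \<epsilon>\<^sub>2 dt N\<^sub>T N \<T> f g d\<^sub>0 w\<^sub>0 d w \<phi> \<longleftrightarrow>
    (\<forall>m<N\<^sub>T. \<forall>i\<in>interior_indices N.
      let d' = midpoint_avg (\<lambda>m. d m i) m; w' = midpoint_avg (\<lambda>m. w m i) m;
          E = (\<lambda>m x. embed e (grad (\<phi> m) x))
      in time_diff dt (\<lambda>m. d m i) m = cross3 d' w' \<and>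
         \<sigma> *\<^sub>R time_diff dt (\<lambda>m. w m i) m =
           k *\<^sub>R cross3 (discrete_laplacian N (\<lambda>i. midpoint_avg (\<lambda>m. d m i) m) i) d'
           - \<alpha> *\<^sub>R w'
           + (\<epsilon>\<^sub>1 / (2 * measure lebesgue (cell N i))) *\<^sub>R
             cross3 (\<integral>x. (E (m + 1) x \<bullet> d') *\<^sub>R E m x + (E m x \<bullet> d') *\<^sub>R E (m + 1) x
                       \<partial>lebesgue_on (cell N i)) d') \<and>
    (\<forall>m\<le>N\<^sub>T. \<forall>i\<in>all_indices N. \<forall>j.
      (i j = 0 \<longrightarrow> d m i = d m (i(j := i j + 1))) \<and>
      (i j = N \<longrightarrow> d m (i(j := i j + 1)) = d m i)) \<and>
    (\<forall>i\<in>interior_indices N. d 0 i = cell_average N d\<^sub>0 i \<and> w 0 i = cell_average N w\<^sub>0 i) \<and>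
    (\<forall>m\<le>N\<^sub>T.
      let A = a_form e \<epsilon>\<^sub>2 (piecewise_const N (d m));
          gh = interpolant \<T> (g (real m * dt))
      in \<exists>u\<in>V \<T>.
        (\<forall>v\<in>V \<T>. A u v = (\<integral>x. f (real m * dt) x * v x \<partial>lebesgue_on Omega) - A gh v) \<and>
        \<phi> m = (\<lambda>x. u x + gh x))"

end

theory Submission
  imports Defs
begin

text \<open>Testing the angular momentum equation with \<open>w\<close> at the midpoint and the director equation with the
  discrete Laplacian gives an exact balance for the discrete energy. The electric term in it is a
  multiple of \<open>a\<^sup>m\<^sup>+\<^sup>1(\<phi>\<^sup>m, \<phi>\<^sup>m\<^sup>+\<^sup>1) - a\<^sup>m(\<phi>\<^sup>m, \<phi>\<^sup>m\<^sup>+\<^sup>1)\<close>, by polarisation of the quadratic expression in the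
  director. With the Galerkin equations at both time levels it becomes a telescoping difference of
  \<open>Q\<^sup>m = a\<^sup>m(\<phi>\<^sup>m, \<phi>\<^sup>m) - 2 a\<^sup>m(\<phi>\<^sup>m, g\<^sup>m)\<close> plus terms that are linear in the time differences of the data.
  The length of the directors is conserved and is at most 1 initially, so that the forms \<open>a\<^sup>m\<close> are
  uniformly coercive, and \<open>\<phi>\<^sup>m\<close> and \<open>Q\<^sup>m\<close> are controlled by \<open>f\<close> and \<open>g\<close> at the same time. Neither the sign of \<open>\<epsilon>\<^sub>1 / \<epsilon>\<^sub>2\<close>
  matters nor is Gronwall's inequality needed.\<close>

subsection \<open>Square integrable functions\<close>

text \<open>What makes the electric term summable is testing crosswise in time: the equation at
  level \<open>m + 1\<close> is tested with the homogeneous part at level \<open>m\<close>, and the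
  other way round. Beside \<open>Q\<close> this leaves only products of data differences with
  \<open>u\<close> and \<open>\<phi>\<close>, which the elliptic estimate bounds by the data, so
  that the energy never reappears on the right-hand side. Two obstacles lie outside this argument.
  The elliptic estimate needs a Poincare inequality whose constant does not depend on the mesh,
  while the gradient of a finite element function exists only almost everywhere; such functions are
  therefore extended by zero to Lipschitz functions on the whole space. And the energy at time 0 has
  to be bounded by the weak gradient of \<open>d\<^sub>0\<close>, which is accessible only through
  test functions; for this purpose explicit smooth functions are built whose derivatives are
  differences of approximate indicators of neighbouring cells.\<close>

abbreviation \<mu> :: "(real ^ 'n) measure"
  where "\<mu> \<equiv> lebesgue_on Omega"

abbreviation sqnorm :: "(real ^ 'n \<Rightarrow> 'b::euclidean_space) \<Rightarrow> real"
  where "sqnorm u \<equiv> (L2_norm Omega u)\<^sup>2"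

abbreviation mid :: "'a::real_vector \<Rightarrow> 'a \<Rightarrow> 'a"
  where "mid a b \<equiv> (1 / 2) *\<^sub>R (a + b)"

lemma L2_norm_power2: "(L2_norm S u)\<^sup>2 = (\<integral>x. (norm (u x))\<^sup>2 \<partial>lebesgue_on S)"
  unfolding L2_norm_def by (simp add: integral_nonneg_AE)

lemma L2_norm_cong_AE:
  assumes "AE x in lebesgue_on S. norm (u x) = norm (v x)"
    and "u \<in> borel_measurable (lebesgue_on S)" "v \<in> borel_measurable (lebesgue_on S)"
  shows "L2_norm S u = L2_norm S v"
  unfolding L2_norm_def
  by (rule arg_cong[where f=sqrt], rule integral_cong_AE) (use assms in auto)

lemma square_integrable_measurable:
  "square_integrable S u \<Longrightarrow> u \<in> borel_measurable (lebesgue_on S)"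
  by (simp add: square_integrable_def)

lemma square_integrable_integrable:
  "square_integrable S u \<Longrightarrow> integrable (lebesgue_on S) (\<lambda>x. (norm (u x))\<^sup>2)"
  by (simp add: square_integrable_def)

lemma square_integrable_bound:
  assumes v: "square_integrable S v"
    and u: "u \<in> borel_measurable (lebesgue_on S)"
    and le: "AE x in lebesgue_on S. norm (u x) \<le> norm (v x)"
  shows "square_integrable S u"
  unfolding square_integrable_def
proof (intro conjI u)
  show "integrable (lebesgue_on S) (\<lambda>x. (norm (u x))\<^sup>2)"
    using le by (intro Bochner_Integration.integrable_bound[OF square_integrable_integrable[OF v]])
      (use u in \<open>auto intro: power_mono\<close>)
qed

lemma square_integrable_cong_AE:
  assumes "square_integrable S v" "AE x in lebesgue_on S. u x = v x"
    and "u \<in> borel_measurable (lebesgue_on S)"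
  shows "square_integrable S u"
  by (rule square_integrable_bound[OF assms(1,3)]) (use assms(2) in auto)

lemma square_integrable_const:
  assumes "S \<in> lmeasurable"
  shows "square_integrable S (\<lambda>x. c)"
proof -
  interpret finite_measure "lebesgue_on S"
    using assms by (rule finite_measure_lebesgue_on)
  show ?thesis by (simp add: square_integrable_def)
qed

lemma square_integrable_scaleR:
  assumes "square_integrable S u" shows "square_integrable S (\<lambda>x. c *\<^sub>R u x)"
  using assms by (auto simp: square_integrable_def power_mult_distrib)

lemma norm_add_power2_le: "(norm (a + b))\<^sup>2 \<le> 2 * (norm a)\<^sup>2 + 2 * (norm b)\<^sup>2"
  using power_mono[OF norm_triangle_ineq norm_ge_zero, of a b 2] sum_squares_bound[of "norm a" "norm b"]
  by (simp add: power2_sum)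

lemma square_integrable_add:
  assumes "square_integrable S u" "square_integrable S v"
  shows "square_integrable S (\<lambda>x. u x + v x)"
  unfolding square_integrable_def
proof (intro conjI)
  show "(\<lambda>x. u x + v x) \<in> borel_measurable (lebesgue_on S)"
    using assms by (auto simp: square_integrable_def)
  show "integrable (lebesgue_on S) (\<lambda>x. (norm (u x + v x))\<^sup>2)"
    by (rule Bochner_Integration.integrable_bound
        [where f="\<lambda>x. 2 * (norm (u x))\<^sup>2 + 2 * (norm (v x))\<^sup>2"])
      (use assms norm_add_power2_le in \<open>auto simp: square_integrable_def\<close>)
qed

lemma square_integrable_diff:
  assumes "square_integrable S u" "square_integrable S v"
  shows "square_integrable S (\<lambda>x. u x - v x)"
  using square_integrable_add[OF assms(1) square_integrable_scaleR[OF assms(2), of "-1"]] by simp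

lemma square_integrable_norm:
  "square_integrable S u \<Longrightarrow> square_integrable S (\<lambda>x. norm (u x))"
  by (auto simp: square_integrable_def)

text \<open>The weight \<open>s\<close> is free so that later estimates can absorb one of the two
  squares on their left-hand side.\<close>

lemma young_inner:
  fixes a b :: "'a::real_inner"
  assumes "s > 0"
  shows "2 * \<bar>a \<bullet> b\<bar> \<le> s * (norm a)\<^sup>2 + (norm b)\<^sup>2 / s"
proof -
  have "2 * (s * norm a * norm b) \<le> (s * norm a)\<^sup>2 + (norm b)\<^sup>2"
    using sum_squares_bound[of "s * norm a" "norm b"] by (simp add: algebra_simps)
  then have "2 * (norm a * norm b) \<le> s * (norm a)\<^sup>2 + (norm b)\<^sup>2 / s"
    using assms by (simp add: field_simps power2_eq_square)
  then show ?thesis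
    using Cauchy_Schwarz_ineq2[of a b] by linarith
qed

lemma square_integrable_inner:
  assumes "square_integrable S u" "square_integrable S v"
  shows "integrable (lebesgue_on S) (\<lambda>x. u x \<bullet> v x)"
proof (rule Bochner_Integration.integrable_bound[where f="\<lambda>x. (norm (u x))\<^sup>2 + (norm (v x))\<^sup>2"])
  show "integrable (lebesgue_on S) (\<lambda>x. (norm (u x))\<^sup>2 + (norm (v x))\<^sup>2)"
    using assms by (auto simp: square_integrable_def)
  show "(\<lambda>x. u x \<bullet> v x) \<in> borel_measurable (lebesgue_on S)"
    using assms by (auto simp: square_integrable_def)
  show "AE x in lebesgue_on S. norm (u x \<bullet> v x) \<le> norm ((norm (u x))\<^sup>2 + (norm (v x))\<^sup>2)"
  proof (rule AE_I2)
    fix x show "norm (u x \<bullet> v x) \<le> norm ((norm (u x))\<^sup>2 + (norm (v x))\<^sup>2)"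
      using young_inner[of 1 "u x" "v x"] by auto
  qed
qed

lemmas square_integrable_mult = square_integrable_inner[where 'b=real, unfolded inner_real_def]

lemma square_integrable_imp_integrable:
  assumes "S \<in> lmeasurable" "square_integrable S u"
  shows "integrable (lebesgue_on S) u"
proof -
  have "integrable (lebesgue_on S) (\<lambda>x. norm (u x) * 1)"
    by (rule square_integrable_mult[OF square_integrable_norm[OF assms(2)] square_integrable_const[OF assms(1)]])
  then show ?thesis
    using assms(2) by (auto simp: square_integrable_def integrable_norm_iff)
qed

lemma integral_young:
  assumes "square_integrable S u" "square_integrable S v" "s > 0"
  shows "2 * \<bar>\<integral>x. u x \<bullet> v x \<partial>lebesgue_on S\<bar>
    \<le> s * (\<integral>x. (norm (u x))\<^sup>2 \<partial>lebesgue_on S) + (\<integral>x. (norm (v x))\<^sup>2 \<partial>lebesgue_on S) / s"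
proof -
  let ?M = "lebesgue_on S"
  have i: "integrable ?M (\<lambda>x. (norm (u x))\<^sup>2)" "integrable ?M (\<lambda>x. (norm (v x))\<^sup>2)"
    using assms by (auto simp: square_integrable_def)
  have "2 * \<bar>\<integral>x. u x \<bullet> v x \<partial>?M\<bar> \<le> (\<integral>x. 2 * \<bar>u x \<bullet> v x\<bar> \<partial>?M)"
    using integral_norm_bound[of ?M "\<lambda>x. u x \<bullet> v x"] by simp
  also have "\<dots> \<le> (\<integral>x. s * (norm (u x))\<^sup>2 + (norm (v x))\<^sup>2 / s \<partial>?M)"
    using i square_integrable_inner[OF assms(1,2)] young_inner[OF assms(3)]
    by (intro integral_mono) auto
  also have "\<dots> = s * (\<integral>x. (norm (u x))\<^sup>2 \<partial>?M) + (\<integral>x. (norm (v x))\<^sup>2 \<partial>?M) / s"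
    using i by simp
  finally show ?thesis .
qed

lemma Omega_lmeasurable [simp]: "Omega \<in> lmeasurable"
  by (rule lmeasurable_cbox)

subsection \<open>Piecewise linear functions on a triangulation\<close>

text \<open>The vertices are affinely independent, so their differences to one vertex
  \<open>p\<close> are linearly independent and a linear functional can be prescribed on them;
  \<open>adjoint g 1\<close> is the vector that represents it. The case of no vertices is the empty
  simplex of dimension -1.\<close>

lemma affine_interpolation_simplex:
  fixes S :: "'a::euclidean_space set" and val :: "'a \<Rightarrow> real"
  assumes "n simplex S"
  shows "\<exists>a c. \<forall>v. v extreme_point_of S \<longrightarrow> a \<bullet> v + c = val v"
proof -
  obtain C where C: "\<not> affine_dependent C" "S = convex hull C"
    using assms by (auto simp: simplex_def)
  have ext: "v extreme_point_of S \<longleftrightarrow> v \<in> C" for v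
    using extreme_point_of_convex_hull_affine_independent[OF C(1)] C(2) by simp
  show ?thesis
  proof (cases "C = {}")
    case False
    then obtain p where p: "p \<in> C" by blast
    then have "independent ((\<lambda>x. -p + x) ` (C - {p}))"
      using affine_dependent_iff_dependent2[OF p] C(1) by simp
    then obtain g where g: "linear g"
      "\<forall>y\<in>(\<lambda>x. -p + x) ` (C - {p}). g y = val (y + p) - val p"
      using linear_independent_extend[of _ "\<lambda>y. val (y + p) - val p"] by blast
    have gv: "g v = g p + val v - val p" if "v \<in> C" for v
    proof (cases "v = p")
      case False
      then have "g (-p + v) = val v - val p"
        using g(2) that by force
      then show ?thesis
        using g(1) by (simp add: linear_diff)
    qed simp
    have "adjoint g 1 \<bullet> v + (val p - g p) = val v" if "v \<in> C" for v
      using adjoint_works[OF g(1), of v 1] gv[OF that] by (simp add: inner_commute)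
    then show ?thesis using ext by blast
  qed (use ext in auto)
qed

text \<open>The points where two affine functions agree form a convex set. If it contains the
  extreme points of \<open>F\<close>, it contains their hull, which is all of \<open>F\<close> by
  Minkowski's theorem. Gluing on common faces, uniqueness of hat functions and their vanishing at
  the boundary all reduce to this.\<close>

lemma affine_eq_on_compact_convex:
  fixes F :: "'a::euclidean_space set"
  assumes F: "compact F" "convex F" and x: "x \<in> F"
    and eq: "\<And>v. v extreme_point_of F \<Longrightarrow> a \<bullet> v + c = a' \<bullet> v + c'"
  shows "a \<bullet> x + c = a' \<bullet> x + c'"
proof -
  have "{x. a \<bullet> x + c = a' \<bullet> x + c'} = {x. (a - a') \<bullet> x = c' - c}"
    by (auto simp: algebra_simps)
  then have "convex {x. a \<bullet> x + c = a' \<bullet> x + c'}"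
    by (simp add: convex_hyperplane)
  then have "convex hull {x. x extreme_point_of F} \<subseteq> {x. a \<bullet> x + c = a' \<bullet> x + c'}"
    by (intro hull_minimal) (use eq in auto)
  then show ?thesis
    using Krein_Milman_Minkowski[OF F] x by blast
qed

section \<open>Gradients that exist almost everywhere\<close>

lemma grad_unique:
  assumes "(u has_derivative (\<lambda>h. a \<bullet> h)) (at x)"
  shows "grad u x = a"
  unfolding grad_def frechet_derivative_at[OF assms, symmetric]
  by (simp add: vec_eq_iff inner_axis)

lemma has_derivative_grad:
  assumes "u differentiable (at x)"
  shows "(u has_derivative (\<lambda>h. grad u x \<bullet> h)) (at x)"
proof -
  let ?f = "frechet_derivative u (at x)"
  have lin: "linear ?f"
    using assms by (rule linear_frechet_derivative)
  have "grad u x \<bullet> h = ?f h" for h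
  proof -
    have "?f h = ?f (\<Sum>j\<in>UNIV. h $ j *\<^sub>R axis j 1)"
      using basis_expansion[of h] by (simp add: scalar_mult_eq_scaleR)
    also have "\<dots> = grad u x \<bullet> h"
      by (simp add: linear_sum[OF lin] linear_cmul[OF lin] grad_def inner_vec_def mult.commute)
    finally show ?thesis by simp
  qed
  then have "(\<lambda>h. grad u x \<bullet> h) = ?f" by blast
  then show ?thesis
    using assms by (simp only: frechet_derivative_works[symmetric])
qed

lemma grad_add:
  assumes "u differentiable (at x)" "v differentiable (at x)"
  shows "grad (\<lambda>x. u x + v x) x = grad u x + grad v x"
proof (rule grad_unique)
  have "((\<lambda>x. u x + v x) has_derivative (\<lambda>h. grad u x \<bullet> h + grad v x \<bullet> h)) (at x)"
    by (intro has_derivative_add has_derivative_grad assms)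
  then show "((\<lambda>x. u x + v x) has_derivative (\<bullet>) (grad u x + grad v x)) (at x)"
    by (simp add: inner_add_left[abs_def])
qed

lemma grad_scale:
  assumes "u differentiable (at x)"
  shows "grad (\<lambda>x. c * u x) x = c *\<^sub>R grad u x"
proof (rule grad_unique)
  have "((\<lambda>x. c * u x) has_derivative (\<lambda>h. c * (grad u x \<bullet> h))) (at x)"
    by (intro has_derivative_mult_right has_derivative_grad assms)
  then show "((\<lambda>x. c * u x) has_derivative (\<bullet>) (c *\<^sub>R grad u x)) (at x)"
    by (simp add: inner_scaleR_left[abs_def])
qed

text \<open>The gradient is the one that exists almost everywhere. The predicate is applied to continuous
  piecewise linear functions only, for which it is the weak gradient.\<close>

definition sobolev :: "(real ^ 'n \<Rightarrow> real) \<Rightarrow> bool"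
  where "sobolev u \<longleftrightarrow> square_integrable Omega u \<and> square_integrable Omega (grad u) \<and>
    (AE x in \<mu>. u differentiable (at x))"

lemma sobolev_grad_add:
  assumes "sobolev u" "sobolev v"
  shows "AE x in \<mu>. grad (\<lambda>x. u x + v x) x = grad u x + grad v x"
proof -
  have "AE x in \<mu>. u differentiable (at x)" "AE x in \<mu>. v differentiable (at x)"
    using assms by (auto simp: sobolev_def)
  then show ?thesis by eventually_elim (rule grad_add)
qed

lemma sobolev_grad_scale:
  assumes "sobolev u"
  shows "AE x in \<mu>. grad (\<lambda>x. c * u x) x = c *\<^sub>R grad u x"
proof -
  have "AE x in \<mu>. u differentiable (at x)"
    using assms by (auto simp: sobolev_def)
  then show ?thesis by eventually_elim (rule grad_scale)
qed

text \<open>The functions differ on a null set only, and by completeness all its subsets are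
  measurable. This serves gradients of sums: they are known to be sums of gradients where both
  summands are differentiable, and nothing is known about their measurability on the rest.\<close>

lemma borel_measurable_lebesgue_cong_AE:
  fixes f g :: "'a::euclidean_space \<Rightarrow> 'b::topological_space"
  assumes f: "f \<in> borel_measurable lebesgue" and ae: "AE x in lebesgue. f x = g x"
  shows "g \<in> borel_measurable lebesgue"
proof (rule measurableI)
  obtain N where N: "N \<in> null_sets lebesgue" "{x. f x \<noteq> g x} \<subseteq> N"
    using ae by (auto simp: eventually_ae_filter)
  fix B :: "'b set" assume "B \<in> sets borel"
  then have "f -` B - N \<in> sets lebesgue"
    using measurable_sets[OF f, of B] N(1) by (auto intro: sets.Diff null_setsD2)
  moreover have "g -` B \<inter> N \<in> sets lebesgue"
    using completion.complete2[of "g -` B \<inter> N" N] N(1) by auto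
  moreover have eq: "f x = g x" if "x \<notin> N" for x
    using N(2) that by blast
  have g_eq: "g -` B \<inter> space lebesgue = (f -` B - N) \<union> (g -` B \<inter> N)"
    using eq by auto
  ultimately show "g -` B \<inter> space lebesgue \<in> sets lebesgue"
    unfolding g_eq by (intro sets.Un)
qed auto

lemma square_integrable_cong_AE_lebesgue:
  assumes v: "square_integrable S v" and S: "S \<in> sets lebesgue"
    and ae: "AE x in lebesgue_on S. u x = v x"
  shows "square_integrable S u"
proof (rule square_integrable_cong_AE[OF v ae])
  have "AE x in lebesgue. indicator S x *\<^sub>R v x = indicator S x *\<^sub>R u x"
    using ae S by (auto simp: AE_restrict_space_iff indicator_def)
  moreover have "(\<lambda>x. indicator S x *\<^sub>R v x) \<in> borel_measurable lebesgue"
    using v S by (simp add: square_integrable_def borel_measurable_restrict_space_iff mult.commute)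
  ultimately have "(\<lambda>x. indicator S x *\<^sub>R u x) \<in> borel_measurable lebesgue"
    by (rule borel_measurable_lebesgue_cong_AE[rotated])
  then show "u \<in> borel_measurable (lebesgue_on S)"
    using S by (simp add: borel_measurable_restrict_space_iff)
qed

lemma sobolev_add:
  assumes "sobolev u" "sobolev v" shows "sobolev (\<lambda>x. u x + v x)"
  unfolding sobolev_def
proof (intro conjI)
  show "square_integrable Omega (\<lambda>x. u x + v x)"
    using assms by (auto simp: sobolev_def intro: square_integrable_add)
  show "square_integrable Omega (grad (\<lambda>x. u x + v x))"
    using assms by (intro square_integrable_cong_AE_lebesgue[OF _ _ sobolev_grad_add])
      (auto simp: sobolev_def intro: square_integrable_add)
  have "AE x in \<mu>. u differentiable (at x)" "AE x in \<mu>. v differentiable (at x)"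
    using assms by (auto simp: sobolev_def)
  then show "AE x in \<mu>. (\<lambda>x. u x + v x) differentiable (at x)"
    by eventually_elim (rule differentiable_add)
qed

lemma sobolev_scale:
  assumes "sobolev u" shows "sobolev (\<lambda>x. c * u x)"
  unfolding sobolev_def
proof (intro conjI)
  show "square_integrable Omega (\<lambda>x. c * u x)"
    using assms square_integrable_scaleR[of Omega u c] by (auto simp: sobolev_def)
  show "square_integrable Omega (grad (\<lambda>x. c * u x))"
    using assms by (intro square_integrable_cong_AE_lebesgue[OF _ _ sobolev_grad_scale])
      (auto simp: sobolev_def intro: square_integrable_scaleR)
  have "AE x in \<mu>. u differentiable (at x)"
    using assms by (auto simp: sobolev_def)
  then show "AE x in \<mu>. (\<lambda>x. c * u x) differentiable (at x)"
    by eventually_elim (auto intro: differentiable_mult)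
qed

lemma sobolev_zero: "sobolev (\<lambda>x. 0)"
proof -
  have "grad (\<lambda>x::real^'a. 0::real) = (\<lambda>x. 0)"
    by (rule ext, rule grad_unique) simp
  then show ?thesis
    by (simp add: sobolev_def square_integrable_const)
qed

lemma sobolev_sum:
  assumes "finite I" "\<And>i. i \<in> I \<Longrightarrow> sobolev (u i)"
  shows "sobolev (\<lambda>x. \<Sum>i\<in>I. c i * u i x)"
  using assms
proof (induction I)
  case (insert i I)
  then show ?case
    using sobolev_add[OF sobolev_scale[of "u i" "c i"] insert.IH] by simp
qed (simp add: sobolev_zero)

section \<open>Hat functions: existence, uniqueness and regularity\<close>

locale mesh =
  fixes \<T> :: "(real ^ 'n) set set"
  assumes triangulation: "triangulation \<T>" and cover: "\<Union>\<T> = Omega"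
begin

lemma finite_mesh: "finite \<T>"
  using triangulation by (simp add: triangulation_def)

lemma element:
  assumes "S \<in> \<T>"
  shows "compact S" "convex S" "closed S" "S \<subseteq> Omega" "finite {v. v extreme_point_of S}"
proof -
  obtain n where "n simplex S"
    using assms triangulation by (auto simp: triangulation_def)
  then show "compact S" "convex S" "closed S"
    by (auto intro: compact_simplex convex_simplex closed_simplex)
  show "S \<subseteq> Omega" using assms cover by blast
  show "finite {v. v extreme_point_of S}"
    using \<open>n simplex S\<close> by (intro finite_polyhedron_extreme_points simplex_imp_polyhedron)
qed

lemma finite_nodes: "finite (nodes \<T>)"
  using finite_mesh element(5) by (auto simp: nodes_def)

text \<open>The affine interpolants on two simplices agree where these meet: the intersection is a
  face of both, so its extreme points are vertices of both, and there the nodal values coincide.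
  Hence the pieces glue to a continuous function.\<close>

lemma ex_is_hat: "\<exists>b. is_hat \<T> p b"
proof -
  define val :: "real ^ 'n \<Rightarrow> real" where "val = (\<lambda>q. if q = p then 1 else 0)"
  have "\<forall>S\<in>\<T>. \<exists>a c. \<forall>v. v extreme_point_of S \<longrightarrow> a \<bullet> v + c = val v"
  proof
    fix S assume "S \<in> \<T>"
    then obtain n where "n simplex S"
      using triangulation by (auto simp: triangulation_def)
    then show "\<exists>a c. \<forall>v. v extreme_point_of S \<longrightarrow> a \<bullet> v + c = val v"
      by (rule affine_interpolation_simplex)
  qed
  then obtain a c where ac: "\<And>S v. S \<in> \<T> \<Longrightarrow> v extreme_point_of S \<Longrightarrow> a S \<bullet> v + c S = val v"
    by metis
  \<comment> \<open>Which simplex \<open>SOME\<close> picks does not matter, since the interpolants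
    agree on overlaps.\<close>
  define b where "b = (\<lambda>x. if x \<in> \<Union>\<T> then let S = SOME S. S \<in> \<T> \<and> x \<in> S in a S \<bullet> x + c S else 0)"
  have agree: "a S \<bullet> x + c S = a S' \<bullet> x + c S'" if "S \<in> \<T>" "S' \<in> \<T>" "x \<in> S" "x \<in> S'" for S S' x
  proof (rule affine_eq_on_compact_convex)
    have F: "S \<inter> S' face_of S" "S' \<inter> S face_of S'"
      using triangulation that unfolding triangulation_def by blast+
    show "compact (S \<inter> S')" "convex (S \<inter> S')"
      using that element by (auto intro: convex_Int compact_Int)
    show "x \<in> S \<inter> S'" using that by simp
    fix v assume v: "v extreme_point_of S \<inter> S'"
    then show "a S \<bullet> v + c S = a S' \<bullet> v + c S'"
    proof -
      have "v extreme_point_of S"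
        using extreme_point_of_face[OF F(1)] v by blast
      moreover have "v extreme_point_of S'"
        using extreme_point_of_face[OF F(2)] v by (simp add: Int_commute)
      ultimately show ?thesis using ac that by simp
    qed
  qed
  have b: "b x = a S \<bullet> x + c S" if "S \<in> \<T>" "x \<in> S" for S x
  proof -
    have *: "(SOME S. S \<in> \<T> \<and> x \<in> S) \<in> \<T> \<and> x \<in> (SOME S. S \<in> \<T> \<and> x \<in> S)"
      by (rule someI[of "\<lambda>S. S \<in> \<T> \<and> x \<in> S" S]) (use that in auto)
    have "b x = a (SOME S. S \<in> \<T> \<and> x \<in> S) \<bullet> x + c (SOME S. S \<in> \<T> \<and> x \<in> S)"
      using that by (auto simp: b_def Let_def)
    also have "\<dots> = a S \<bullet> x + c S"
      by (rule agree) (use * that in auto)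
    finally show ?thesis .
  qed
  have "is_hat \<T> p b"
    unfolding is_hat_def
  proof (intro conjI ballI allI impI)
    have "continuous_on (\<Union>S\<in>\<T>. S) b"
    proof (rule continuous_on_closed_Union[OF finite_mesh])
      fix S assume S: "S \<in> \<T>"
      then show "closed S" by (rule element)
      have "continuous_on S (\<lambda>x. a S \<bullet> x + c S)"
        by (intro continuous_intros)
      then show "continuous_on S b"
        using b[OF S] by (simp cong: continuous_on_cong)
    qed
    then show "continuous_on (\<Union>\<T>) b" by simp
    show "\<exists>a c. \<forall>x\<in>S. b x = a \<bullet> x + c" if "S \<in> \<T>" for S
      using b[OF that] by blast
    show "b q = (if q = p then 1 else 0)" if q: "q \<in> nodes \<T>" for q
    proof -
      obtain S where "S \<in> \<T>" "q extreme_point_of S"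
        using q by (auto simp: nodes_def)
      then show ?thesis
        using b[of S q] ac[of S q] by (auto simp: val_def extreme_point_of_def)
    qed
    show "b x = 0" if "x \<notin> \<Union>\<T>" for x
      using that by (simp add: b_def)
  qed
  then show ?thesis by blast
qed

text \<open>Together with existence this gives the definite description in \<open>hat\<close> its
  meaning.\<close>

lemma is_hat_unique:
  assumes "is_hat \<T> p b" "is_hat \<T> p b'"
  shows "b = b'"
proof
  fix x
  show "b x = b' x"
  proof (cases "x \<in> \<Union>\<T>")
    case True
    then obtain S where S: "S \<in> \<T>" "x \<in> S" by blast
    obtain a c a' c' where ac: "\<And>x. x \<in> S \<Longrightarrow> b x = a \<bullet> x + c" "\<And>x. x \<in> S \<Longrightarrow> b' x = a' \<bullet> x + c'"
      using assms[unfolded is_hat_def] S(1) by meson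
    have "a \<bullet> x + c = a' \<bullet> x + c'"
    proof (rule affine_eq_on_compact_convex[OF element(1,2)[OF S(1)] S(2)])
      fix v assume v: "v extreme_point_of S"
      then have "v \<in> nodes \<T>" "v \<in> S"
        using S by (auto simp: nodes_def extreme_point_of_def)
      then show "a \<bullet> v + c = a' \<bullet> v + c'"
        using assms ac[of v] by (simp add: is_hat_def)
    qed
    then show ?thesis using ac S by simp
  qed (use assms in \<open>auto simp: is_hat_def\<close>)
qed

lemma is_hat_hat: "is_hat \<T> p (hat \<T> p)"
proof -
  obtain b where "is_hat \<T> p b" using ex_is_hat by blast
  then show ?thesis
    unfolding hat_def by (rule theI[where P="is_hat \<T> p"]) (rule is_hat_unique[OF _ \<open>is_hat \<T> p b\<close>])
qed

lemma hat_affine: "S \<in> \<T> \<Longrightarrow> \<exists>a c. \<forall>x\<in>S. hat \<T> p x = a \<bullet> x + c"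
  using is_hat_hat[of p] unfolding is_hat_def by blast

lemma hat_continuous: "continuous_on Omega (hat \<T> p)"
  using is_hat_hat[of p] cover by (simp add: is_hat_def)

lemma hat_node: "q \<in> nodes \<T> \<Longrightarrow> hat \<T> p q = (if q = p then 1 else 0)"
  using is_hat_hat[of p] by (simp add: is_hat_def)

lemma hat_outside: "x \<notin> Omega \<Longrightarrow> hat \<T> p x = 0"
  using is_hat_hat[of p] cover by (simp add: is_hat_def)

text \<open>Frontiers of convex sets are negligible, and there are finitely many simplices.\<close>

lemma AE_interior: "AE x in \<mu>. \<exists>S\<in>\<T>. x \<in> interior S"
proof -
  have "negligible (\<Union>S\<in>\<T>. frontier S)"
    using finite_mesh element(2) by (auto intro!: negligible_Union negligible_convex_frontier)
  then have "AE x in lebesgue. x \<notin> (\<Union>S\<in>\<T>. frontier S)"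
    using AE_not_in negligible_iff_null_sets by blast
  then have "AE x in lebesgue. x \<in> Omega \<longrightarrow> (\<exists>S\<in>\<T>. x \<in> interior S)"
  proof eventually_elim
    case (elim x)
    show ?case
    proof
      assume "x \<in> Omega"
      then obtain S where S: "S \<in> \<T>" "x \<in> S" using cover by blast
      then have "x \<in> interior S"
        using elim element(3)[OF S(1)] by (auto simp: frontier_def)
      then show "\<exists>S\<in>\<T>. x \<in> interior S" using S by blast
    qed
  qed
  then show ?thesis by (simp add: AE_restrict_space_iff)
qed

lemma hat_has_derivative:
  assumes "S \<in> \<T>" "\<And>x. x \<in> S \<Longrightarrow> hat \<T> p x = a \<bullet> x + c" "x \<in> interior S"
  shows "(hat \<T> p has_derivative (\<lambda>h. a \<bullet> h)) (at x)"
proof (rule has_derivative_transform_within_open[where s="interior S" and f="\<lambda>x. a \<bullet> x + c"])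
  show "((\<lambda>x. a \<bullet> x + c) has_derivative (\<lambda>h. a \<bullet> h)) (at x)"
    by (auto intro!: derivative_eq_intros)
  show "a \<bullet> x + c = hat \<T> p x" if "x \<in> interior S" for x
    using that assms(2)[of x] interior_subset[of S] by (simp add: subset_iff)
qed (use assms in auto)

lemma sobolev_hat: "sobolev (hat \<T> p)"
  unfolding sobolev_def
proof (intro conjI)
  have "\<forall>S\<in>\<T>. \<exists>a. \<forall>x\<in>interior S. (hat \<T> p has_derivative (\<lambda>h. a \<bullet> h)) (at x)"
  proof
    fix S assume S: "S \<in> \<T>"
    obtain a c where "\<And>x. x \<in> S \<Longrightarrow> hat \<T> p x = a \<bullet> x + c"
      using hat_affine[OF S] by blast
    from hat_has_derivative[OF S this]
    show "\<exists>a. \<forall>x\<in>interior S. (hat \<T> p has_derivative (\<lambda>h. a \<bullet> h)) (at x)" by blast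
  qed
  then obtain a where a: "\<And>S x. S \<in> \<T> \<Longrightarrow> x \<in> interior S \<Longrightarrow> (hat \<T> p has_derivative (\<lambda>h. a S \<bullet> h)) (at x)"
    by metis
  show "square_integrable Omega (hat \<T> p)"
  proof -
    have "compact (hat \<T> p ` Omega)"
      by (intro compact_continuous_image hat_continuous compact_cbox)
    then have "bounded (hat \<T> p ` Omega)"
      by (rule compact_imp_bounded)
    then obtain B where "\<forall>y\<in>hat \<T> p ` Omega. norm y \<le> B"
      unfolding bounded_iff by (elim exE)
    then have B: "\<And>x. x \<in> Omega \<Longrightarrow> norm (hat \<T> p x) \<le> B"
      by simp
    show ?thesis
    proof (rule square_integrable_bound[OF square_integrable_const[of _ B]])
      show "hat \<T> p \<in> borel_measurable \<mu>"
        by (intro continuous_imp_measurable_on_sets_lebesgue hat_continuous) auto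
      show "AE x in \<mu>. norm (hat \<T> p x) \<le> norm B"
        using B by (intro AE_I2) (auto intro: order_trans[OF _ abs_ge_self])
    qed simp
  qed
  show "AE x in \<mu>. hat \<T> p differentiable (at x)"
    using AE_interior
  proof eventually_elim
    case (elim x)
    then show ?case using a unfolding differentiable_def by blast
  qed
  \<comment> \<open>Off the open simplices \<open>grad\<close> may take unspecified values. Set to 0
    there, it is constant on each of finitely many measurable pieces, hence measurable and
    bounded.\<close>
  define X where "X = (\<Union>S\<in>\<T>. interior S)"
  define G where "G = (\<lambda>x. if x \<in> X then grad (hat \<T> p) x else 0)"
  have G: "G x = a S" if "S \<in> \<T>" "x \<in> interior S" for x S
    using that grad_unique[OF a[OF that]] by (auto simp: G_def X_def)
  have "G \<in> borel_measurable lebesgue"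
  proof (rule measurable_piecewise_restrict)
    show "countable (insert (-X) (interior ` \<T>))"
      using finite_mesh by (auto intro: countable_finite)
    show "\<Omega> \<inter> space lebesgue \<in> sets lebesgue" if "\<Omega> \<in> insert (-X) (interior ` \<T>)" for \<Omega>
    proof -
      have "open X" by (auto simp: X_def)
      then have "X \<in> sets lebesgue" by simp
      then have "-X \<in> sets lebesgue" using sets.compl_sets[of X lebesgue] by (simp add: Compl_eq_Diff_UNIV)
      then show ?thesis using that by auto
    qed
    show "space lebesgue \<subseteq> \<Union>(insert (-X) (interior ` \<T>))"
      by (auto simp: X_def)
    show "G \<in> borel_measurable (restrict_space lebesgue \<Omega>)" if \<Omega>: "\<Omega> \<in> insert (-X) (interior ` \<T>)" for \<Omega>
    proof -
      have "\<exists>k. \<forall>x\<in>\<Omega>. G x = k"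
      proof (cases "\<Omega> = -X")
        case False
        then obtain S where "S \<in> \<T>" "\<Omega> = interior S" using \<Omega> by auto
        then show ?thesis using G by blast
      qed (simp add: G_def)
      then obtain k where "\<And>x. x \<in> \<Omega> \<Longrightarrow> G x = k" by blast
      then show ?thesis
        using measurable_cong[of "restrict_space lebesgue \<Omega>" G "\<lambda>x. k" borel]
        by (simp add: space_restrict_space)
    qed
  qed
  then have Gm: "G \<in> borel_measurable \<mu>"
    by (rule measurable_restrict_space1)
  have "finite (insert 0 (norm ` a ` \<T>))" using finite_mesh by simp
  from Max_ge[OF this] obtain B where B: "\<And>y. y \<in> insert 0 (norm ` a ` \<T>) \<Longrightarrow> y \<le> B"
    by (rule that)
  have "norm (G x) \<le> norm B" for x
  proof (cases "x \<in> X")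
    case True
    then obtain S where "S \<in> \<T>" "x \<in> interior S" by (auto simp: X_def)
    then show ?thesis using G B[of "norm (a S)"] by auto
  qed (simp add: G_def)
  then have "square_integrable Omega G"
    by (intro square_integrable_bound[OF square_integrable_const[of _ B] Gm]) auto
  then show "square_integrable Omega (grad (hat \<T> p))"
  proof (rule square_integrable_cong_AE_lebesgue)
    show "AE x in \<mu>. grad (hat \<T> p) x = G x"
      using AE_interior by eventually_elim (auto simp: G_def X_def)
  qed simp
qed

lemma sobolev_interpolant: "sobolev (interpolant \<T> u)"
  unfolding interpolant_def by (intro sobolev_sum finite_nodes sobolev_hat)

lemma sobolev_V: "u \<in> V \<T> \<Longrightarrow> sobolev u"
  unfolding V_def using finite_nodes by (auto intro!: sobolev_sum sobolev_hat)

end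

subsection \<open>The Poincare inequality\<close>

text \<open>Any two points are joined by a segment. Along it the closed pieces cover an interval,
  where Lipschitz functions on finitely many closed pieces glue without loss in the
  constant.\<close>

lemma lipschitz_closed_cover:
  fixes f :: "'a::real_normed_vector \<Rightarrow> 'b::metric_space"
  assumes lip: "\<And>i. i \<in> I \<Longrightarrow> L-lipschitz_on (U i) f" and cl: "\<And>i. i \<in> I \<Longrightarrow> closed (U i)"
    and fin: "finite I" and L: "L \<ge> 0" and cov: "UNIV \<subseteq> (\<Union>i\<in>I. U i)"
  shows "L-lipschitz_on UNIV f"
proof (rule lipschitz_onI[OF _ L])
  fix x y :: 'a
  define p where "p = (\<lambda>t::real. x + t *\<^sub>R (y - x))"
  have "(L * dist x y)-lipschitz_on {0..1} (f \<circ> p)"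
  proof (rule lipschitz_on_closed_Union[where I=I and U="\<lambda>i. p -` U i"])
    fix i assume i: "i \<in> I"
    have "(norm (y - x))-lipschitz_on (p -` U i) p"
    proof (rule lipschitz_onI)
      fix s t
      have "p s - p t = (s - t) *\<^sub>R (y - x)" by (simp add: p_def algebra_simps)
      then show "dist (p s) (p t) \<le> norm (y - x) * dist s t"
        by (simp add: dist_norm)
    qed simp
    then show "(L * dist x y)-lipschitz_on (p -` U i) (f \<circ> p)"
      using lipschitz_on_compose[of "norm (y - x)" "p -` U i" p L f] lip[OF i]
      by (auto simp: dist_norm norm_minus_commute intro: lipschitz_on_subset)
    show "closed (p -` U i)"
      using cl[OF i] by (intro continuous_closed_vimage) (auto simp: p_def intro!: continuous_intros)
  next
    show "{0..1} \<subseteq> (\<Union>i\<in>I. p -` U i)"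
    proof
      fix t :: real
      have "p t \<in> (\<Union>i\<in>I. U i)" using cov by blast
      then show "t \<in> (\<Union>i\<in>I. p -` U i)" by blast
    qed
  next
    show "0 \<le> L * dist x y" using L by simp
  qed (rule fin)
  from lipschitz_onD[OF this, of 0 1] show "dist (f x) (f y) \<le> L * dist x y"
    by (simp add: p_def)
qed

context mesh
begin

text \<open>A boundary point of the cube lies on a hyperplane \<open>x $ j = l\<close> with
  \<open>l\<close> equal to 0 or 1. A simplex stays on one side of it and so meets it in a face,
  whose extreme points are nodes on the boundary and therefore different from \<open>p\<close>. An
  affine function that vanishes at them vanishes on the face.\<close>

lemma hat_boundary:
  assumes p: "p \<in> interior Omega" and x: "x \<notin> interior Omega"
  shows "hat \<T> p x = 0"
proof (cases "x \<in> Omega")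
  case True
  then obtain j where "0 \<le> x $ j" "x $ j \<le> 1" "\<not> (0 < x $ j \<and> x $ j < 1)"
    using x unfolding interior_cbox mem_box_cart zero_index one_index by blast
  then obtain l where l: "x $ j = l" "l = 0 \<or> l = 1"
    by fastforce
  obtain S where S: "S \<in> \<T>" "x \<in> S" using True cover by blast
  define F where "F = S \<inter> {y. axis j 1 \<bullet> y = l}"
  have S01: "0 \<le> y $ j" "y $ j \<le> 1" if "y \<in> S" for y
    using element(4)[OF S(1)] that by (auto simp: mem_box_cart subset_iff)
  have F: "F face_of S"
    unfolding F_def
  proof (cases "l = 0")
    case True
    then show "S \<inter> {y. axis j 1 \<bullet> y = l} face_of S"
      using S01 by (intro face_of_Int_supporting_hyperplane_ge element(2)[OF S(1)]) (auto simp: inner_axis')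
  next
    case False
    then show "S \<inter> {y. axis j 1 \<bullet> y = l} face_of S"
      using S01 l by (intro face_of_Int_supporting_hyperplane_le element(2)[OF S(1)]) (auto simp: inner_axis')
  qed
  obtain a c where ac: "\<And>x. x \<in> S \<Longrightarrow> hat \<T> p x = a \<bullet> x + c"
    using hat_affine[OF S(1)] by blast
  have "a \<bullet> x + c = 0 \<bullet> x + 0"
  proof (rule affine_eq_on_compact_convex)
    show "compact F" "convex F"
      using F element[OF S(1)] face_of_imp_compact face_of_imp_convex by blast+
    show "x \<in> F" using S l by (simp add: F_def inner_axis')
    fix v assume "v extreme_point_of F"
    then have v: "v extreme_point_of S" "v \<in> F"
      using extreme_point_of_face[OF F] by auto
    then have "v \<in> nodes \<T>" "v \<in> S" "v $ j = l"
      using S by (auto simp: nodes_def F_def inner_axis')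
    moreover have "v \<noteq> p"
    proof
      assume "v = p"
      then have "0 < v $ j \<and> v $ j < 1"
        using p by (simp add: mem_box_cart interior_cbox)
      then show False using \<open>v $ j = l\<close> l(2) by auto
    qed
    ultimately show "a \<bullet> v + c = 0 \<bullet> v + 0"
      using hat_node[of v p] ac[of v] by simp
  qed
  then show ?thesis using ac S by simp
qed (rule hat_outside)

text \<open>For an interior node the extension by zero has no jump at the boundary, so the simplices
  and the complement of the open cube are closed pieces on which the function is Lipschitz. The sum
  of the constants serves as a common bound.\<close>

lemma hat_lipschitz:
  assumes p: "p \<in> interior Omega"
  shows "\<exists>L. L-lipschitz_on UNIV (hat \<T> p)"
proof -
  have "\<forall>S\<in>\<T>. \<exists>L. L-lipschitz_on S (hat \<T> p)"
  proof
    fix S assume S: "S \<in> \<T>"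
    obtain a c where ac: "\<And>x. x \<in> S \<Longrightarrow> hat \<T> p x = a \<bullet> x + c"
      using hat_affine[OF S] by blast
    have "(norm a)-lipschitz_on S (hat \<T> p)"
    proof (rule lipschitz_onI)
      fix x y assume "x \<in> S" "y \<in> S"
      then show "dist (hat \<T> p x) (hat \<T> p y) \<le> norm a * dist x y"
        using Cauchy_Schwarz_ineq2[of a "x - y"] by (simp add: ac dist_norm inner_diff_right)
    qed simp
    then show "\<exists>L. L-lipschitz_on S (hat \<T> p)" by blast
  qed
  then obtain L where L: "\<And>S. S \<in> \<T> \<Longrightarrow> (L S)-lipschitz_on S (hat \<T> p)"
    by metis
  have L0: "L S \<ge> 0" if "S \<in> \<T>" for S
    using L[OF that] by (rule lipschitz_on_nonneg)
  have "(sum L \<T>)-lipschitz_on UNIV (hat \<T> p)"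
  proof (rule lipschitz_closed_cover[where I="insert (- interior Omega) \<T>" and U="\<lambda>S. S"])
    fix S assume S: "S \<in> insert (- interior Omega) \<T>"
    show "(sum L \<T>)-lipschitz_on S (hat \<T> p)"
    proof (cases "S \<in> \<T>")
      case True
      then show ?thesis
        using L[OF True] L0 finite_mesh by (auto intro: lipschitz_on_mono member_le_sum)
    next
      case False
      then have "S = - interior Omega" using S by simp
      then show ?thesis
        using hat_boundary[OF p] L0 by (intro lipschitz_onI) (auto simp: sum_nonneg)
    qed
    show "closed S" using S element(3) by auto
  next
    show "UNIV \<subseteq> (\<Union>S\<in>insert (- interior Omega) \<T>. S)"
      using cover interior_subset[of "Omega :: (real^'n) set"] by auto
  qed (use finite_mesh L0 in \<open>auto simp: sum_nonneg\<close>)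
  then show ?thesis by blast
qed

lemma V_lipschitz:
  assumes "u \<in> V \<T>" shows "\<exists>L. L-lipschitz_on UNIV u"
proof -
  obtain c where u: "u = (\<lambda>x. \<Sum>p\<in>nodes \<T> \<inter> interior Omega. c p * hat \<T> p x)"
    using assms by (auto simp: V_def)
  have "\<exists>L. L-lipschitz_on UNIV (\<lambda>x. \<Sum>p\<in>I. c p * hat \<T> p x)"
    if "finite I" "I \<subseteq> interior Omega" for I
    using that
  proof (induction I)
    case (insert p I)
    then obtain L L' where "L-lipschitz_on UNIV (\<lambda>x. \<Sum>p\<in>I. c p * hat \<T> p x)" "L'-lipschitz_on UNIV (hat \<T> p)"
      using hat_lipschitz[of p] by auto
    then have "(\<bar>c p\<bar> * L' + L)-lipschitz_on UNIV (\<lambda>x. c p * hat \<T> p x + (\<Sum>p\<in>I. c p * hat \<T> p x))"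
      by (intro lipschitz_on_add lipschitz_on_cmult_real)
    then show ?case using insert by auto
  qed (auto intro: lipschitz_on_constant)
  then show ?thesis unfolding u using finite_nodes by auto
qed

lemma V_outside: "u \<in> V \<T> \<Longrightarrow> x \<notin> Omega \<Longrightarrow> u x = 0"
  by (auto simp: V_def hat_outside)

end

section \<open>The inequality by difference quotients\<close>

lemma directional_derivative_limit:
  fixes x e :: "'a::real_normed_vector" and u :: "'a \<Rightarrow> real"
  assumes "(u has_derivative D) (at x)" and t: "t \<longlonglongrightarrow> 0" "\<And>n. t n \<noteq> 0"
  shows "(\<lambda>n. ((u (x + t n *\<^sub>R e))\<^sup>2 - (u x)\<^sup>2) / t n) \<longlonglongrightarrow> 2 * u x * D e"
proof -
  interpret D: bounded_linear D using assms(1) by (rule has_derivative_bounded_linear)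
  have "((\<lambda>s. u (x + s *\<^sub>R e)) has_derivative (\<lambda>s. D (s *\<^sub>R e))) (at 0)"
    by (rule has_derivative_compose[of "\<lambda>s. x + s *\<^sub>R e" "\<lambda>s. s *\<^sub>R e" 0 UNIV u D])
      (use assms(1) in \<open>auto intro!: derivative_eq_intros\<close>)
  moreover have "(\<lambda>s. D (s *\<^sub>R e)) = (*) (D e)"
    by (auto simp: D.scaleR mult.commute)
  ultimately have "((\<lambda>s. u (x + s *\<^sub>R e)) has_real_derivative D e) (at 0)"
    by (simp add: has_field_derivative_def)
  then have "((\<lambda>s. (u (x + s *\<^sub>R e))\<^sup>2) has_real_derivative 2 * u x * D e) (at 0)"
    by (auto intro!: derivative_eq_intros)
  then have "((\<lambda>s. ((u (x + s *\<^sub>R e))\<^sup>2 - (u x)\<^sup>2) / s) \<longlongrightarrow> 2 * u x * D e) (at 0)"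
    by (simp add: DERIV_def)
  moreover have "filterlim t (at 0) sequentially"
    using t by (intro filterlim_atI) auto
  ultimately show ?thesis by (rule filterlim_compose)
qed

lemma lborel_integral_translate:
  fixes f :: "'a::euclidean_space \<Rightarrow> real"
  assumes "f \<in> borel_measurable borel"
  shows "(\<integral>x. f (c + x) \<partial>lborel) = (\<integral>x. f x \<partial>lborel)"
proof -
  have "(\<integral>x. f x \<partial>lborel) = (\<integral>x. f x \<partial>distr lborel borel ((+) c))"
    by (simp add: lborel_distr_plus)
  also have "\<dots> = (\<integral>x. f (c + x) \<partial>lborel)"
    using assms by (intro integral_distr) auto
  finally show ?thesis by simp
qed

text \<open>Translating \<open>u\<^sup>2\<close> shows that the integral of the difference quotients of \<open>u\<^sup>2\<close> in direction \<open>j\<close>,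
  weighted with \<open>x $ j\<close>, is \<open>- \<integral>u\<^sup>2\<close>; the limit gives the estimate without any
  integration by parts.\<close>

lemma poincare:
  fixes u :: "real ^ 'n \<Rightarrow> real"
  assumes lip: "L-lipschitz_on UNIV u" and out: "\<And>x. x \<notin> Omega \<Longrightarrow> u x = 0" and sob: "sobolev u"
  shows "sqnorm u \<le> 4 * sqnorm (grad u)"
proof -
  \<comment> \<open>Any coordinate direction will do.\<close>
  define j :: 'n where "j = undefined"
  define e :: "real ^ 'n" where "e = axis j 1"
  define t :: "nat \<Rightarrow> real" where "t n = 1 / (real n + 1)" for n
  have t: "0 < t n" "t n \<le> 1" for n by (auto simp: t_def)
  have t0: "t \<longlonglongrightarrow> 0" unfolding t_def using LIMSEQ_inverse_real_of_nat by (simp add: inverse_eq_divide add.commute)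
  have cont: "continuous_on UNIV u" using lip by (rule lipschitz_on_continuous_on)
  then have [measurable]: "u \<in> borel_measurable borel"
    by (rule borel_measurable_continuous_onI)
  have "bounded (u ` Omega)"
    by (intro compact_imp_bounded compact_continuous_image continuous_on_subset[OF cont] compact_cbox) auto
  then obtain B where "\<forall>y\<in>u ` Omega. norm y \<le> B"
    unfolding bounded_iff by (elim exE)
  then have B1: "\<And>x. x \<in> Omega \<Longrightarrow> \<bar>u x\<bar> \<le> B" by simp
  have B0: "0 \<le> B" using B1[of 0] by (auto simp: mem_box_cart)
  have B: "\<bar>u x\<bar> \<le> B" for x using B1[of x] out[of x] B0 by fastforce
  have L0: "0 \<le> L" using lip by (rule lipschitz_on_nonneg)
  define D where "D n x = ((u (x + t n *\<^sub>R e))\<^sup>2 - (u x)\<^sup>2) / t n * x $ j" for n x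
  \<comment> \<open>A nonzero quotient requires \<open>x\<close> or the shifted point to lie in
    \<open>Omega\<close>. As the shift is at most 1, \<open>x\<close> then lies in this box, which
    does not depend on \<open>n\<close> and so carries an integrable majorant.\<close>
  define K :: "(real^'n) set" where "K = cbox (\<chi> i. -1) (\<chi> i. 2)"
  define R where "R x = indicator Omega x * (2 * u x * (grad u x $ j * x $ j))" for x
  have ej: "e $ i = (if i = j then 1 else 0)" for i by (simp add: e_def axis_def)
  have dom: "norm (D n x) \<le> indicator K x * (2 * L * B)" for n x
  proof (cases "u x = 0 \<and> u (x + t n *\<^sub>R e) = 0")
    case True
    then show ?thesis using L0 B0 by (simp add: D_def)
  next
    case False
    then have "x \<in> Omega \<or> x + t n *\<^sub>R e \<in> Omega" using out by blast
    then have c: "\<forall>i. -1 \<le> x $ i \<and> x $ i \<le> 1"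
    proof
      assume "x + t n *\<^sub>R e \<in> Omega"
      then have "\<forall>i. 0 \<le> x $ i + t n * e $ i \<and> x $ i + t n * e $ i \<le> 1"
        by (simp add: mem_box_cart)
      moreover have "0 \<le> t n * e $ i \<and> t n * e $ i \<le> 1" for i
        using t[of n] by (auto simp: ej)
      moreover have "-1 \<le> a \<and> a \<le> 1" if "0 \<le> a + b \<and> a + b \<le> 1" "0 \<le> b \<and> b \<le> 1" for a b :: real
        using that by linarith
      ultimately show ?thesis by blast
    qed (auto simp: mem_box_cart intro: order_trans[of _ 0])
    then have "x \<in> K" by (auto simp: K_def mem_box_cart intro: order_trans)
    have "\<bar>u (x + t n *\<^sub>R e) - u x\<bar> \<le> L * t n"
      using lipschitz_onD[OF lip, of "x + t n *\<^sub>R e" x] t(1)[of n]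
      by (simp add: dist_norm e_def)
    moreover have "\<bar>u (x + t n *\<^sub>R e) + u x\<bar> \<le> 2 * B"
      using B[of x] B[of "x + t n *\<^sub>R e"] by linarith
    ultimately have "\<bar>u (x + t n *\<^sub>R e) - u x\<bar> * \<bar>u (x + t n *\<^sub>R e) + u x\<bar> \<le> (L * t n) * (2 * B)"
      using L0 t(1)[of n] by (intro mult_mono) auto
    then have "\<bar>(u (x + t n *\<^sub>R e))\<^sup>2 - (u x)\<^sup>2\<bar> \<le> (L * t n) * (2 * B)"
      by (simp add: power2_eq_square square_diff_square_factored abs_mult mult.commute)
    then have "\<bar>((u (x + t n *\<^sub>R e))\<^sup>2 - (u x)\<^sup>2) / t n\<bar> \<le> 2 * L * B"
      using t(1)[of n] by (simp add: field_simps)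
    moreover have "\<bar>x $ j\<bar> \<le> 1" using c by (simp add: abs_le_iff)
    ultimately have "\<bar>((u (x + t n *\<^sub>R e))\<^sup>2 - (u x)\<^sup>2) / t n\<bar> * \<bar>x $ j\<bar> \<le> 2 * L * B * 1"
      using L0 B0 by (intro mult_mono) auto
    then show ?thesis
      using \<open>x \<in> K\<close> L0 B0 by (simp add: D_def abs_mult)
  qed
  have lim: "AE x in lebesgue. (\<lambda>n. D n x) \<longlonglongrightarrow> R x"
  proof -
    have "AE x in \<mu>. u differentiable (at x)"
      using sob by (simp add: sobolev_def)
    then have "AE x in lebesgue. x \<in> Omega \<longrightarrow> u differentiable (at x)"
      by (simp add: AE_restrict_space_iff)
    then show ?thesis
    proof eventually_elim
      case (elim x)
      show ?case
      proof (cases "x \<in> Omega")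
        case True
        have "(\<lambda>n. ((u (x + t n *\<^sub>R e))\<^sup>2 - (u x)\<^sup>2) / t n) \<longlonglongrightarrow> 2 * u x * (grad u x \<bullet> e)"
          using elim True t0 t(1) by (intro directional_derivative_limit has_derivative_grad) (auto simp: less_le)
        then have "(\<lambda>n. D n x) \<longlonglongrightarrow> 2 * u x * (grad u x \<bullet> e) * x $ j"
          unfolding D_def by (intro tendsto_mult_right)
        then show ?thesis using True by (simp add: R_def e_def inner_axis mult.assoc)
      next
        case False
        \<comment> \<open>The complement of \<open>Omega\<close> is open, so the shifted points
          eventually stay in it and the quotients vanish.\<close>
        have "(\<lambda>n. x + t n *\<^sub>R e) \<longlonglongrightarrow> x + 0 *\<^sub>R e"
          by (intro tendsto_intros t0)
        then have "eventually (\<lambda>n. x + t n *\<^sub>R e \<in> - Omega) sequentially"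
          using False by (intro topological_tendstoD[where l=x]) auto
        then have "eventually (\<lambda>n. D n x = 0) sequentially"
          by eventually_elim (use False out in \<open>auto simp: D_def\<close>)
        then show ?thesis
          using False by (simp add: R_def tendsto_eventually)
      qed
    qed
  qed
  have Kint: "integrable lebesgue (\<lambda>x. indicator K x * (2 * L * B))"
    by (intro integrable_mult_left integrable_real_indicator) (auto simp: K_def emeasure_lborel_cbox_eq)
  have gm: "(\<lambda>x. grad u x) \<in> borel_measurable \<mu>"
    using sob by (simp add: sobolev_def square_integrable_def)
  have um: "u \<in> borel_measurable \<mu>"
    using sob by (simp add: sobolev_def square_integrable_def)
  have xm: "(\<lambda>x. x $ j) \<in> borel_measurable \<mu>"
    by (intro continuous_imp_measurable_on_sets_lebesgue continuous_intros) auto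
  have gj: "(\<lambda>x. grad u x $ j) \<in> borel_measurable \<mu>"
  proof -
    have "(\<lambda>x. grad u x \<bullet> e) \<in> borel_measurable \<mu>" using gm by simp
    then show ?thesis by (simp add: e_def inner_axis)
  qed
  have Rm: "R \<in> borel_measurable lebesgue"
  proof -
    have "(\<lambda>x. 2 * u x * (grad u x $ j * x $ j)) \<in> borel_measurable \<mu>"
      using um gj xm by simp
    then show ?thesis
      unfolding R_def by (simp add: borel_measurable_restrict_space_iff)
  qed
  have Dm: "D n \<in> borel_measurable borel" for n
    unfolding D_def by measurable
  have conv: "(\<lambda>n. \<integral>x. D n x \<partial>lebesgue) \<longlonglongrightarrow> (\<integral>x. R x \<partial>lebesgue)"
    by (rule integral_dominated_convergence[OF Rm _ Kint lim])
      (use Dm dom in \<open>auto intro: measurable_completion\<close>)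
  have uint: "integrable lborel (\<lambda>x. (u x)\<^sup>2 * h x)" if [measurable]: "h \<in> borel_measurable borel"
    and h: "\<And>x. x \<in> Omega \<Longrightarrow> \<bar>h x\<bar> \<le> 1" for h :: "real^'n \<Rightarrow> real"
  proof (rule Bochner_Integration.integrable_bound[where f="\<lambda>x. indicator Omega x * B\<^sup>2"])
    show "integrable lborel (\<lambda>x::real^'n. indicator Omega x * B\<^sup>2)"
      by (intro integrable_mult_left integrable_real_indicator) (auto simp: emeasure_lborel_cbox_eq)
    show "AE x in lborel. norm ((u x)\<^sup>2 * h x) \<le> norm (indicator Omega x * B\<^sup>2)"
    proof (rule AE_I2)
      fix x
      show "norm ((u x)\<^sup>2 * h x) \<le> norm (indicator Omega x * B\<^sup>2)"
      proof (cases "x \<in> Omega")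
        case True
        have "(u x)\<^sup>2 * \<bar>h x\<bar> \<le> B\<^sup>2 * 1"
          using h[OF True] B[of x] B0 by (intro mult_mono) (auto simp: abs_le_square_iff[symmetric])
        then show ?thesis using True by (simp add: abs_mult)
      qed (use out in auto)
    qed
  qed measurable
  have Dint: "(\<integral>x. D n x \<partial>lebesgue) = - (\<integral>x. (u x)\<^sup>2 \<partial>lborel)" for n
  proof -
    \<comment> \<open>The integrand after the substitution that moves the translation from
      \<open>u\<close> to the weight \<open>x $ j\<close>.\<close>
    let ?h = "\<lambda>x. (u x)\<^sup>2 * (x $ j - t n)"
    have x1: "\<And>x::real^'n. x \<in> Omega \<Longrightarrow> 0 \<le> x $ j \<and> x $ j \<le> 1"
      by (simp add: mem_box_cart)
    have i1: "integrable lborel ?h" "integrable lborel (\<lambda>x. (u x)\<^sup>2 * x $ j)"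
      "integrable lborel (\<lambda>x. (u x)\<^sup>2)"
      using uint[of "\<lambda>x. x $ j - t n"] uint[of "\<lambda>x. x $ j"] uint[of "\<lambda>x. 1"] x1 t[of n]
      by (force simp: abs_le_iff)+
    have h: "?h (t n *\<^sub>R e + x) = (u (x + t n *\<^sub>R e))\<^sup>2 * x $ j" for x
      by (simp add: ej add.commute)
    have "integrable (distr lborel borel ((+) (t n *\<^sub>R e))) ?h"
      using i1(1) by (simp add: lborel_distr_plus)
    then have "integrable lborel (\<lambda>x. ?h (t n *\<^sub>R e + x))"
      by (rule integrable_distr_eq[THEN iffD1, rotated 2]) simp_all
    then have i2: "integrable lborel (\<lambda>x. (u (x + t n *\<^sub>R e))\<^sup>2 * x $ j)"
      by (simp only: h)
    have tr: "(\<integral>x. (u (x + t n *\<^sub>R e))\<^sup>2 * x $ j \<partial>lborel) = (\<integral>x. ?h x \<partial>lborel)"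
      using lborel_integral_translate[of ?h "t n *\<^sub>R e"] by (simp only: h) measurable
    have "(\<integral>x. D n x \<partial>lebesgue) = (\<integral>x. D n x \<partial>lborel)"
      using Dm by (intro integral_completion) simp
    also have "\<dots> = (\<integral>x. ((u (x + t n *\<^sub>R e))\<^sup>2 * x $ j - (u x)\<^sup>2 * x $ j) / t n \<partial>lborel)"
      by (simp add: D_def field_simps)
    also have "\<dots> = ((\<integral>x. ?h x \<partial>lborel) - (\<integral>x. (u x)\<^sup>2 * x $ j \<partial>lborel)) / t n"
      using i1 i2 tr by simp
    also have "(\<integral>x. ?h x \<partial>lborel) = (\<integral>x. (u x)\<^sup>2 * x $ j - t n * (u x)\<^sup>2 \<partial>lborel)"
      by (simp add: algebra_simps)
    also have "\<dots> = (\<integral>x. (u x)\<^sup>2 * x $ j \<partial>lborel) - t n * (\<integral>x. (u x)\<^sup>2 \<partial>lborel)"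
      using i1 by simp
    finally show ?thesis using t(1)[of n] by simp
  qed
  have Req: "(\<integral>x. R x \<partial>lebesgue) = - (\<integral>x. (u x)\<^sup>2 \<partial>lborel)"
    using conv unfolding Dint by (simp add: LIMSEQ_const_iff)
  have "(\<integral>x. (norm (u x))\<^sup>2 \<partial>\<mu>) = (\<integral>x. indicator Omega x *\<^sub>R (u x)\<^sup>2 \<partial>lebesgue)"
    by (simp add: integral_restrict_space)
  also have "\<dots> = (\<integral>x. (u x)\<^sup>2 \<partial>lebesgue)"
    using out by (intro Bochner_Integration.integral_cong) (auto simp: indicator_def)
  also have "\<dots> = (\<integral>x. (u x)\<^sup>2 \<partial>lborel)"
    by (intro integral_completion) simp
  also have "\<dots> = - (\<integral>x. R x \<partial>lebesgue)" using Req by simp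
  also have "(\<integral>x. R x \<partial>lebesgue) = (\<integral>x. 2 * u x * (grad u x $ j * x $ j) \<partial>\<mu>)"
    by (simp add: R_def integral_restrict_space)
  also have "\<dots> = 2 * (\<integral>x. u x \<bullet> (grad u x $ j * x $ j) \<partial>\<mu>)"
    by (simp add: mult.assoc)
  finally have eq: "sqnorm u = - 2 * (\<integral>x. u x \<bullet> (grad u x $ j * x $ j) \<partial>\<mu>)"
    by (simp add: L2_norm_power2)
  have le: "\<bar>grad u x $ j * x $ j\<bar> \<le> norm (grad u x)" if "x \<in> Omega" for x
  proof -
    have "\<bar>grad u x $ j\<bar> * \<bar>x $ j\<bar> \<le> norm (grad u x) * 1"
      using that by (intro mult_mono component_le_norm_cart) (auto simp: mem_box_cart abs_le_iff intro: order_trans[of _ 0])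
    then show ?thesis by (simp add: abs_mult)
  qed
  have sq: "square_integrable Omega (\<lambda>x. grad u x $ j * x $ j)"
  proof (rule square_integrable_bound[where v="grad u"])
    show "square_integrable Omega (grad u)" using sob by (simp add: sobolev_def)
    show "(\<lambda>x. grad u x $ j * x $ j) \<in> borel_measurable \<mu>"
      using gj xm by simp
    show "AE x in \<mu>. norm (grad u x $ j * x $ j) \<le> norm (grad u x)"
      using le by (intro AE_I2) simp
  qed
  have "(\<integral>x. (norm (grad u x $ j * x $ j))\<^sup>2 \<partial>\<mu>) \<le> sqnorm (grad u)"
    unfolding L2_norm_power2
  proof (rule integral_mono)
    show "integrable \<mu> (\<lambda>x. (norm (grad u x $ j * x $ j))\<^sup>2)"
      using sq by (rule square_integrable_integrable)
    show "integrable \<mu> (\<lambda>x. (norm (grad u x))\<^sup>2)"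
      using sob by (simp add: sobolev_def square_integrable_def)
    show "(norm (grad u x $ j * x $ j))\<^sup>2 \<le> (norm (grad u x))\<^sup>2" if "x \<in> space \<mu>" for x
      using le[of x] that by (intro power_mono) auto
  qed
  \<comment> \<open>The weight 1/2 in Young's inequality leaves half of \<open>sqnorm u\<close> on
    the left; hence the constant 4.\<close>
  moreover have "2 * \<bar>\<integral>x. u x \<bullet> (grad u x $ j * x $ j) \<partial>\<mu>\<bar>
      \<le> 1 / 2 * sqnorm u + 2 * (\<integral>x. (norm (grad u x $ j * x $ j))\<^sup>2 \<partial>\<mu>)"
    using integral_young[of Omega u "\<lambda>x. grad u x $ j * x $ j" "1/2"] sob sq
    by (simp add: sobolev_def L2_norm_power2)
  ultimately show ?thesis using eq by linarith
qed

subsection \<open>Summation by parts and the discrete energy balance\<close>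

lemma interior_indices_eq_PiE:
  "interior_indices N = (\<Pi>\<^sub>E j\<in>(UNIV::'n set). {1..N})"
  by (auto simp: interior_indices_def PiE_def extensional_def Pi_def)

lemma finite_interior_indices [simp]: "finite (interior_indices N :: ('n::finite \<Rightarrow> nat) set)"
  unfolding interior_indices_eq_PiE by (intro finite_PiE) auto

lemma interior_indicesD: "i \<in> interior_indices N \<Longrightarrow> 1 \<le> i j \<and> i j \<le> N"
  by (simp add: interior_indices_def)

lemma interior_indices_upd:
  "i \<in> interior_indices N \<Longrightarrow> 1 \<le> l \<Longrightarrow> l \<le> N \<Longrightarrow> i(j := l) \<in> interior_indices N"
  by (simp add: interior_indices_def)

text \<open>Raising \<open>i j\<close> by one maps the layers \<open>i j < N\<close> onto the layers
  \<open>1 < i j\<close>; the layer left over on either side must not contribute. For differences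
  across the boundary this is the Neumann condition.\<close>

lemma sum_interior_shift:
  fixes P Q :: "('n::finite \<Rightarrow> nat) \<Rightarrow> 'b::comm_monoid_add"
  assumes P: "\<And>i. i \<in> interior_indices N \<Longrightarrow> i j = 1 \<Longrightarrow> P i = 0"
    and Q: "\<And>i. i \<in> interior_indices N \<Longrightarrow> i j = N \<Longrightarrow> Q i = 0"
    and PQ: "\<And>i. i \<in> interior_indices N \<Longrightarrow> i j < N \<Longrightarrow> P (i(j := i j + 1)) = Q i"
  shows "sum P (interior_indices N) = sum Q (interior_indices N)"
proof -
  let ?I = "interior_indices N"
  have "sum P ?I = sum P {i\<in>?I. 1 < i j}"
  proof (rule sum.mono_neutral_right)
    show "\<forall>i\<in>?I - {i \<in> ?I. 1 < i j}. P i = 0"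
      using P interior_indicesD[of _ N j] by (auto simp: not_less intro!: P antisym)
  qed auto
  also have "\<dots> = sum Q {i\<in>?I. i j < N}"
  proof (rule sum.reindex_bij_witness[where i="\<lambda>i. i(j := i j + 1)" and j="\<lambda>i. i(j := i j - 1)"])
    fix i assume i: "i \<in> {i\<in>?I. 1 < i j}"
    then have "i(j := i j - 1) \<in> ?I" "(i(j := i j - 1)) j < N"
      using interior_indicesD[of i N j] by (auto intro!: interior_indices_upd)
    then show "i(j := i j - 1) \<in> {i\<in>?I. i j < N}" by simp
    show eq: "(i(j := i j - 1))(j := (i(j := i j - 1)) j + 1) = i"
      using i by (auto simp: fun_upd_idem)
    show "Q (i(j := i j - 1)) = P i"
      using PQ[OF \<open>i(j := i j - 1) \<in> ?I\<close> \<open>(i(j := i j - 1)) j < N\<close>] unfolding eq by (rule sym)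
  next
    fix i assume i: "i \<in> {i\<in>?I. i j < N}"
    then show "i(j := i j + 1) \<in> {i\<in>?I. 1 < i j}"
      using interior_indicesD[of i N j] by (auto intro!: interior_indices_upd)
    show "(i(j := i j + 1))(j := (i(j := i j + 1)) j - 1) = i"
      by (auto simp: fun_upd_idem)
  qed
  also have "\<dots> = sum Q ?I"
  proof (rule sum.mono_neutral_left)
    show "\<forall>i\<in>?I - {i \<in> ?I. i j < N}. Q i = 0"
      using interior_indicesD[of _ N j] by (auto simp: not_less intro!: Q antisym)
  qed auto
  finally show ?thesis .
qed

text \<open>Ghost values at 0 and \<open>N + 1\<close> copy the adjacent interior cell, so that
  differences across the boundary vanish. Only the ghost neighbours of interior cells are
  constrained, which are all that the difference operators reach.\<close>

definition neumann :: "nat \<Rightarrow> (('n::finite \<Rightarrow> nat) \<Rightarrow> 'b) \<Rightarrow> bool"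
  where "neumann N a \<longleftrightarrow> (\<forall>i\<in>interior_indices N. \<forall>j.
    (i j = 1 \<longrightarrow> a (i(j := 0)) = a i) \<and> (i j = N \<longrightarrow> a (i(j := N + 1)) = a i))"

lemma backward_diff_shift: "backward_diff N j a (i(j := i j + 1)) = forward_diff N j a i"
  by (simp add: backward_diff_def forward_diff_def)

lemma neumann_forward: "neumann N a \<Longrightarrow> i \<in> interior_indices N \<Longrightarrow> i j = N \<Longrightarrow> forward_diff N j a i = 0"
  by (simp add: neumann_def forward_diff_def)

lemma neumann_backward: "neumann N a \<Longrightarrow> i \<in> interior_indices N \<Longrightarrow> i j = 1 \<Longrightarrow> backward_diff N j a i = 0"
  by (simp add: neumann_def backward_diff_def)

text \<open>A backward difference is the forward difference of the preceding cell, and those across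
  the boundary vanish. This covers both signs of the discrete gradient in the claim.\<close>

lemma sum_backward_eq_forward:
  fixes a :: "('n::finite \<Rightarrow> nat) \<Rightarrow> 'b::real_normed_vector"
  assumes "neumann N a"
  shows "(\<Sum>i\<in>interior_indices N. (norm (backward_diff N j a i))\<^sup>2)
    = (\<Sum>i\<in>interior_indices N. (norm (forward_diff N j a i))\<^sup>2)"
  by (rule sum_interior_shift[of N j])
    (use neumann_forward[OF assms, where j=j] neumann_backward[OF assms, where j=j] in \<open>auto simp: backward_diff_shift[simplified]\<close>)

text \<open>Shifting the backward differences by one cell pairs each forward difference of
  \<open>a\<close> with that of \<open>b\<close> over the same two cells. The ghost values of
  \<open>b\<close> meet only differences of \<open>a\<close> that vanish.\<close>

lemma summation_by_parts:
  fixes a b :: "('n::finite \<Rightarrow> nat) \<Rightarrow> 'b::real_inner"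
  assumes a: "neumann N a"
  shows "(\<Sum>i\<in>interior_indices N. discrete_laplacian N a i \<bullet> b i)
    = - (\<Sum>i\<in>interior_indices N. \<Sum>j\<in>UNIV. forward_diff N j a i \<bullet> forward_diff N j b i)"
proof -
  let ?I = "interior_indices N :: ('n \<Rightarrow> nat) set"
  have lap: "discrete_laplacian N a i = (\<Sum>j\<in>UNIV. real N *\<^sub>R (forward_diff N j a i - backward_diff N j a i))" for i
    unfolding discrete_laplacian_def
    by (intro sum.cong refl) (simp add: forward_diff_def[of N _ "backward_diff N _ a"] backward_diff_shift[simplified])
  have shift: "(\<Sum>i\<in>?I. backward_diff N j a i \<bullet> b i) = (\<Sum>i\<in>?I. forward_diff N j a i \<bullet> b (i(j := i j + 1)))" for j
    by (rule sum_interior_shift[of N j])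
      (use neumann_forward[OF a, where j=j] neumann_backward[OF a, where j=j] in \<open>auto simp: backward_diff_shift[simplified]\<close>)
  have "(\<Sum>i\<in>?I. discrete_laplacian N a i \<bullet> b i)
      = (\<Sum>j\<in>UNIV. \<Sum>i\<in>?I. real N * (forward_diff N j a i \<bullet> b i - backward_diff N j a i \<bullet> b i))"
    unfolding lap inner_sum_left by (subst sum.swap) (simp add: inner_diff_left)
  also have "\<dots> = (\<Sum>j\<in>UNIV. - (\<Sum>i\<in>?I. forward_diff N j a i \<bullet> forward_diff N j b i))"
  proof (rule sum.cong[OF refl])
    fix j :: 'n
    have "(\<Sum>i\<in>?I. real N * (forward_diff N j a i \<bullet> b i - backward_diff N j a i \<bullet> b i))
        = real N * ((\<Sum>i\<in>?I. forward_diff N j a i \<bullet> b i) - (\<Sum>i\<in>?I. backward_diff N j a i \<bullet> b i))"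
      by (simp add: sum_distrib_left sum_subtractf algebra_simps)
    also have "\<dots> = real N * (\<Sum>i\<in>?I. forward_diff N j a i \<bullet> b i - forward_diff N j a i \<bullet> b (i(j := i j + 1)))"
      unfolding shift by (simp add: sum_subtractf)
    also have "\<dots> = - (\<Sum>i\<in>?I. forward_diff N j a i \<bullet> forward_diff N j b i)"
      by (simp add: forward_diff_def[of N j b] sum_distrib_left sum_negf[symmetric] inner_diff_right algebra_simps)
    finally show "(\<Sum>i\<in>?I. real N * (forward_diff N j a i \<bullet> b i - backward_diff N j a i \<bullet> b i))
        = - (\<Sum>i\<in>?I. forward_diff N j a i \<bullet> forward_diff N j b i)" .
  qed
  also have "\<dots> = - (\<Sum>i\<in>?I. \<Sum>j\<in>UNIV. forward_diff N j a i \<bullet> forward_diff N j b i)"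
    unfolding sum_negf by (subst sum.swap) simp
  finally show ?thesis .
qed

section \<open>The energy balance of one time step\<close>

lemma cross3_triple: "cross3 a b \<bullet> c = a \<bullet> cross3 b c"
  by (simp add: cross3_simps)

lemma inner_midpoint_diff:
  fixes a b :: "'b::real_inner"
  shows "mid a b \<bullet> ((1 / dt) *\<^sub>R (b - a)) = ((norm b)\<^sup>2 - (norm a)\<^sup>2) / (2 * dt)"
proof -
  have "(a + b) \<bullet> (b - a) = (norm b)\<^sup>2 - (norm a)\<^sup>2"
    by (simp add: power2_norm_eq_inner inner_add_left inner_diff_right inner_commute[of b a])
  then show ?thesis by simp
qed

lemma forward_diff_linear:
  "forward_diff N j (\<lambda>i. r *\<^sub>R (a i + b i)) i = r *\<^sub>R (forward_diff N j a i + forward_diff N j b i)"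
  "forward_diff N j (\<lambda>i. r *\<^sub>R (a i - b i)) i = r *\<^sub>R (forward_diff N j a i - forward_diff N j b i)"
  by (simp_all add: forward_diff_def algebra_simps)

text \<open>By \<open>cross3_triple\<close>, a torque \<open>cross3 Y d\<close> tested with
  \<open>w\<close> is \<open>Y\<close> tested with \<open>cross3 d w\<close>, which by the director
  equation is the time difference of the director (all at midpoints). So a single test treats the
  elastic and the electric term alike, and \<open>inner_midpoint_diff\<close> turns the products of
  midpoints with differences into exact differences of squares. \<open>X\<close> and
  \<open>c\<close> stay abstract, since the electric term is evaluated only as a sum over all
  cells.\<close>

lemma discrete_energy:
  fixes d w d1 w1 X :: "('n::finite \<Rightarrow> nat) \<Rightarrow> real ^ 3"
  assumes dt: "dt > 0" and nd: "neumann N d" "neumann N d1"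
    and d_eq: "\<And>i. i \<in> interior_indices N \<Longrightarrow>
      (1 / dt) *\<^sub>R (d1 i - d i) = cross3 (mid (d i) (d1 i)) (mid (w i) (w1 i))"
    and w_eq: "\<And>i. i \<in> interior_indices N \<Longrightarrow>
      \<sigma> *\<^sub>R ((1 / dt) *\<^sub>R (w1 i - w i)) =
        k *\<^sub>R cross3 (discrete_laplacian N (\<lambda>i. mid (d i) (d1 i)) i) (mid (d i) (d1 i))
        - \<alpha> *\<^sub>R mid (w i) (w1 i) + c *\<^sub>R cross3 (X i) (mid (d i) (d1 i))"
  shows "(\<sigma> / 2) * (\<Sum>i\<in>interior_indices N. (norm (w1 i))\<^sup>2)
      + (k / 2) * (\<Sum>i\<in>interior_indices N. \<Sum>j\<in>UNIV. (norm (forward_diff N j d1 i))\<^sup>2)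
    = (\<sigma> / 2) * (\<Sum>i\<in>interior_indices N. (norm (w i))\<^sup>2)
      + (k / 2) * (\<Sum>i\<in>interior_indices N. \<Sum>j\<in>UNIV. (norm (forward_diff N j d i))\<^sup>2)
      - \<alpha> * dt * (\<Sum>i\<in>interior_indices N. (norm (mid (w i) (w1 i)))\<^sup>2)
      + c * (\<Sum>i\<in>interior_indices N. X i \<bullet> (d1 i - d i))"
proof -
  let ?I = "interior_indices N :: ('n \<Rightarrow> nat) set"
  let ?d = "\<lambda>i. mid (d i) (d1 i)" and ?w = "\<lambda>i. mid (w i) (w1 i)"
  let ?\<delta> = "\<lambda>i. (1 / dt) *\<^sub>R (d1 i - d i)"
  have nm: "neumann N ?d" using nd by (simp add: neumann_def)
  have "\<sigma> * (((norm (w1 i))\<^sup>2 - (norm (w i))\<^sup>2) / (2 * dt))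
      = k * (discrete_laplacian N ?d i \<bullet> ?\<delta> i) - \<alpha> * (norm (?w i))\<^sup>2 + c * (X i \<bullet> ?\<delta> i)" if i: "i \<in> ?I" for i
  proof -
    have "\<sigma> * (((norm (w1 i))\<^sup>2 - (norm (w i))\<^sup>2) / (2 * dt)) = (\<sigma> *\<^sub>R ((1 / dt) *\<^sub>R (w1 i - w i))) \<bullet> ?w i"
      by (subst inner_midpoint_diff[symmetric]) (simp only: inner_commute inner_scaleR_left)
    also have "\<dots> = k * (discrete_laplacian N ?d i \<bullet> cross3 (?d i) (?w i)) - \<alpha> * (?w i \<bullet> ?w i)
        + c * (X i \<bullet> cross3 (?d i) (?w i))"
      unfolding w_eq[OF i] by (simp only: inner_add_left inner_diff_left inner_scaleR_left cross3_triple)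
    finally show ?thesis
      unfolding d_eq[OF i] power2_norm_eq_inner .
  qed
  then have "(\<Sum>i\<in>?I. \<sigma> * (((norm (w1 i))\<^sup>2 - (norm (w i))\<^sup>2) / (2 * dt)))
      = (\<Sum>i\<in>?I. k * (discrete_laplacian N ?d i \<bullet> ?\<delta> i) - \<alpha> * (norm (?w i))\<^sup>2 + c * (X i \<bullet> ?\<delta> i))"
    by simp
  also have "\<dots> = k * (\<Sum>i\<in>?I. discrete_laplacian N ?d i \<bullet> ?\<delta> i) - \<alpha> * (\<Sum>i\<in>?I. (norm (?w i))\<^sup>2)
      + c * (\<Sum>i\<in>?I. X i \<bullet> ?\<delta> i)"
    by (simp only: sum.distrib sum_subtractf sum_distrib_left)
  also have "(\<Sum>i\<in>?I. discrete_laplacian N ?d i \<bullet> ?\<delta> i)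
      = - (\<Sum>i\<in>?I. \<Sum>j\<in>UNIV. ((norm (forward_diff N j d1 i))\<^sup>2 - (norm (forward_diff N j d i))\<^sup>2) / (2 * dt))"
    unfolding summation_by_parts[OF nm] forward_diff_linear inner_midpoint_diff ..
  also have "\<dots> = ((\<Sum>i\<in>?I. \<Sum>j\<in>UNIV. (norm (forward_diff N j d i))\<^sup>2)
      - (\<Sum>i\<in>?I. \<Sum>j\<in>UNIV. (norm (forward_diff N j d1 i))\<^sup>2)) / (2 * dt)"
    by (simp add: sum_subtractf sum_divide_distrib[symmetric] minus_divide_left)
  also have "(\<Sum>i\<in>?I. X i \<bullet> ?\<delta> i) = (\<Sum>i\<in>?I. X i \<bullet> (d1 i - d i)) / dt"
    by (simp add: sum_divide_distrib)
  also have "(\<Sum>i\<in>?I. \<sigma> * (((norm (w1 i))\<^sup>2 - (norm (w i))\<^sup>2) / (2 * dt)))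
      = \<sigma> * ((\<Sum>i\<in>?I. (norm (w1 i))\<^sup>2) - (\<Sum>i\<in>?I. (norm (w i))\<^sup>2)) / (2 * dt)"
    by (simp add: sum_subtractf sum_divide_distrib[symmetric] sum_distrib_left[symmetric])
  finally show ?thesis
    using dt by (simp add: field_simps)
qed

text \<open>The increment is orthogonal to the midpoint, and their inner product is half the
  difference of the squared norms.\<close>

lemma midpoint_cross_norm:
  assumes "dt > 0" "(1 / dt) *\<^sub>R (b - a) = cross3 (mid a b) c"
  shows "norm b = norm a"
proof -
  have "((norm b)\<^sup>2 - (norm a)\<^sup>2) / (2 * dt) = 0"
    unfolding inner_midpoint_diff[symmetric] assms(2) by (rule dot_cross_self)
  then show ?thesis using assms(1) by (simp add: power2_eq_iff_nonneg)
qed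

subsection \<open>Cells and piecewise constant functions\<close>

definition cell_lo :: "nat \<Rightarrow> ('n::finite \<Rightarrow> nat) \<Rightarrow> real ^ 'n"
  where "cell_lo N i = (\<chi> j. (real (i j) - 1) * step N)"

definition cell_hi :: "nat \<Rightarrow> ('n::finite \<Rightarrow> nat) \<Rightarrow> real ^ 'n"
  where "cell_hi N i = (\<chi> j. real (i j) * step N)"

lemma box_subset_cell: "box (cell_lo N i) (cell_hi N i) \<subseteq> cell N i"
  by (auto simp: cell_def cell_lo_def cell_hi_def mem_box_cart intro: less_imp_le)

lemma cell_subset_cbox: "cell N i \<subseteq> cbox (cell_lo N i) (cell_hi N i)"
proof
  fix x assume x: "x \<in> cell N i"
  have "cell_lo N i $ j \<le> x $ j \<and> x $ j \<le> cell_hi N i $ j" for j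
    using x less_imp_le[of "(real (i j) - 1) * step N" "x $ j"] by (simp add: cell_def cell_lo_def cell_hi_def)
  then show "x \<in> cbox (cell_lo N i) (cell_hi N i)" by (simp add: mem_box_cart)
qed

lemma cell_borel [measurable]: "cell N i \<in> sets borel"
  unfolding cell_def by measurable

lemma cell_lebesgue [simp]: "cell N i \<in> sets lebesgue"
  by (simp add: cell_borel)

lemma AE_cell_box: "AE x in lebesgue. x \<in> cell N i \<longleftrightarrow> x \<in> box (cell_lo N i) (cell_hi N i)"
proof -
  have "AE x in lebesgue. x \<notin> cbox (cell_lo N i) (cell_hi N i) - box (cell_lo N i) (cell_hi N i)"
    using negligible_frontier_interval AE_not_in negligible_iff_null_sets by blast
  then show ?thesis
    by eventually_elim (use box_subset_cell[of N i] cell_subset_cbox[of N i] in blast)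
qed

lemma emeasure_cell:
  fixes i :: "'n::finite \<Rightarrow> nat"
  assumes "N \<ge> 1"
  shows "emeasure lborel (cell N i) = ennreal (step N ^ CARD('n))"
proof -
  have le: "cell_lo N i $ j \<le> cell_hi N i $ j" for j
    by (simp add: cell_lo_def cell_hi_def divide_right_mono)
  have prod: "(\<Prod>b\<in>Basis. (cell_hi N i - cell_lo N i) \<bullet> b) = step N ^ CARD('n)"
  proof -
    have ne: "cbox (cell_lo N i) (cell_hi N i) \<noteq> {}"
      using le by (simp add: interval_ne_empty_cart)
    have "measure lborel (cbox (cell_lo N i) (cell_hi N i)) = (\<Prod>j\<in>UNIV. cell_hi N i $ j - cell_lo N i $ j)"
      by (rule content_cbox_cart[OF ne])
    moreover have "measure lborel (cbox (cell_lo N i) (cell_hi N i)) = (\<Prod>b\<in>Basis. (cell_hi N i - cell_lo N i) \<bullet> b)"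
      using content_cbox'[OF ne] by (simp add: inner_diff_left)
    moreover have "cell_hi N i $ j - cell_lo N i $ j = step N" for j
      by (simp add: cell_lo_def cell_hi_def diff_divide_distrib)
    ultimately show ?thesis by simp
  qed
  have le': "\<And>b. b \<in> Basis \<Longrightarrow> cell_lo N i \<bullet> b \<le> cell_hi N i \<bullet> b"
    using le by (auto simp: Basis_vec_def inner_axis)
  have "emeasure lborel (cell N i) \<le> emeasure lborel (cbox (cell_lo N i) (cell_hi N i))"
    by (rule emeasure_mono[OF cell_subset_cbox]) simp
  moreover have "emeasure lborel (box (cell_lo N i) (cell_hi N i)) \<le> emeasure lborel (cell N i)"
    by (rule emeasure_mono[OF box_subset_cell]) simp
  ultimately show ?thesis
    using le' by (simp add: emeasure_lborel_box emeasure_lborel_cbox prod)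
qed

lemma measure_cell:
  fixes i :: "'n::finite \<Rightarrow> nat"
  assumes "N \<ge> 1"
  shows "measure lebesgue (cell N i) = step N ^ CARD('n)"
  using emeasure_cell[OF assms, of i] by (simp add: measure_def)

lemma cell_lmeasurable: "N \<ge> 1 \<Longrightarrow> cell N i \<in> lmeasurable"
  by (simp add: fmeasurable_def emeasure_cell)

lemma cell_disjoint:
  assumes "N \<ge> 1" "x \<in> cell N i" "x \<in> cell N i'" shows "i = i'"
proof
  fix j
  have "real (i j) - 1 < real N * x $ j \<and> real N * x $ j \<le> real (i j)" if "x \<in> cell N i" for i
    using that assms(1) by (auto simp: cell_def field_simps)
  from this[OF assms(2)] this[OF assms(3)] show "i j = i' j" by linarith
qed

lemma cell_subset_Omega:
  assumes "i \<in> interior_indices N" shows "cell N i \<subseteq> Omega"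
proof
  fix x assume x: "x \<in> cell N i"
  show "x \<in> Omega"
    unfolding mem_box_cart
  proof
    fix j
    have i: "1 \<le> i j" "i j \<le> N" using interior_indicesD[OF assms] by auto
    then have "0 \<le> (real (i j) - 1) * step N" "real (i j) * step N \<le> 1"
      by (auto simp: field_simps)
    then show "0 $ j \<le> x $ j \<and> x $ j \<le> 1 $ j"
      using x by (auto simp: cell_def dest!: spec[of _ j])
  qed
qed

lemma AE_in_cell:
  assumes N: "N \<ge> 1"
  shows "AE x::real^'n in \<mu>. \<exists>i\<in>interior_indices N. x \<in> cell N i"
proof -
  have "AE x::real^'n in lebesgue. x \<notin> cbox 0 1 - box 0 1"
    using negligible_frontier_interval AE_not_in negligible_iff_null_sets by blast
  then have "AE x::real^'n in lebesgue. x \<in> Omega \<longrightarrow> (\<exists>i\<in>interior_indices N. x \<in> cell N i)"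
  proof eventually_elim
    case (elim x)
    show ?case
    proof
      assume "x \<in> Omega"
      then have x: "0 < x $ j" "x $ j < 1" for j using elim by (auto simp: mem_box_cart)
      \<comment> \<open>Cells are open below and closed above in every coordinate, hence the
        ceiling. Off the boundary of \<open>Omega\<close> it lies between 1 and
        \<open>N\<close>.\<close>
      define i where "i = (\<lambda>j. nat \<lceil>real N * x $ j\<rceil>)"
      have "1 \<le> i j \<and> i j \<le> N \<and> real (i j) - 1 < real N * x $ j \<and> real N * x $ j \<le> real (i j)" for j
      proof -
        have 0: "0 < real N * x $ j" using x[of j] N by simp
        have "real N * x $ j \<le> real N * 1" using x[of j] N by (intro mult_left_mono) auto
        then have 1: "\<lceil>real N * x $ j\<rceil> \<le> int N" by (simp add: ceiling_le_iff)
        have "real (i j) = of_int \<lceil>real N * x $ j\<rceil>" using 0 by (simp add: i_def)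
        then show ?thesis using 0 1 unfolding i_def by linarith
      qed
      then have "i \<in> interior_indices N" "x \<in> cell N i"
        using N by (auto simp: interior_indices_def cell_def field_simps)
      then show "\<exists>i\<in>interior_indices N. x \<in> cell N i" by blast
    qed
  qed
  then show ?thesis by (simp add: AE_restrict_space_iff)
qed

lemma piecewise_const_cell:
  assumes "N \<ge> 1" "i \<in> interior_indices N" "x \<in> cell N i"
  shows "piecewise_const N a x = a i"
proof -
  have "piecewise_const N a x = (\<Sum>i'\<in>interior_indices N. if i' = i then a i' else 0)"
    unfolding piecewise_const_def
    by (intro sum.cong refl) (use assms cell_disjoint in \<open>auto simp: indicator_def\<close>)
  then show ?thesis using assms by simp
qed

lemma piecewise_const_outside:
  "(\<And>i. i \<in> interior_indices N \<Longrightarrow> x \<notin> cell N i) \<Longrightarrow> piecewise_const N a x = 0"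
  by (simp add: piecewise_const_def)

lemma piecewise_const_norm_le:
  assumes "N \<ge> 1" "\<And>i. i \<in> interior_indices N \<Longrightarrow> norm (a i) \<le> B" "0 \<le> B"
  shows "norm (piecewise_const N a x) \<le> B"
proof (cases "\<exists>i\<in>interior_indices N. x \<in> cell N i")
  case True
  then show ?thesis using assms piecewise_const_cell[OF assms(1)] by metis
qed (use assms piecewise_const_outside[of N x a] in auto)

lemma piecewise_const_measurable [measurable]:
  fixes a :: "('n::finite \<Rightarrow> nat) \<Rightarrow> 'b::euclidean_space"
  shows "piecewise_const N a \<in> borel_measurable borel"
  unfolding piecewise_const_def[abs_def] by measurable

lemma piecewise_const_measurable_lebesgue_on [measurable]:
  fixes a :: "('n::finite \<Rightarrow> nat) \<Rightarrow> 'b::euclidean_space"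
  shows "piecewise_const N a \<in> borel_measurable (lebesgue_on S)"
  by (intro measurable_restrict_space1 measurable_completion) simp

lemma integrable_lebesgue_on_subset:
  fixes h :: "'a::euclidean_space \<Rightarrow> 'b::euclidean_space"
  assumes "integrable (lebesgue_on S) h" "T \<subseteq> S" "T \<in> sets lebesgue" "S \<in> sets lebesgue"
  shows "integrable (lebesgue_on T) h"
proof -
  have "set_integrable lebesgue S h"
    using assms(1,4) by (simp add: set_integrable_def integrable_restrict_space)
  then have "set_integrable lebesgue T h"
    using assms by (intro set_integrable_subset[of lebesgue S h T])
  then show ?thesis
    using assms(3) by (simp add: set_integrable_def integrable_restrict_space)
qed

lemma integral_cells:
  fixes h :: "real ^ 'n \<Rightarrow> 'b::euclidean_space"
  assumes N: "N \<ge> 1" and h: "integrable \<mu> h"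
  shows "(\<integral>x. h x \<partial>\<mu>) = (\<Sum>i\<in>interior_indices N. \<integral>x. h x \<partial>lebesgue_on (cell N i))"
proof -
  have int: "integrable lebesgue (\<lambda>x. indicator (cell N i) x *\<^sub>R h x)" if "i \<in> interior_indices N" for i
    using integrable_lebesgue_on_subset[OF h cell_subset_Omega[OF that]] by (simp add: integrable_restrict_space)
  have ae: "AE x in lebesgue. indicator Omega x *\<^sub>R h x = (\<Sum>i\<in>interior_indices N. indicator (cell N i) x *\<^sub>R h x)"
  proof -
    have "AE x::real^'n in lebesgue. x \<in> Omega \<longrightarrow> (\<exists>i\<in>interior_indices N. x \<in> cell N i)"
      using AE_in_cell[OF N, where 'n='n] by (simp add: AE_restrict_space_iff)
    then show ?thesis
    proof eventually_elim
      case (elim x)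
      \<comment> \<open>With the value \<open>h x\<close> frozen, the sum is the piecewise constant
        function of a constant family, evaluated at this same \<open>x\<close>.\<close>
      have pc: "(\<Sum>i\<in>interior_indices N. indicator (cell N i) x *\<^sub>R h x) = piecewise_const N (\<lambda>i. h x) x"
        by (simp add: piecewise_const_def)
      show ?case
      proof (cases "x \<in> Omega")
        case True
        then obtain i where "i \<in> interior_indices N" "x \<in> cell N i" using elim by blast
        then show ?thesis using True unfolding pc by (simp add: piecewise_const_cell[OF N])
      next
        case False
        then have "piecewise_const N (\<lambda>i. h x) x = 0"
          using cell_subset_Omega by (intro piecewise_const_outside) blast
        then show ?thesis using False unfolding pc by simp
      qed
    qed
  qed
  have "(\<integral>x. h x \<partial>\<mu>) = (\<integral>x. indicator Omega x *\<^sub>R h x \<partial>lebesgue)"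
    by (simp add: integral_restrict_space)
  also have "\<dots> = (\<integral>x. (\<Sum>i\<in>interior_indices N. indicator (cell N i) x *\<^sub>R h x) \<partial>lebesgue)"
  proof (rule integral_cong_AE[OF _ _ ae])
    have "integrable lebesgue (\<lambda>x. indicator Omega x *\<^sub>R h x)"
      using h by (simp add: integrable_restrict_space)
    then show "(\<lambda>x. indicator Omega x *\<^sub>R h x) \<in> borel_measurable lebesgue" by simp
    show "(\<lambda>x. \<Sum>i\<in>interior_indices N. indicator (cell N i) x *\<^sub>R h x) \<in> borel_measurable lebesgue"
      using int by (intro borel_measurable_sum) auto
  qed
  also have "\<dots> = (\<Sum>i\<in>interior_indices N. \<integral>x. indicator (cell N i) x *\<^sub>R h x \<partial>lebesgue)"
    using int by (intro Bochner_Integration.integral_sum) auto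
  also have "\<dots> = (\<Sum>i\<in>interior_indices N. \<integral>x. h x \<partial>lebesgue_on (cell N i))"
    by (simp add: integral_restrict_space)
  finally show ?thesis .
qed

lemma square_integrable_piecewise_const:
  fixes a :: "('n::finite \<Rightarrow> nat) \<Rightarrow> 'b::euclidean_space"
  assumes "N \<ge> 1"
  shows "square_integrable Omega (piecewise_const N a)"
proof (rule square_integrable_bound[OF square_integrable_const[of _ "\<Sum>i\<in>interior_indices N. norm (a i)"]])
  have "norm (piecewise_const N a x) \<le> (\<Sum>i\<in>interior_indices N. norm (a i))" for x
    by (rule piecewise_const_norm_le[OF assms])
      (auto intro: member_le_sum[where f="\<lambda>i. norm (a i)"] sum_nonneg)
  then show "AE x in \<mu>. norm (piecewise_const N a x) \<le> norm (\<Sum>i\<in>interior_indices N. norm (a i))"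
    by (simp add: sum_nonneg)
qed auto

lemma L2_norm_piecewise_const:
  fixes a :: "('n::finite \<Rightarrow> nat) \<Rightarrow> 'b::euclidean_space"
  assumes N: "N \<ge> 1"
  shows "sqnorm (piecewise_const N a) = step N ^ CARD('n) * (\<Sum>i\<in>interior_indices N. (norm (a i))\<^sup>2)"
proof -
  have "sqnorm (piecewise_const N a)
      = (\<Sum>i\<in>interior_indices N. \<integral>x. (norm (piecewise_const N a x))\<^sup>2 \<partial>lebesgue_on (cell N i))"
    unfolding L2_norm_power2
    by (intro integral_cells N square_integrable_integrable square_integrable_piecewise_const)
  also have "\<dots> = (\<Sum>i\<in>interior_indices N. \<integral>x. (norm (a i))\<^sup>2 \<partial>lebesgue_on (cell N i))"
    by (intro sum.cong refl Bochner_Integration.integral_cong) (auto simp: piecewise_const_cell[OF N])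
  also have "\<dots> = (\<Sum>i\<in>interior_indices N. step N ^ CARD('n) * (norm (a i))\<^sup>2)"
    by (simp add: measure_restrict_space measure_cell[OF N, simplified])
  finally show ?thesis by (simp add: sum_distrib_left)
qed

lemma norm_vec_power2: "(norm (v :: 'b::real_normed_vector ^ 'n))\<^sup>2 = (\<Sum>j\<in>UNIV. (norm (v $ j))\<^sup>2)"
  by (simp add: norm_vec_def L2_set_def sum_nonneg)

section \<open>Functions that are piecewise constant in space and time\<close>

lemma piecewise_in_time_node:
  "dt > 0 \<Longrightarrow> piecewise_in_time dt a (real m * dt) = a m"
  by (simp add: piecewise_in_time_def)

lemma emeasure_lborel_Times:
  fixes A :: "'a::euclidean_space set" and B :: "'b::euclidean_space set"
  assumes "A \<in> sets borel" "B \<in> sets borel"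
  shows "emeasure lborel (A \<times> B) = emeasure lborel A * emeasure lborel B"
  unfolding lborel_prod[symmetric] using assms by (intro lborel.emeasure_pair_measure_Times) auto

text \<open>Up to a null set the cylinder splits into the boxes \<open>Q m i\<close>, half-open in
  time, on which the integrand is constant. As a finite combination of their indicators it is
  integrated by means of the volumes of the boxes alone.\<close>

lemma L2_norm_space_time:
  fixes a :: "nat \<Rightarrow> ('n::finite \<Rightarrow> nat) \<Rightarrow> 'b::euclidean_space"
  assumes N: "N \<ge> 1" and dt: "dt > 0"
  shows "(L2_norm ({0..<real M * dt} \<times> Omega)
        (\<lambda>(s, x). piecewise_in_time dt (\<lambda>m. piecewise_const N (a m)) s x))\<^sup>2
    = dt * (\<Sum>m<M. step N ^ CARD('n) * (\<Sum>i\<in>interior_indices N. (norm (a m i))\<^sup>2))"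
proof -
  let ?I = "interior_indices N :: ('n \<Rightarrow> nat) set"
  define Q where "Q m i = {real m * dt..<(real m + 1) * dt} \<times> cell N i" for m and i :: "'n \<Rightarrow> nat"
  let ?S = "{0..<real M * dt} \<times> (Omega :: (real^'n) set)"
  let ?u = "\<lambda>(s, x). piecewise_in_time dt (\<lambda>m. piecewise_const N (a m)) s x"
  have Qb: "Q m i \<in> sets borel" for m i
    unfolding Q_def by (intro borel_Times) auto
  have eQ: "emeasure lborel (Q m i) = ennreal (dt * step N ^ CARD('n))" for m i
  proof -
    have "emeasure lborel (Q m i) = ennreal dt * ennreal (step N ^ CARD('n))"
      unfolding Q_def
      by (subst emeasure_lborel_Times) (use dt in \<open>auto simp: emeasure_cell[OF N] algebra_simps\<close>)
    then show ?thesis using dt by (simp add: ennreal_mult)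
  qed
  have pt: "indicator ?S p *\<^sub>R (norm (?u p))\<^sup>2 = (\<Sum>m<M. \<Sum>i\<in>?I. indicator (Q m i) p * (norm (a m i))\<^sup>2)" for p
  proof (cases p)
    case (Pair s x)
    define m where "m = nat \<lfloor>s / dt\<rfloor>"
    have in_time: "s \<in> {real m' * dt..<(real m' + 1) * dt} \<longleftrightarrow> 0 \<le> s \<and> m' = m" for m'
    proof -
      have "s \<in> {real m' * dt..<(real m' + 1) * dt} \<longleftrightarrow> real m' \<le> s / dt \<and> s / dt < real m' + 1"
        using dt by (auto simp: field_simps)
      also have "\<dots> \<longleftrightarrow> \<lfloor>s / dt\<rfloor> = int m'" by (auto simp: floor_eq_iff)
      also have "\<dots> \<longleftrightarrow> 0 \<le> s \<and> m' = m"
        using dt by (auto simp: m_def zero_le_divide_iff dest: arg_cong[of _ _ "\<lambda>z. 0 \<le> z"])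
      finally show ?thesis .
    qed
    have mM: "m < M" if "0 \<le> s" "s < real M * dt"
    proof -
      have "s / dt < real M" using that dt by (simp add: field_simps)
      moreover have "0 \<le> s / dt" using that dt by simp
      ultimately show ?thesis unfolding m_def by linarith
    qed
    have Ms: "s < real M * dt" if "0 \<le> s" "m < M"
    proof -
      have "s < (real m + 1) * dt" using in_time[of m] that by auto
      also have "\<dots> \<le> real M * dt" using that dt by (intro mult_right_mono) auto
      finally show ?thesis .
    qed
    have u: "?u p = piecewise_const N (a m) x"
      by (simp add: Pair piecewise_in_time_def m_def)
    have ind: "indicator (Q m' i) p = (if 0 \<le> s \<and> m' = m then indicator (cell N i) x else (0::real))" for m' i
      using in_time[of m'] by (auto simp: Pair Q_def indicator_def)
    have cells: "(\<Sum>i\<in>?I. indicator (cell N i) x * (norm (a m i))\<^sup>2) = (norm (piecewise_const N (a m) x))\<^sup>2"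
    proof -
      have "(\<Sum>i\<in>?I. indicator (cell N i) x * (norm (a m i))\<^sup>2) = piecewise_const N (\<lambda>i. (norm (a m i))\<^sup>2) x"
        by (simp add: piecewise_const_def)
      also have "\<dots> = (norm (piecewise_const N (a m) x))\<^sup>2"
      proof (cases "\<exists>i\<in>?I. x \<in> cell N i")
        case True
        then show ?thesis by (auto simp: piecewise_const_cell[OF N])
      next
        case False
        then show ?thesis by (simp add: piecewise_const_outside)
      qed
      finally show ?thesis .
    qed
    have "(\<Sum>m'<M. \<Sum>i\<in>?I. indicator (Q m' i) p * (norm (a m' i))\<^sup>2)
        = (\<Sum>m'<M. if m' = m then (if 0 \<le> s then (norm (piecewise_const N (a m) x))\<^sup>2 else 0) else 0)"
      by (intro sum.cong refl) (auto simp: ind cells)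
    also have "\<dots> = (if m < M \<and> 0 \<le> s then (norm (piecewise_const N (a m) x))\<^sup>2 else 0)"
      by simp
    also have "\<dots> = indicator ?S p *\<^sub>R (norm (?u p))\<^sup>2"
    proof (cases "x \<in> Omega")
      case True
      then show ?thesis using mM Ms unfolding u by (auto simp: Pair indicator_def)
    next
      case False
      then have "piecewise_const N (a m) x = 0"
        using cell_subset_Omega by (intro piecewise_const_outside) blast
      then show ?thesis unfolding u by simp
    qed
    finally show ?thesis by simp
  qed
  have S: "?S \<in> sets lebesgue"
    by (intro sets_completionI_sets) (simp add: borel_Times)
  have int: "integrable lebesgue (\<lambda>p. indicator (Q m i) p * (norm (a m i))\<^sup>2)" for m i
    using Qb[of m i] by (intro integrable_mult_left integrable_real_indicator) (auto simp: eQ)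
  have "(L2_norm ?S ?u)\<^sup>2 = (\<integral>p. indicator ?S p *\<^sub>R (norm (?u p))\<^sup>2 \<partial>lebesgue)"
    unfolding L2_norm_power2 using S by (simp add: integral_restrict_space)
  also have "\<dots> = (\<integral>p. (\<Sum>m<M. \<Sum>i\<in>?I. indicator (Q m i) p * (norm (a m i))\<^sup>2) \<partial>lebesgue)"
    unfolding pt ..
  also have "\<dots> = (\<Sum>m<M. \<Sum>i\<in>?I. \<integral>p. indicator (Q m i) p * (norm (a m i))\<^sup>2 \<partial>lebesgue)"
  proof (subst Bochner_Integration.integral_sum)
    show "integrable lebesgue (\<lambda>p. \<Sum>i\<in>?I. indicator (Q m i) p * (norm (a m i))\<^sup>2)" for m
      by (intro Bochner_Integration.integrable_sum int)
    show "(\<Sum>m<M. \<integral>p. (\<Sum>i\<in>?I. indicator (Q m i) p * (norm (a m i))\<^sup>2) \<partial>lebesgue)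
        = (\<Sum>m<M. \<Sum>i\<in>?I. \<integral>p. indicator (Q m i) p * (norm (a m i))\<^sup>2 \<partial>lebesgue)"
      by (intro sum.cong refl Bochner_Integration.integral_sum int)
  qed
  also have "\<dots> = (\<Sum>m<M. \<Sum>i\<in>?I. dt * step N ^ CARD('n) * (norm (a m i))\<^sup>2)"
  proof (intro sum.cong refl)
    fix m i
    have "measure lebesgue (Q m i) = dt * step N ^ CARD('n)"
      using Qb[of m i] dt by (simp add: measure_def eQ)
    then show "(\<integral>p. indicator (Q m i) p * (norm (a m i))\<^sup>2 \<partial>lebesgue) = dt * step N ^ CARD('n) * (norm (a m i))\<^sup>2"
      by simp
  qed
  finally show ?thesis by (simp add: sum_distrib_left mult.assoc)
qed

subsection \<open>Bump functions and weak gradients on cells\<close>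

text \<open>Differentiability \<open>k\<close> times on the whole line. The derivative is bound
  existentially, so that the closure properties follow by induction on \<open>k\<close>. Continuity
  of the last derivative is implied as soon as all \<open>k\<close> are taken together, as in
  \<open>smooth\<close>.\<close>

primrec Ck :: "nat \<Rightarrow> (real \<Rightarrow> real) \<Rightarrow> bool" where
  "Ck 0 f = True"
| "Ck (Suc k) f = (\<exists>f'. (\<forall>x. (f has_real_derivative f' x) (at x)) \<and> Ck k f')"

lemma Ck_Suc_D: "Ck (Suc k) f \<Longrightarrow> Ck k f"
proof (induction k arbitrary: f)
  case (Suc k)
  then obtain f' where "\<forall>x. (f has_real_derivative f' x) (at x)" "Ck (Suc k) f'" by auto
  then show ?case using Suc.IH[of f'] by auto
qed simp

lemma Ck_add: "Ck k f \<Longrightarrow> Ck k g \<Longrightarrow> Ck k (\<lambda>x. f x + g x)"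
proof (induction k arbitrary: f g)
  case (Suc k)
  then obtain f' g' where f: "\<forall>x. (f has_real_derivative f' x) (at x)" "Ck k f'"
    and g: "\<forall>x. (g has_real_derivative g' x) (at x)" "Ck k g'" by auto
  have "\<forall>x. ((\<lambda>x. f x + g x) has_real_derivative f' x + g' x) (at x)"
    using f g by (auto intro!: derivative_eq_intros)
  then show ?case using Suc.IH[OF f(2) g(2)] by (auto intro!: exI[of _ "\<lambda>x. f' x + g' x"])
qed simp

lemma Ck_mult: "Ck k f \<Longrightarrow> Ck k g \<Longrightarrow> Ck k (\<lambda>x. f x * g x)"
proof (induction k arbitrary: f g)
  case (Suc k)
  then obtain f' g' where f: "\<forall>x. (f has_real_derivative f' x) (at x)" "Ck k f'"
    and g: "\<forall>x. (g has_real_derivative g' x) (at x)" "Ck k g'" by auto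
  have "\<forall>x. ((\<lambda>x. f x * g x) has_real_derivative f' x * g x + f x * g' x) (at x)"
    using f g by (auto intro!: derivative_eq_intros)
  moreover have "Ck k (\<lambda>x. f' x * g x + f x * g' x)"
    using Suc.IH[OF f(2) Ck_Suc_D[OF Suc.prems(2)]] Suc.IH[OF Ck_Suc_D[OF Suc.prems(1)] g(2)]
    by (rule Ck_add)
  ultimately show ?case by (auto intro!: exI[of _ "\<lambda>x. f' x * g x + f x * g' x"])
qed simp

lemma Ck_const: "Ck k (\<lambda>x. c)"
proof (induction k arbitrary: c)
  case (Suc k)
  then show ?case by (auto intro!: exI[of _ "\<lambda>x. 0"])
qed simp

lemma Ck_affine: "Ck k f \<Longrightarrow> Ck k (\<lambda>x. f (a * x + b))"
proof (induction k arbitrary: f)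
  case (Suc k)
  then obtain f' where f: "\<forall>x. (f has_real_derivative f' x) (at x)" "Ck k f'" by auto
  have "((\<lambda>x. f (a * x + b)) has_real_derivative f' (a * x + b) * a) (at x)" for x
    by (rule DERIV_chain2) (use f in \<open>auto intro!: derivative_eq_intros\<close>)
  moreover have "Ck k (\<lambda>x. f' (a * x + b) * a)"
    using Suc.IH[OF f(2)] Ck_const by (rule Ck_mult)
  ultimately show ?case by (auto intro!: exI[of _ "\<lambda>x. f' (a * x + b) * a"])
qed simp

definition smooth :: "(real \<Rightarrow> real) \<Rightarrow> bool"
  where "smooth f \<longleftrightarrow> (\<forall>k. Ck k f)"

lemma smooth_deriv:
  assumes "smooth f"
  shows "(f has_real_derivative deriv f x) (at x)" "smooth (deriv f)"
proof -
  have *: "(\<forall>x. (f has_real_derivative deriv f x) (at x)) \<and> Ck k (deriv f)" for k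
  proof -
    have "Ck (Suc k) f" using assms by (simp add: smooth_def)
    then obtain f' where f': "\<forall>x. (f has_real_derivative f' x) (at x)" "Ck k f'" by auto
    then have "deriv f = f'" by (auto intro!: DERIV_imp_deriv)
    then show ?thesis using f' by simp
  qed
  show "(f has_real_derivative deriv f x) (at x)" "smooth (deriv f)"
    using * by (auto simp: smooth_def)
qed

lemma smooth_antiderivative:
  assumes "smooth g" "\<And>x. (f has_real_derivative g x) (at x)"
  shows "smooth f"
  unfolding smooth_def
proof
  fix k show "Ck k f"
    by (cases k) (use assms in \<open>auto simp: smooth_def\<close>)
qed

lemma smooth_add: "smooth f \<Longrightarrow> smooth g \<Longrightarrow> smooth (\<lambda>x. f x + g x)"
  and smooth_mult: "smooth f \<Longrightarrow> smooth g \<Longrightarrow> smooth (\<lambda>x. f x * g x)"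
  and smooth_const: "smooth (\<lambda>x. c)"
  and smooth_affine: "smooth f \<Longrightarrow> smooth (\<lambda>x. f (a * x + b))"
  by (auto simp: smooth_def intro: Ck_add Ck_mult Ck_const Ck_affine)

text \<open>The classical function exp(-1/x), extended by 0, times powers of 1/x. With these powers
  the family is closed under differentiation up to linear combinations, and one induction shows that
  all members are smooth. Only \<open>flat 0\<close> enters the bumps.\<close>

definition flat :: "nat \<Rightarrow> real \<Rightarrow> real"
  where "flat k x = (if x \<le> 0 then 0 else (1 / x) ^ k * exp (- (1 / x)))"

lemma flat_tendsto_0: "(flat k \<longlongrightarrow> 0) (at 0)"
proof -
  have "(flat k \<longlongrightarrow> 0) (at_left 0)"
  proof (rule tendsto_eventually)
    show "eventually (\<lambda>x. flat k x = 0) (at_left 0)"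
      using eventually_at_left_real[of "-1" 0] by (auto elim!: eventually_mono simp: flat_def)
  qed
  moreover have "(flat k \<longlongrightarrow> 0) (at_right 0)"
  proof -
    have "((\<lambda>y::real. y ^ k / exp y) \<longlongrightarrow> 0) at_top" by (rule tendsto_power_div_exp_0)
    then have "((\<lambda>x::real. inverse x ^ k / exp (inverse x)) \<longlongrightarrow> 0) (at_right 0)"
      by (rule filterlim_compose[OF _ filterlim_inverse_at_top_right])
    moreover have "eventually (\<lambda>x. inverse x ^ k / exp (inverse x) = flat k x) (at_right 0)"
      using eventually_at_right_real[of 0 1]
      by (auto elim!: eventually_mono simp: flat_def exp_minus inverse_eq_divide)
    ultimately show ?thesis by (rule Lim_transform_eventually)
  qed
  ultimately show ?thesis by (simp add: filterlim_split_at)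
qed

lemma flat_has_derivative:
  "(flat k has_real_derivative flat (k + 2) x - real k * flat (k + 1) x) (at x)"
proof -
  consider "x < 0" | "x = 0" | "x > 0" by linarith
  then show ?thesis
  proof cases
    case 1
    have "((\<lambda>x. 0) has_real_derivative 0) (at x)" by simp
    then have "(flat k has_real_derivative 0) (at x)"
      by (rule has_field_derivative_transform_within_open[of _ _ _ "{..<0}"]) (use 1 in \<open>auto simp: flat_def\<close>)
    then show ?thesis using 1 by (simp add: flat_def)
  next
    case 2
    \<comment> \<open>The difference quotient of \<open>flat k\<close> at 0 is
      \<open>flat (k + 1)\<close> itself.\<close>
    have "(flat (k + 1) \<longlongrightarrow> 0) (at 0)" by (rule flat_tendsto_0)
    then have "((\<lambda>h. (flat k (0 + h) - flat k 0) / h) \<longlongrightarrow> 0) (at 0)"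
      by (rule Lim_transform_eventually) (auto simp: flat_def)
    then have "(flat k has_real_derivative 0) (at 0)" by (simp add: DERIV_def)
    then show ?thesis using 2 by (simp add: flat_def)
  next
    case 3
    have "((\<lambda>x. (1 / x) ^ k * exp (- (1 / x))) has_real_derivative
        flat (k + 2) x - real k * flat (k + 1) x) (at x)"
    proof -
      have "((\<lambda>x. 1 / x) has_real_derivative - ((1 / x) ^ 2)) (at x)"
        using 3 by (auto intro!: derivative_eq_intros simp: power2_eq_square field_simps)
      moreover have "((\<lambda>x. g x ^ k * exp (- g x)) has_real_derivative
          real k * g x ^ (k - 1) * g' * exp (- g x) + g x ^ k * (exp (- g x) * - g')) (at x)"
        if "(g has_real_derivative g') (at x)" for g g'
        using that by (auto intro!: derivative_eq_intros)
      ultimately have "((\<lambda>x. (1 / x) ^ k * exp (- (1 / x))) has_real_derivative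
          real k * (1 / x) ^ (k - 1) * (- ((1 / x) ^ 2)) * exp (- (1 / x))
          + (1 / x) ^ k * (exp (- (1 / x)) * - (- ((1 / x) ^ 2)))) (at x)"
        by blast
      moreover have "real k * (1 / x) ^ (k - 1) * (- ((1 / x) ^ 2)) * exp (- (1 / x))
          + (1 / x) ^ k * (exp (- (1 / x)) * - (- ((1 / x) ^ 2))) = flat (k + 2) x - real k * flat (k + 1) x"
        using 3 by (cases k) (auto simp: flat_def power2_eq_square field_simps)
      ultimately show ?thesis by simp
    qed
    then show ?thesis
      by (rule has_field_derivative_transform_within_open[of _ _ _ "{0<..}"]) (use 3 in \<open>auto simp: flat_def\<close>)
  qed
qed

lemma smooth_flat: "smooth (flat k)"
proof -
  have "Ck n (flat k)" for n
  proof (induction n arbitrary: k)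
    case (Suc n)
    have "Ck n (\<lambda>x. flat (k + 2) x + - real k * flat (k + 1) x)"
      by (intro Ck_add Ck_mult Ck_const Suc)
    then show ?case
      using flat_has_derivative[of k] by (auto intro!: exI[of _ "\<lambda>x. flat (k + 2) x - real k * flat (k + 1) x"])
  qed simp
  then show ?thesis by (simp add: smooth_def)
qed

lemma flat_range: "0 \<le> flat 0 x" "flat 0 x \<le> 1"
  by (auto simp: flat_def)

lemma flat_at_top: "(flat 0 \<longlongrightarrow> 1) at_top"
proof -
  have "((\<lambda>x::real. exp (- (inverse x))) \<longlongrightarrow> exp (- 0)) at_top"
    by (intro tendsto_intros tendsto_inverse_0_at_top filterlim_ident)
  moreover have "eventually (\<lambda>x::real. exp (- (inverse x)) = flat 0 x) at_top"
    using eventually_gt_at_top[of 0] by eventually_elim (auto simp: flat_def inverse_eq_divide)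
  ultimately show ?thesis using Lim_transform_eventually by fastforce
qed

text \<open>The supports are compact subsets of the open interval from 0 to \<open>h\<close>, so that test functions exist
  also for the cells that touch the boundary of \<open>Omega\<close>.\<close>

definition bump :: "real \<Rightarrow> nat \<Rightarrow> real \<Rightarrow> real"
  where "bump h n y = flat 0 (real (Suc n) * y - 1) * flat 0 (real (Suc n) * (h - y) - 1)"

lemma smooth_bump: "smooth (\<lambda>y. bump h n (y - c))"
proof -
  have "smooth (\<lambda>y. flat 0 (real (Suc n) * y + (- real (Suc n) * c - 1))
      * flat 0 (- real (Suc n) * y + (real (Suc n) * (h + c) - 1)))"
    by (intro smooth_mult smooth_affine smooth_flat)
  then show ?thesis by (simp add: bump_def[abs_def] algebra_simps)
qed

lemma bump_range: "0 \<le> bump h n y" "bump h n y \<le> 1"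
  using flat_range by (auto simp: bump_def intro: mult_le_one)

lemma bump_eq_0: "y \<le> 1 / real (Suc n) \<or> h - 1 / real (Suc n) \<le> y \<Longrightarrow> bump h n y = 0"
  by (auto simp: bump_def flat_def field_simps)

lemma bump_tendsto: "(\<lambda>n. bump h n y) \<longlonglongrightarrow> indicator {0<..<h} y"
proof (cases "0 < y \<and> y < h")
  case True
  have *: "filterlim (\<lambda>n. real (Suc n) * c - 1) at_top sequentially" if "c > 0" for c :: real
  proof -
    have "filterlim (\<lambda>n. - 1 + c * real (Suc n)) at_top sequentially"
      using that by (intro filterlim_tendsto_add_at_top[OF tendsto_const] filterlim_tendsto_pos_mult_at_top[OF tendsto_const]
          filterlim_compose[OF filterlim_real_sequentially filterlim_Suc])
    then show ?thesis by (simp add: mult.commute)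
  qed
  have "(\<lambda>n. bump h n y) \<longlonglongrightarrow> 1 * 1"
    unfolding bump_def using True
    by (intro tendsto_mult filterlim_compose[OF flat_at_top] *) auto
  then show ?thesis using True by simp
next
  case False
  have "y \<le> 1 / real (Suc n) \<or> h - 1 / real (Suc n) \<le> y" for n
  proof -
    have "0 \<le> 1 / real (Suc n)" by simp
    then show ?thesis using False by linarith
  qed
  then show ?thesis using False by (simp add: bump_eq_0)
qed

text \<open>The tent is the increment over a length \<open>h\<close> of an antiderivative
  \<open>P\<close> of the bump, so its slope is the bump on the first interval and minus its
  translate on the second. By the mean value theorem its value at \<open>y\<close> is
  \<open>h\<close> times a value of the bump between \<open>y - h\<close> and \<open>y\<close>,
  which yields both the range and the support.\<close>

lemma ex_tent:
  assumes h: "h > 0"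
  shows "\<exists>\<tau>. smooth \<tau> \<and> (\<forall>y. deriv \<tau> y = bump h n y - bump h n (y - h)) \<and> (\<forall>y. 0 \<le> \<tau> y \<and> \<tau> y \<le> h)
    \<and> (\<forall>y. y \<le> 1 / real (Suc n) \<or> 2 * h - 1 / real (Suc n) \<le> y \<longrightarrow> \<tau> y = 0)"
proof -
  have sb: "smooth (bump h n)" using smooth_bump[of h n 0] by simp
  have cont: "isCont (bump h n) x" for x
    using smooth_deriv(1)[OF sb] DERIV_isCont by blast
  obtain P where "\<forall>x. (P has_vector_derivative bump h n x) (at x)"
    using einterval_antiderivative[of "-\<infinity>" "\<infinity>" "bump h n"] cont by auto
  then have P: "(P has_real_derivative bump h n x) (at x)" for x
    by (simp add: has_real_derivative_iff_has_vector_derivative)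
  define \<tau> where "\<tau> y = P y - P (y - h)" for y
  have sP: "smooth P" using sb P by (rule smooth_antiderivative)
  have "smooth (\<lambda>y. P y + (- 1) * P (1 * y + (- h)))"
    by (intro smooth_add smooth_mult smooth_const smooth_affine sP)
  then have st: "smooth \<tau>" by (simp add: \<tau>_def[abs_def])
  have d: "deriv \<tau> y = bump h n y - bump h n (y - h)" for y
  proof (rule DERIV_imp_deriv)
    have "((\<lambda>y. P (y - h)) has_real_derivative bump h n (y - h) * 1) (at y)"
      by (rule DERIV_chain2[OF P]) (auto intro!: derivative_eq_intros)
    then show "(\<tau> has_real_derivative bump h n y - bump h n (y - h)) (at y)"
      unfolding \<tau>_def[abs_def] using P by (auto intro!: derivative_eq_intros)
  qed
  have mvt: "\<exists>z. y - h < z \<and> z < y \<and> \<tau> y = h * bump h n z" for y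
  proof -
    have "y - h < y" using h by simp
    then obtain z where "y - h < z" "z < y" "P y - P (y - h) = (y - (y - h)) * bump h n z"
      using MVT2[of "y - h" y P "bump h n"] P by blast
    then show ?thesis by (auto simp: \<tau>_def)
  qed
  have "0 \<le> \<tau> y \<and> \<tau> y \<le> h" for y
    using mvt[of y] bump_range[of h n] h by (auto intro: mult_left_le)
  moreover have "\<tau> y = 0" if "y \<le> 1 / real (Suc n) \<or> 2 * h - 1 / real (Suc n) \<le> y" for y
  proof -
    obtain z where z: "y - h < z" "z < y" "\<tau> y = h * bump h n z" using mvt by blast
    then have "z \<le> 1 / real (Suc n) \<or> h - 1 / real (Suc n) \<le> z" using that by linarith
    then show ?thesis using z(3) bump_eq_0 by simp
  qed
  ultimately show ?thesis using st d by blast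
qed

section \<open>Products of smooth functions as test functions on cells\<close>

definition prodf :: "('n::finite \<Rightarrow> real \<Rightarrow> real) \<Rightarrow> real ^ 'n \<Rightarrow> real"
  where "prodf r x = (\<Prod>l\<in>UNIV. r l (x $ l))"

lemma prodf_has_derivative:
  assumes "\<And>l. smooth (r l)"
  shows "(prodf r has_derivative (\<lambda>h. \<Sum>j\<in>UNIV. h $ j * prodf (r(j := deriv (r j))) x)) (at x)"
proof -
  have "((\<lambda>x. r l (x $ l)) has_derivative (\<lambda>h. deriv (r l) (x $ l) * h $ l)) (at x)" for l
  proof -
    have "(r l has_derivative (\<lambda>h. deriv (r l) (x $ l) * h)) (at (x $ l))"
      using smooth_deriv(1)[OF assms] by (simp add: has_field_derivative_def)
    then show ?thesis
      by (rule has_derivative_compose[of "\<lambda>x. x $ l" "\<lambda>h. h $ l", rotated])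
        (auto intro!: bounded_linear_imp_has_derivative bounded_linear_vec_nth)
  qed
  then have "(prodf r has_derivative
      (\<lambda>h. \<Sum>j\<in>UNIV. (deriv (r j) (x $ j) * h $ j) * (\<Prod>l\<in>UNIV - {j}. r l (x $ l)))) (at x)"
    unfolding prodf_def[abs_def] by (intro has_derivative_prod) auto
  moreover have "deriv (r j) (x $ j) * h $ j * (\<Prod>l\<in>UNIV - {j}. r l (x $ l))
      = h $ j * prodf (r(j := deriv (r j))) x" for h j
    unfolding prodf_def by (subst (2) prod.remove[of _ j]) auto
  ultimately show ?thesis by simp
qed

lemma prodf_differentiable: "(\<And>l. smooth (r l)) \<Longrightarrow> prodf r differentiable (at x)"
  using prodf_has_derivative unfolding differentiable_def by blast

lemma dir_deriv_prodf:
  assumes "\<And>l. smooth (r l)"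
  shows "dir_deriv (axis j 1) (prodf r) = prodf (r(j := deriv (r j)))"
proof
  fix x
  have "dir_deriv (axis j 1) (prodf r) x = (\<Sum>l\<in>UNIV. axis j 1 $ l * prodf (r(l := deriv (r l))) x)"
    unfolding dir_deriv_def frechet_derivative_at[OF prodf_has_derivative[of r x, OF assms], symmetric] ..
  also have "\<dots> = (\<Sum>l\<in>UNIV. if l = j then prodf (r(l := deriv (r l))) x else 0)"
    by (intro sum.cong) (auto simp: axis_def)
  finally show "dir_deriv (axis j 1) (prodf r) x = prodf (r(j := deriv (r j))) x" by simp
qed

text \<open>A partial derivative of a product of functions of one coordinate each is again such a
  product, with one factor differentiated. All iterated partial derivatives are thus covered by
  induction on the list of directions.\<close>

lemma test_function_prodf:
  assumes r: "\<And>l. smooth (r l)" and K: "closed K" "bounded K" "K \<subseteq> U"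
    and supp: "\<And>x. prodf r x \<noteq> 0 \<Longrightarrow> x \<in> K"
  shows "test_function U (prodf r)"
proof -
  have iter: "\<exists>r'. (\<forall>l. smooth (r' l)) \<and> foldr dir_deriv bs (prodf r) = prodf r'" if "set bs \<subseteq> Basis" for bs
    using that
  proof (induction bs)
    case (Cons b bs)
    then obtain r' where r': "\<And>l. smooth (r' l)" "foldr dir_deriv bs (prodf r) = prodf r'" by auto
    obtain j where "b = axis j 1" using Cons.prems by (auto simp: Basis_vec_def)
    then have "foldr dir_deriv (b # bs) (prodf r) = prodf (r'(j := deriv (r' j)))"
      using r'(2) dir_deriv_prodf[of r' j, OF r'(1)] by simp
    moreover have "\<forall>l. smooth ((r'(j := deriv (r' j))) l)"
      using r'(1) smooth_deriv(2) by simp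
    ultimately show ?case by blast
  qed (use r in auto)
  have "foldr dir_deriv bs (prodf r) differentiable (at x)" if bs: "set bs \<subseteq> Basis" for bs x
  proof -
    obtain r' where "\<And>l. smooth (r' l)" "foldr dir_deriv bs (prodf r) = prodf r'"
      using iter[OF bs] by blast
    then show ?thesis using prodf_differentiable[of r'] by simp
  qed
  moreover have "closure {x. prodf r x \<noteq> 0} \<subseteq> K"
    using supp K(1) by (intro closure_minimal) auto
  ultimately show ?thesis
    unfolding test_function_def using K by (auto simp: compact_eq_bounded_closed intro: bounded_subset)
qed

definition cell_bump :: "nat \<Rightarrow> nat \<Rightarrow> ('n::finite \<Rightarrow> nat) \<Rightarrow> real ^ 'n \<Rightarrow> real"
  where "cell_bump N n i = prodf (\<lambda>l y. bump (step N) n (y - cell_lo N i $ l))"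

lemma cell_bump_range: "0 \<le> cell_bump N n i x" "cell_bump N n i x \<le> 1"
  unfolding cell_bump_def prodf_def using bump_range by (auto intro!: prod_nonneg prod_le_1)

lemma cell_bump_tendsto:
  "(\<lambda>n. cell_bump N n i x) \<longlonglongrightarrow> indicator (box (cell_lo N i) (cell_hi N i)) x"
proof -
  have "(\<lambda>n. cell_bump N n i x) \<longlonglongrightarrow> (\<Prod>l\<in>UNIV. indicator {0<..<step N} (x $ l - cell_lo N i $ l))"
    unfolding cell_bump_def prodf_def by (intro tendsto_prod bump_tendsto)
  moreover have "(\<Prod>l\<in>UNIV. indicator {0<..<step N} (x $ l - cell_lo N i $ l))
      = (indicator (box (cell_lo N i) (cell_hi N i)) x :: real)"
  proof -
    have hi: "cell_hi N i $ l = cell_lo N i $ l + step N" for l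
      by (simp add: cell_lo_def cell_hi_def diff_divide_distrib)
    show ?thesis
    proof (cases "x \<in> box (cell_lo N i) (cell_hi N i)")
      case True
      then have "x $ l - cell_lo N i $ l \<in> {0<..<step N}" for l
        using hi[of l] by (auto simp: mem_box_cart dest!: spec[of _ l])
      then show ?thesis using True by simp
    next
      case False
      then obtain l where "\<not> (cell_lo N i $ l < x $ l \<and> x $ l < cell_hi N i $ l)"
        unfolding mem_box_cart by blast
      then have "x $ l - cell_lo N i $ l \<notin> {0<..<step N}"
        using hi[of l] by auto
      then have "\<exists>l\<in>UNIV. indicator {0<..<step N} (x $ l - cell_lo N i $ l) = (0::real)"
        by (intro bexI[of _ l]) auto
      then show ?thesis using False by (subst prod_zero) auto
    qed
  qed
  ultimately show ?thesis by simp
qed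

lemma prodf_measurable:
  fixes r :: "'n::finite \<Rightarrow> real \<Rightarrow> real"
  assumes "\<And>l. smooth (r l)"
  shows "prodf r \<in> borel_measurable (lebesgue_on S)"
proof -
  have "continuous_on UNIV (prodf r)"
    by (intro continuous_at_imp_continuous_on ballI differentiable_imp_continuous_within
        prodf_differentiable assms)
  then have "prodf r \<in> borel_measurable borel" by (rule borel_measurable_continuous_onI)
  then show ?thesis by (intro measurable_restrict_space1 measurable_completion) simp
qed

lemma cell_bump_measurable: "cell_bump N n i \<in> borel_measurable (lebesgue_on S)"
  unfolding cell_bump_def by (intro prodf_measurable smooth_bump)

text \<open>The bumps converge pointwise to the indicator of the open box, which differs from the
  half-open cell by a null set, and \<open>norm (u x)\<close> is a majorant.\<close>

lemma integral_cell_bump_tendsto: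
  fixes u :: "real ^ 'n \<Rightarrow> 'b::euclidean_space"
  assumes u: "integrable \<mu> u" and i: "i \<in> interior_indices N"
  shows "(\<lambda>n. \<integral>x. cell_bump N n i x *\<^sub>R u x \<partial>\<mu>) \<longlonglongrightarrow> (\<integral>x. u x \<partial>lebesgue_on (cell N i))"
proof -
  let ?B = "box (cell_lo N i) (cell_hi N i)"
  have um: "u \<in> borel_measurable \<mu>" using u by auto
  have lim: "(\<lambda>n. \<integral>x. cell_bump N n i x *\<^sub>R u x \<partial>\<mu>)
      \<longlonglongrightarrow> (\<integral>x. indicator ?B x *\<^sub>R u x \<partial>\<mu>)"
  proof (rule integral_dominated_convergence[where w="\<lambda>x. norm (u x)"])
    have "indicator ?B \<in> borel_measurable \<mu>"
      by (intro measurable_restrict_space1 borel_measurable_indicator) auto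
    then show "(\<lambda>x. indicator ?B x *\<^sub>R u x) \<in> borel_measurable \<mu>"
      using um by (intro borel_measurable_scaleR) auto
    show "(\<lambda>x. cell_bump N n i x *\<^sub>R u x) \<in> borel_measurable \<mu>" for n
      using um cell_bump_measurable by (intro borel_measurable_scaleR) auto
    show "integrable \<mu> (\<lambda>x. norm (u x))" using u by simp
    show "AE x in \<mu>. (\<lambda>n. cell_bump N n i x *\<^sub>R u x) \<longlonglongrightarrow> indicator ?B x *\<^sub>R u x"
      by (intro AE_I2 tendsto_scaleR cell_bump_tendsto tendsto_const)
    show "AE x in \<mu>. norm (cell_bump N n i x *\<^sub>R u x) \<le> norm (u x)" for n
      using cell_bump_range[of N n i] by (intro AE_I2) (simp add: mult_left_le_one_le)
  qed
  have ae: "AE x in lebesgue. indicator Omega x *\<^sub>R (indicator ?B x *\<^sub>R u x) = indicator (cell N i) x *\<^sub>R u x"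
    using AE_cell_box[of N i]
  proof eventually_elim
    case (elim x)
    then show ?case using cell_subset_Omega[OF i] by (auto simp: indicator_def)
  qed
  have "(\<integral>x. indicator ?B x *\<^sub>R u x \<partial>\<mu>)
      = (\<integral>x. indicator Omega x *\<^sub>R (indicator ?B x *\<^sub>R u x) \<partial>lebesgue)"
    by (simp add: integral_restrict_space)
  also have "\<dots> = (\<integral>x. indicator (cell N i) x *\<^sub>R u x \<partial>lebesgue)"
  proof (rule integral_cong_AE[OF _ _ ae])
    have "integrable (lebesgue_on (cell N i)) u"
      by (rule integrable_lebesgue_on_subset[OF u cell_subset_Omega[OF i]]) auto
    then show *: "(\<lambda>x. indicator (cell N i) x *\<^sub>R u x) \<in> borel_measurable lebesgue"
      by (simp add: integrable_restrict_space)
    show "(\<lambda>x. indicator Omega x *\<^sub>R (indicator ?B x *\<^sub>R u x)) \<in> borel_measurable lebesgue"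
      by (rule borel_measurable_lebesgue_cong_AE[OF *]) (use ae in \<open>auto elim: eventually_mono\<close>)
  qed
  also have "\<dots> = (\<integral>x. u x \<partial>lebesgue_on (cell N i))"
    by (simp add: integral_restrict_space)
  finally show ?thesis using lim by simp
qed

lemma integral_indicator_cell:
  fixes h :: "real ^ 'n \<Rightarrow> real"
  assumes h: "integrable \<mu> h" and k: "k \<in> interior_indices N"
  shows "integrable \<mu> (\<lambda>x. indicator (cell N k) x * h x)"
    "(\<integral>x. indicator (cell N k) x * h x \<partial>\<mu>) = (\<integral>x. h x \<partial>lebesgue_on (cell N k))"
proof -
  have eq: "(\<lambda>x. indicator Omega x *\<^sub>R (indicator (cell N k) x * h x)) = (\<lambda>x. indicator (cell N k) x *\<^sub>R h x)"
    using cell_subset_Omega[OF k] by (auto simp: fun_eq_iff indicator_def)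
  have "integrable (lebesgue_on (cell N k)) h"
    by (rule integrable_lebesgue_on_subset[OF h cell_subset_Omega[OF k]]) auto
  then have "integrable lebesgue (\<lambda>x. indicator (cell N k) x *\<^sub>R h x)"
    by (simp only: integrable_restrict_space cell_lebesgue sets.Int_space_eq2)
  then show "integrable \<mu> (\<lambda>x. indicator (cell N k) x * h x)"
    by (subst integrable_restrict_space) (simp_all only: eq, auto)
  show "(\<integral>x. indicator (cell N k) x * h x \<partial>\<mu>) = (\<integral>x. h x \<partial>lebesgue_on (cell N k))"
    by (subst (1 2) integral_restrict_space) (simp_all only: eq, auto)
qed

text \<open>The weak gradient is tested with products of bumps, with a tent function in direction \<open>j\<close>.\<close>

lemma cell_integral_difference:
  fixes u :: "real ^ 'n \<Rightarrow> 'b::euclidean_space"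
  assumes N: "N \<ge> 1" and H1: "H1_with_gradient u G"
    and i: "i \<in> interior_indices N" and i': "i(j := i j + 1) \<in> interior_indices N"
  shows "norm ((\<integral>x. u x \<partial>lebesgue_on (cell N (i(j := i j + 1)))) - (\<integral>x. u x \<partial>lebesgue_on (cell N i)))
    \<le> step N * ((\<integral>x. norm (G x $ j) \<partial>lebesgue_on (cell N i))
        + (\<integral>x. norm (G x $ j) \<partial>lebesgue_on (cell N (i(j := i j + 1)))))"
proof -
  define i' where "i' = i(j := i j + 1)"
  note i' = i'[folded i'_def]
  let ?h = "step N"
  let ?Gj = "\<lambda>x. G x $ j"
  have h: "?h > 0" using N by simp
  have u: "integrable \<mu> u"
    using H1 by (intro square_integrable_imp_integrable) (auto simp: H1_with_gradient_def)
  have G: "integrable \<mu> G"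
    using H1 by (intro square_integrable_imp_integrable) (auto simp: H1_with_gradient_def)
  have Gj: "integrable \<mu> ?Gj"
    by (rule integrable_bounded_linear[OF bounded_linear_vec_nth G])
  have lo': "cell_lo N i' $ l = cell_lo N i $ l + (if l = j then ?h else 0)" for l
    by (simp add: i'_def cell_lo_def diff_divide_distrib add_divide_distrib)
  note cells = integral_indicator_cell[OF integrable_norm[OF Gj] i] integral_indicator_cell[OF integrable_norm[OF Gj] i']
  \<comment> \<open>The bound is uniform in \<open>n\<close>; the integrals over the cells
    themselves are reached only in the limit at the end.\<close>
  have key: "norm (\<integral>x. (cell_bump N n i' x - cell_bump N n i x) *\<^sub>R u x \<partial>\<mu>)
      \<le> ?h * ((\<integral>x. norm (?Gj x) \<partial>lebesgue_on (cell N i)) + (\<integral>x. norm (?Gj x) \<partial>lebesgue_on (cell N i')))" for n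
  proof -
    obtain \<tau> where \<tau>: "smooth \<tau>" "\<And>y. deriv \<tau> y = bump ?h n y - bump ?h n (y - ?h)"
      "\<And>y. 0 \<le> \<tau> y \<and> \<tau> y \<le> ?h"
      "\<And>y. y \<le> 1 / real (Suc n) \<or> 2 * ?h - 1 / real (Suc n) \<le> y \<Longrightarrow> \<tau> y = 0"
      using ex_tent[OF h, of n] by blast
    define \<delta> where "\<delta> = 1 / real (Suc n)"
    have \<delta>: "\<delta> > 0" by (simp add: \<delta>_def)
    define lo where "lo l = cell_lo N i $ l" for l
    define r where "r l y = (if l = j then \<tau> (y - lo l) else bump ?h n (y - lo l))" for l y
    have sr: "smooth (r l)" for l
    proof (cases "l = j")
      case True
      have "smooth (\<lambda>y. \<tau> (1 * y + (- lo l)))" by (intro smooth_affine \<tau>)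
      then show ?thesis using True by (simp add: r_def[abs_def])
    next
      case False
      then show ?thesis using smooth_bump by (simp add: r_def[abs_def])
    qed
    have dr: "deriv (r j) y = bump ?h n (y - lo j) - bump ?h n (y - cell_lo N i' $ j)" for y
    proof (rule DERIV_imp_deriv)
      have "((\<lambda>y. \<tau> (y - lo j)) has_real_derivative deriv \<tau> (y - lo j) * 1) (at y)"
        by (rule DERIV_chain2[OF smooth_deriv(1)[OF \<tau>(1)]]) (auto intro!: derivative_eq_intros)
      then show "(r j has_real_derivative bump ?h n (y - lo j) - bump ?h n (y - cell_lo N i' $ j)) (at y)"
        by (simp add: r_def[abs_def] \<tau>(2) lo' lo_def algebra_simps)
    qed
    have dd: "dir_deriv (axis j 1) (prodf r) x = cell_bump N n i x - cell_bump N n i' x" for x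
    proof -
      have "dir_deriv (axis j 1) (prodf r) x = deriv (r j) (x $ j) * (\<Prod>l\<in>UNIV - {j}. r l (x $ l))"
        unfolding dir_deriv_prodf[OF sr] prodf_def by (subst prod.remove[of _ j]) auto
      also have "\<dots> = bump ?h n (x $ j - lo j) * (\<Prod>l\<in>UNIV - {j}. r l (x $ l))
          - bump ?h n (x $ j - cell_lo N i' $ j) * (\<Prod>l\<in>UNIV - {j}. r l (x $ l))"
        by (simp add: dr left_diff_distrib)
      also have "(\<Prod>l\<in>UNIV - {j}. r l (x $ l)) = (\<Prod>l\<in>UNIV - {j}. bump ?h n (x $ l - cell_lo N i $ l))"
        by (intro prod.cong) (auto simp: r_def lo_def)
      also have "bump ?h n (x $ j - lo j) * \<dots> = cell_bump N n i x"
        unfolding cell_bump_def prodf_def lo_def by (subst (2) prod.remove[of _ j]) auto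
      also have "(\<Prod>l\<in>UNIV - {j}. bump ?h n (x $ l - cell_lo N i $ l))
          = (\<Prod>l\<in>UNIV - {j}. bump ?h n (x $ l - cell_lo N i' $ l))"
        by (intro prod.cong) (auto simp: lo')
      also have "bump ?h n (x $ j - cell_lo N i' $ j) * \<dots> = cell_bump N n i' x"
        unfolding cell_bump_def prodf_def by (subst (2) prod.remove[of _ j]) auto
      finally show ?thesis .
    qed
    \<comment> \<open>The support keeps the distance \<open>\<delta>\<close> from the boundary of
      the union of the two cells, hence also from that of \<open>Omega\<close>.\<close>
    have supp: "lo l + \<delta> < x $ l \<and> x $ l < lo l + (if l = j then 2 * ?h else ?h) - \<delta>"
      if x: "prodf r x \<noteq> 0" for x l
    proof -
      have nz: "r l (x $ l) \<noteq> 0" using x by (auto simp: prodf_def)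
      show ?thesis
      proof (cases "l = j")
        case True
        have "\<not> (x $ l - lo l \<le> \<delta> \<or> 2 * ?h - \<delta> \<le> x $ l - lo l)"
          using nz True \<tau>(4)[of "x $ l - lo l", folded \<delta>_def] unfolding r_def by metis
        then have "lo l + \<delta> < x $ l" "x $ l < lo l + 2 * ?h - \<delta>" by linarith+
        then show ?thesis using True by simp
      next
        case False
        have "\<not> (x $ l - lo l \<le> \<delta> \<or> ?h - \<delta> \<le> x $ l - lo l)"
          using nz False bump_eq_0[of "x $ l - lo l" n ?h, folded \<delta>_def] unfolding r_def by metis
        then have "lo l + \<delta> < x $ l" "x $ l < lo l + ?h - \<delta>" by linarith+
        then show ?thesis using False by simp
      qed
    qed
    have lo01: "0 \<le> lo l \<and> lo l + (if l = j then 2 * ?h else ?h) \<le> 1" for l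
    proof -
      have "1 \<le> i l" "i l \<le> N" "l = j \<Longrightarrow> i l + 1 \<le> N"
        using interior_indicesD[OF i, of l] interior_indicesD[OF i', of l] by (auto simp: i'_def)
      then show ?thesis
        using N by (auto simp: lo_def cell_lo_def field_simps)
    qed
    have test: "test_function (interior Omega) (prodf r)"
    proof (rule test_function_prodf[OF sr])
      show "cbox (\<chi> l. \<delta>) (\<chi> l. 1 - \<delta>) \<subseteq> interior (Omega :: (real^'n) set)"
      proof
        fix x :: "real^'n" assume x: "x \<in> cbox (\<chi> l. \<delta>) (\<chi> l. 1 - \<delta>)"
        have "0 < x $ l \<and> x $ l < 1" for l
          using x \<delta> by (auto simp: mem_box_cart dest!: spec[of _ l])
        then show "x \<in> interior Omega" by (simp add: mem_box_cart)
      qed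
      show "x \<in> cbox (\<chi> l. \<delta>) (\<chi> l. 1 - \<delta>)" if "prodf r x \<noteq> 0" for x
        unfolding mem_box_cart
      proof
        fix l
        show "(\<chi> l. \<delta>) $ l \<le> x $ l \<and> x $ l \<le> (\<chi> l. 1 - \<delta>) $ l"
          using supp[OF that, of l] lo01[of l] by simp
      qed
    qed auto
    \<comment> \<open>The factor \<open>h\<close> is the height of the tent, and the bumps are at
      most 1. A point of the support lies in one of the two cells, according to its position
      relative to their common face.\<close>
    have bound: "\<bar>prodf r x\<bar> \<le> ?h * (indicator (cell N i) x + indicator (cell N i') x)" for x
    proof (cases "prodf r x = 0")
      case False
      have s: "lo l < x $ l \<and> x $ l \<le> lo l + (if l = j then 2 * ?h else ?h)" for l
        using supp[OF False, of l] \<delta> by linarith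
      have c: "x \<in> cell N k \<longleftrightarrow> (\<forall>l. cell_lo N k $ l < x $ l \<and> x $ l \<le> cell_lo N k $ l + ?h)" for k :: "'n \<Rightarrow> nat"
        by (simp add: cell_def cell_lo_def diff_divide_distrib)
      have "x \<in> cell N i \<or> x \<in> cell N i'"
      proof (cases "x $ j \<le> lo j + ?h")
        case True
        then have "lo l < x $ l \<and> x $ l \<le> lo l + ?h" for l
          using s[of l] by (cases "l = j") auto
        then show ?thesis unfolding c lo_def by blast
      next
        case False
        then have "cell_lo N i' $ l < x $ l \<and> x $ l \<le> cell_lo N i' $ l + ?h" for l
          using s[of l] unfolding lo' by (cases "l = j") (auto simp: lo_def)
        then show ?thesis unfolding c by blast
      qed
      then have ind: "1 \<le> indicator (cell N i) x + (indicator (cell N i') x :: real)"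
        by (auto simp: indicator_def)
      have "\<bar>prodf r x\<bar> = \<bar>r j (x $ j)\<bar> * (\<Prod>l\<in>UNIV - {j}. \<bar>r l (x $ l)\<bar>)"
        unfolding prodf_def abs_prod by (subst prod.remove[of _ j]) auto
      also have "\<dots> \<le> ?h * 1"
        using \<tau>(3) bump_range h by (intro mult_mono prod_le_1 prod_nonneg) (auto simp: r_def)
      also have "\<dots> \<le> ?h * (indicator (cell N i) x + indicator (cell N i') x)"
        using ind h by (intro mult_left_mono) auto
      finally show ?thesis .
    qed (use h in simp)
    have "(\<integral>x. dir_deriv (axis j 1) (prodf r) x *\<^sub>R u x \<partial>\<mu>)
        = - (\<integral>x. prodf r x *\<^sub>R ?Gj x \<partial>\<mu>)"
      using H1 test unfolding H1_with_gradient_def by blast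
    moreover have "(\<integral>x. dir_deriv (axis j 1) (prodf r) x *\<^sub>R u x \<partial>\<mu>)
        = - (\<integral>x. (cell_bump N n i' x - cell_bump N n i x) *\<^sub>R u x \<partial>\<mu>)"
      unfolding dd Bochner_Integration.integral_minus[symmetric] by (simp add: scaleR_minus_left[symmetric])
    ultimately have "norm (\<integral>x. (cell_bump N n i' x - cell_bump N n i x) *\<^sub>R u x \<partial>\<mu>)
        = norm (\<integral>x. prodf r x *\<^sub>R ?Gj x \<partial>\<mu>)"
      by simp
    also have "\<dots> \<le> (\<integral>x. ?h * (indicator (cell N i) x * norm (?Gj x) + indicator (cell N i') x * norm (?Gj x)) \<partial>\<mu>)"
    proof (rule order_trans[OF integral_norm_bound], rule integral_mono')
      show "integrable \<mu>
          (\<lambda>x. ?h * (indicator (cell N i) x * norm (?Gj x) + indicator (cell N i') x * norm (?Gj x)))"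
        using cells by simp
      show "norm (prodf r x *\<^sub>R ?Gj x)
          \<le> ?h * (indicator (cell N i) x * norm (?Gj x) + indicator (cell N i') x * norm (?Gj x))" for x
        using mult_right_mono[OF bound[of x] norm_ge_zero[of "?Gj x"]] by (simp add: algebra_simps)
      show "0 \<le> ?h * (indicator (cell N i) x * norm (?Gj x) + indicator (cell N i') x * norm (?Gj x))" for x
        using h by simp
    qed
    also have "\<dots> = ?h * ((\<integral>x. norm (?Gj x) \<partial>lebesgue_on (cell N i)) + (\<integral>x. norm (?Gj x) \<partial>lebesgue_on (cell N i')))"
      using cells by simp
    finally show ?thesis .
  qed
  have int: "integrable \<mu> (\<lambda>x. cell_bump N n k x *\<^sub>R u x)" for n k
  proof (rule Bochner_Integration.integrable_bound[OF integrable_norm[OF u]])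
    show "(\<lambda>x. cell_bump N n k x *\<^sub>R u x) \<in> borel_measurable \<mu>"
      using cell_bump_measurable u by (intro borel_measurable_scaleR) auto
    show "AE x in \<mu>. norm (cell_bump N n k x *\<^sub>R u x) \<le> norm (norm (u x))"
      using cell_bump_range[of N n k] by (intro AE_I2) (simp add: mult_left_le_one_le)
  qed
  have "(\<lambda>n. norm ((\<integral>x. cell_bump N n i' x *\<^sub>R u x \<partial>\<mu>) - (\<integral>x. cell_bump N n i x *\<^sub>R u x \<partial>\<mu>)))
      \<longlonglongrightarrow> norm ((\<integral>x. u x \<partial>lebesgue_on (cell N i')) - (\<integral>x. u x \<partial>lebesgue_on (cell N i)))"
    by (intro tendsto_norm tendsto_diff integral_cell_bump_tendsto u i i')
  then show ?thesis
    unfolding i'_def[symmetric]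
  proof (rule LIMSEQ_le_const2)
    show "\<exists>M. \<forall>n\<ge>M. norm ((\<integral>x. cell_bump N n i' x *\<^sub>R u x \<partial>\<mu>) - (\<integral>x. cell_bump N n i x *\<^sub>R u x \<partial>\<mu>))
        \<le> ?h * ((\<integral>x. norm (?Gj x) \<partial>lebesgue_on (cell N i)) + (\<integral>x. norm (?Gj x) \<partial>lebesgue_on (cell N i')))"
      using key int by (auto simp: scaleR_left_diff_distrib)
  qed
qed

subsection \<open>Cell averages\<close>

lemma square_integrable_subset:
  assumes "square_integrable S u" "T \<subseteq> S" "T \<in> sets lebesgue" "S \<in> sets lebesgue"
  shows "square_integrable T u"
  using assms integrable_lebesgue_on_subset[OF _ assms(2-4)] measurable_restrict_mono[OF _ assms(2)]
  unfolding square_integrable_def by blast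

text \<open>Jensen's inequality. Young's inequality against the constant function whose value is the
  mean \<open>c\<close> bounds twice \<open>?m * (norm c)\<^sup>2\<close> by the integral plus once
  the same quantity.\<close>

lemma norm_integral_power2_le:
  assumes S: "S \<in> lmeasurable" "measure lebesgue S > 0" and u: "square_integrable S u"
  shows "(norm (\<integral>x. u x \<partial>lebesgue_on S))\<^sup>2 \<le> measure lebesgue S * (\<integral>x. (norm (u x))\<^sup>2 \<partial>lebesgue_on S)"
proof -
  let ?m = "measure lebesgue S"
  define c where "c = (1 / ?m) *\<^sub>R (\<integral>x. u x \<partial>lebesgue_on S)"
  have int: "integrable (lebesgue_on S) u" by (rule square_integrable_imp_integrable[OF S(1) u])
  have c: "(\<integral>x. u x \<partial>lebesgue_on S) = ?m *\<^sub>R c" using S(2) by (simp add: c_def)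
  have "(\<integral>x. u x \<bullet> c \<partial>lebesgue_on S) = (\<integral>x. u x \<partial>lebesgue_on S) \<bullet> c"
    using int by (rule integral_inner_left[rotated])
  also have "\<dots> = ?m * (norm c)\<^sup>2"
    unfolding c by (simp add: power2_norm_eq_inner)
  finally have "2 * \<bar>?m * (norm c)\<^sup>2\<bar> \<le> 1 * (\<integral>x. (norm (u x))\<^sup>2 \<partial>lebesgue_on S) + (\<integral>x. (norm c)\<^sup>2 \<partial>lebesgue_on S) / 1"
    using integral_young[OF u square_integrable_const[OF S(1), of c], of 1] by simp
  moreover have "(\<integral>x. (norm c)\<^sup>2 \<partial>lebesgue_on S) = ?m * (norm c)\<^sup>2"
    using S(1) by (simp add: measure_restrict_space fmeasurableD)
  ultimately have "2 * \<bar>?m * (norm c)\<^sup>2\<bar> \<le> (\<integral>x. (norm (u x))\<^sup>2 \<partial>lebesgue_on S) + ?m * (norm c)\<^sup>2"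
    by (simp only: mult_1 div_by_1)
  then have "?m * (norm c)\<^sup>2 \<le> (\<integral>x. (norm (u x))\<^sup>2 \<partial>lebesgue_on S)"
    using abs_ge_self[of "?m * (norm c)\<^sup>2"] by linarith
  then have "?m * (?m * (norm c)\<^sup>2) \<le> ?m * (\<integral>x. (norm (u x))\<^sup>2 \<partial>lebesgue_on S)"
    using S(2) by (intro mult_left_mono) auto
  then show ?thesis unfolding c by (simp add: power_mult_distrib power2_eq_square mult_ac)
qed

lemma cell_volume_pos: "N \<ge> 1 \<Longrightarrow> 0 < step N ^ k"
  by simp

lemma square_integrable_cell:
  "square_integrable Omega u \<Longrightarrow> i \<in> interior_indices N \<Longrightarrow> square_integrable (cell N i) u"
  by (rule square_integrable_subset[OF _ cell_subset_Omega]) auto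

lemma norm_integral_cell_power2_le:
  fixes u :: "real ^ 'n \<Rightarrow> 'b::euclidean_space"
  assumes "N \<ge> 1" "square_integrable Omega u" "i \<in> interior_indices N"
  shows "(norm (\<integral>x. u x \<partial>lebesgue_on (cell N i)))\<^sup>2
    \<le> step N ^ CARD('n) * (\<integral>x. (norm (u x))\<^sup>2 \<partial>lebesgue_on (cell N i))"
  using norm_integral_power2_le[of "cell N i" u] assms
  by (simp add: cell_lmeasurable measure_cell[OF assms(1), simplified] square_integrable_cell)

lemma cell_average_power2_le:
  fixes u :: "real ^ 'n \<Rightarrow> 'b::euclidean_space"
  assumes N: "N \<ge> 1" and u: "square_integrable Omega u" "i \<in> interior_indices N"
  shows "step N ^ CARD('n) * (norm (cell_average N u i))\<^sup>2 \<le> (\<integral>x. (norm (u x))\<^sup>2 \<partial>lebesgue_on (cell N i))"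
proof -
  let ?v = "step N ^ CARD('n)" and ?I = "\<integral>x. u x \<partial>lebesgue_on (cell N i)"
  have v: "0 < ?v" using cell_volume_pos[OF N] .
  have avg: "norm (cell_average N u i) = norm ?I / ?v"
    unfolding cell_average_def measure_cell[OF N] using v by simp
  have "w * (x / w)\<^sup>2 = x\<^sup>2 / w" if "w > 0" for w x :: real
    using that by (simp add: power2_eq_square)
  then have "?v * (norm (cell_average N u i))\<^sup>2 = (norm ?I)\<^sup>2 / ?v"
    unfolding avg using v by blast
  also have "\<dots> \<le> (?v * (\<integral>x. (norm (u x))\<^sup>2 \<partial>lebesgue_on (cell N i))) / ?v"
    using norm_integral_cell_power2_le[OF N u] v by (intro divide_right_mono) auto
  finally show ?thesis using v N by simp
qed

lemma L2_norm_cell_average_le: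
  fixes u :: "real ^ 'n \<Rightarrow> 'b::euclidean_space"
  assumes N: "N \<ge> 1" and u: "square_integrable Omega u"
    and a: "\<And>i. i \<in> interior_indices N \<Longrightarrow> a i = cell_average N u i"
  shows "step N ^ CARD('n) * (\<Sum>i\<in>interior_indices N. (norm (a i))\<^sup>2) \<le> sqnorm u"
proof -
  have "step N ^ CARD('n) * (\<Sum>i\<in>interior_indices N. (norm (a i))\<^sup>2)
      = (\<Sum>i\<in>interior_indices N. step N ^ CARD('n) * (norm (cell_average N u i))\<^sup>2)"
    unfolding sum_distrib_left by (intro sum.cong) (auto simp: a)
  also have "\<dots> \<le> (\<Sum>i\<in>interior_indices N. \<integral>x. (norm (u x))\<^sup>2 \<partial>lebesgue_on (cell N i))"
    by (intro sum_mono cell_average_power2_le N u)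
  also have "\<dots> = sqnorm u"
    unfolding L2_norm_power2 by (rule integral_cells[OF N square_integrable_integrable[OF u], symmetric])
  finally show ?thesis .
qed

text \<open>Averages of unit vectors lie in the unit ball but in general not on the sphere. The
  bounds on the director forms therefore rely on length at most 1 only.\<close>

lemma norm_cell_average_le_1:
  fixes u :: "real ^ 'n \<Rightarrow> 'b::euclidean_space"
  assumes N: "N \<ge> 1" and u: "square_integrable Omega u" and i: "i \<in> interior_indices N"
    and 1: "AE x in \<mu>. norm (u x) = 1"
  shows "norm (cell_average N u i) \<le> 1"
proof -
  let ?v = "step N ^ CARD('n)"
  have v: "0 < ?v" using cell_volume_pos[OF N] .
  have "AE x in lebesgue. x \<in> Omega \<longrightarrow> norm (u x) = 1"
    using 1 by (simp add: AE_restrict_space_iff)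
  then have ae: "AE x in lebesgue_on (cell N i). (norm (u x))\<^sup>2 = 1"
    using cell_subset_Omega[OF i] by (auto simp: AE_restrict_space_iff elim!: eventually_mono)
  have "?v * (norm (cell_average N u i))\<^sup>2 \<le> (\<integral>x. (norm (u x))\<^sup>2 \<partial>lebesgue_on (cell N i))"
    by (rule cell_average_power2_le[OF N u i])
  also have "\<dots> = (\<integral>x. 1 \<partial>lebesgue_on (cell N i))"
    by (rule integral_cong_AE) (use ae square_integrable_cell[OF u i] in \<open>auto simp: square_integrable_def\<close>)
  also have "\<dots> = ?v"
    by (simp add: measure_restrict_space measure_cell[OF N, simplified])
  finally have "?v * (norm (cell_average N u i))\<^sup>2 \<le> ?v * 1"
    by (simp only: mult_1_right)
  then have "(norm (cell_average N u i))\<^sup>2 \<le> 1"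
    by (simp only: mult_le_cancel_left_pos[OF v])
  then have "(norm (cell_average N u i))\<^sup>2 \<le> 1\<^sup>2" by simp
  then show ?thesis by (rule power2_le_imp_le) simp
qed

lemma square_integrable_vec_nth:
  fixes G :: "real ^ 'n \<Rightarrow> 'b::euclidean_space ^ 'm"
  assumes G: "square_integrable S G"
  shows "square_integrable S (\<lambda>x. G x $ j)"
proof (rule square_integrable_bound[OF G])
  have "(\<lambda>v::'b^'m. v $ j) \<in> borel_measurable borel"
    by (intro borel_measurable_continuous_onI continuous_intros)
  then show "(\<lambda>x. G x $ j) \<in> borel_measurable (lebesgue_on S)"
    using square_integrable_measurable[OF G] by (rule measurable_compose[rotated])
  show "AE x in lebesgue_on S. norm (G x $ j) \<le> norm (G x)"
    by (intro AE_I2 Finite_Cartesian_Product.norm_nth_le)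
qed

text \<open>The factor \<open>h\<close> of \<open>cell_integral_difference\<close> cancels the
  \<open>1 / h\<close> of the difference quotient, and Jensen's inequality on each cell passes from
  integrals of the norm to integrals of its square. The constant is thus independent of
  \<open>N\<close>.\<close>

lemma forward_diff_cell_average:
  fixes u :: "real ^ 'n \<Rightarrow> 'b::euclidean_space"
  assumes N: "N \<ge> 1" and H1: "H1_with_gradient u G"
    and i: "i \<in> interior_indices N" and i': "i(j := i j + 1) \<in> interior_indices N"
  shows "step N ^ CARD('n) * (norm (forward_diff N j (cell_average N u) i))\<^sup>2
    \<le> 2 * (\<integral>x. (norm (G x $ j))\<^sup>2 \<partial>lebesgue_on (cell N i))
      + 2 * (\<integral>x. (norm (G x $ j))\<^sup>2 \<partial>lebesgue_on (cell N (i(j := i j + 1))))"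
proof -
  define v where "v = step N ^ CARD('n)"
  define h where "h = step N"
  define i' where "i' = i(j := i j + 1)"
  note i' = i'[folded i'_def]
  define g where "g k = (\<integral>x. norm (G x $ j) \<partial>lebesgue_on (cell N k))" for k :: "'n \<Rightarrow> nat"
  define q where "q k = (\<integral>x. (norm (G x $ j))\<^sup>2 \<partial>lebesgue_on (cell N k))" for k :: "'n \<Rightarrow> nat"
  have v: "0 < v" unfolding v_def using cell_volume_pos[OF N] .
  have h: "0 < h" using N by (simp add: h_def)
  have G: "square_integrable Omega G" using H1 by (simp add: H1_with_gradient_def)
  have Gj: "square_integrable Omega (\<lambda>x. G x $ j)"
    by (rule square_integrable_vec_nth[OF G])
  have gq: "(g k)\<^sup>2 \<le> v * q k" if "k \<in> interior_indices N" for k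
    using norm_integral_cell_power2_le[OF N square_integrable_norm[OF Gj] that] by (simp add: g_def q_def v_def)
  have "forward_diff N j (cell_average N u) i = (1 / (h * v)) *\<^sub>R
      ((\<integral>x. u x \<partial>lebesgue_on (cell N i')) - (\<integral>x. u x \<partial>lebesgue_on (cell N i)))"
    unfolding forward_diff_def cell_average_def measure_cell[OF N] i'_def v_def[symmetric] unfolding h_def[symmetric]
    by (simp add: scaleR_diff_right)
  then have "norm (forward_diff N j (cell_average N u) i) = (1 / (h * v)) *
      norm ((\<integral>x. u x \<partial>lebesgue_on (cell N i')) - (\<integral>x. u x \<partial>lebesgue_on (cell N i)))"
    using h v by simp
  also have "\<dots> \<le> (1 / (h * v)) * (h * (g i + g i'))"
    using cell_integral_difference[OF N H1 i i'[unfolded i'_def], folded i'_def h_def] h v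
    unfolding g_def by (intro mult_left_mono) auto
  also have "\<dots> = (g i + g i') / v" using h by simp
  finally have "(norm (forward_diff N j (cell_average N u) i))\<^sup>2 \<le> ((g i + g i') / v)\<^sup>2"
    by (rule power_mono) simp
  also have "\<dots> \<le> (2 * (g i)\<^sup>2 + 2 * (g i')\<^sup>2) / v\<^sup>2"
    using sum_squares_bound[of "g i" "g i'"] by (simp only: power_divide) (intro divide_right_mono, auto simp: power2_sum)
  also have "\<dots> \<le> (2 * (v * q i) + 2 * (v * q i')) / v\<^sup>2"
    using gq[OF i] gq[OF i'] by (intro divide_right_mono) auto
  also have "\<dots> = (2 * q i + 2 * q i') / v"
    using v by (simp add: power2_eq_square field_simps)
  finally have "v * (norm (forward_diff N j (cell_average N u) i))\<^sup>2 \<le> 2 * q i + 2 * q i'"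
    using v by (simp add: pos_le_divide_eq mult.commute)
  then show ?thesis unfolding q_def i'_def v_def .
qed

text \<open>In each direction a cell occurs at most twice, as the lower and as the upper one of a
  pair, each time with the factor 2 of \<open>forward_diff_cell_average\<close>; hence the
  4.\<close>

lemma discrete_gradient_cell_average:
  fixes u :: "real ^ 'n \<Rightarrow> 'b::euclidean_space"
  assumes N: "N \<ge> 1" and H1: "H1_with_gradient u G" and nm: "neumann N a"
    and a: "\<And>i. i \<in> interior_indices N \<Longrightarrow> a i = cell_average N u i"
  shows "step N ^ CARD('n) * (\<Sum>i\<in>interior_indices N. \<Sum>j\<in>UNIV. (norm (forward_diff N j a i))\<^sup>2)
    \<le> 4 * sqnorm G"
proof -
  let ?v = "step N ^ CARD('n)" and ?I = "interior_indices N :: ('n \<Rightarrow> nat) set"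
  define q where "q j k = (\<integral>x. (norm (G x $ j))\<^sup>2 \<partial>lebesgue_on (cell N k))" for j and k :: "'n \<Rightarrow> nat"
  have q0: "0 \<le> q j k" for j k by (simp add: q_def)
  have G: "square_integrable Omega G" using H1 by (simp add: H1_with_gradient_def)
  have Gj: "square_integrable Omega (\<lambda>x. G x $ j)" for j
    by (rule square_integrable_vec_nth[OF G])
  have dir: "?v * (\<Sum>i\<in>?I. (norm (forward_diff N j a i))\<^sup>2) \<le> 4 * (\<Sum>i\<in>?I. q j i)" for j
  proof -
    \<comment> \<open>In the last layer the upper neighbour is a ghost cell, where \<open>a\<close>
      need not be a cell average. The default 0 is correct there since the difference vanishes by
      the Neumann condition.\<close>
    let ?Q = "\<lambda>i. if i j = N then 0 else q j (i(j := i j + 1))"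
    have "?v * (\<Sum>i\<in>?I. (norm (forward_diff N j a i))\<^sup>2) \<le> (\<Sum>i\<in>?I. 2 * q j i + 2 * ?Q i)"
      unfolding sum_distrib_left
    proof (rule sum_mono)
      fix i assume i: "i \<in> ?I"
      show "?v * (norm (forward_diff N j a i))\<^sup>2 \<le> 2 * q j i + 2 * ?Q i"
      proof (cases "i j = N")
        case True
        then show ?thesis using neumann_forward[OF nm i True] q0 by simp
      next
        case False
        then have i': "i(j := i j + 1) \<in> ?I"
          using interior_indicesD[OF i, of j] by (intro interior_indices_upd i) auto
        have "forward_diff N j a i = forward_diff N j (cell_average N u) i"
          using a[OF i] a[OF i'] by (simp add: forward_diff_def)
        then show ?thesis
          using forward_diff_cell_average[OF N H1 i i'] False by (simp add: q_def)
      qed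
    qed
    also have "\<dots> = 2 * (\<Sum>i\<in>?I. q j i) + 2 * (\<Sum>i\<in>?I. ?Q i)"
      by (simp only: sum.distrib sum_distrib_left)
    also have "(\<Sum>i\<in>?I. ?Q i) = (\<Sum>i\<in>?I. if i j = 1 then 0 else q j i)"
    proof (rule sum_interior_shift[of N j, symmetric])
      show "(if (i(j := i j + 1)) j = 1 then 0 else q j (i(j := i j + 1))) = ?Q i"
        if "i \<in> ?I" "i j < N" for i
        using interior_indicesD[OF that(1), of j] that(2) by auto
    qed auto
    also have "\<dots> \<le> (\<Sum>i\<in>?I. q j i)"
      using q0 by (intro sum_mono) auto
    finally show ?thesis by simp
  qed
  have "?v * (\<Sum>i\<in>?I. \<Sum>j\<in>UNIV. (norm (forward_diff N j a i))\<^sup>2)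
      = (\<Sum>j\<in>UNIV. ?v * (\<Sum>i\<in>?I. (norm (forward_diff N j a i))\<^sup>2))"
    by (subst sum.swap) (simp only: sum_distrib_left)
  also have "\<dots> \<le> (\<Sum>j\<in>UNIV. 4 * (\<Sum>i\<in>?I. q j i))"
    by (intro sum_mono dir)
  also have "\<dots> = 4 * (\<Sum>j\<in>UNIV. \<integral>x. (norm (G x $ j))\<^sup>2 \<partial>\<mu>)"
    unfolding q_def sum_distrib_left[symmetric]
    by (subst integral_cells[OF N square_integrable_integrable[OF Gj]]) simp
  also have "(\<Sum>j\<in>UNIV. \<integral>x. (norm (G x $ j))\<^sup>2 \<partial>\<mu>)
      = (\<integral>x. (\<Sum>j\<in>UNIV. (norm (G x $ j))\<^sup>2) \<partial>\<mu>)"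
    by (intro Bochner_Integration.integral_sum[symmetric] square_integrable_integrable Gj)
  also have "\<dots> = sqnorm G"
    unfolding L2_norm_power2 norm_vec_power2 ..
  finally show ?thesis .
qed

subsection \<open>The elliptic problem\<close>

lemma linear_embed: "linear (embed e)"
  by (rule linearI) (auto simp: embed_def scaleR_left.add sum.distrib scaleR_sum_right)

lemma norm_embed:
  assumes "inj e" shows "norm (embed e v) = norm v"
proof -
  have "embed e v \<bullet> embed e v = (\<Sum>j\<in>UNIV. \<Sum>l\<in>UNIV. if l = j then v $ j * v $ l else 0)"
    unfolding embed_def inner_sum_left inner_sum_right
    by (intro sum.cong refl) (auto simp: inner_axis_axis inj_eq[OF assms])
  also have "\<dots> = v \<bullet> v"
    by (simp add: inner_vec_def)
  finally show ?thesis by (simp add: norm_eq_sqrt_inner)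
qed

text \<open>\<open>a_form\<close> on vector fields instead of functions. Fields may be replaced by
  others that agree almost everywhere, and differences of gradients can be inserted without being
  written as gradients.\<close>

definition director_form ::
    "('n::finite \<Rightarrow> 3) \<Rightarrow> real \<Rightarrow> (real ^ 'n \<Rightarrow> real ^ 3) \<Rightarrow> (real ^ 'n \<Rightarrow> real ^ 'n) \<Rightarrow> (real ^ 'n \<Rightarrow> real ^ 'n) \<Rightarrow> real"
  where "director_form e \<epsilon> dh A B =
    (\<integral>x. A x \<bullet> B x + \<epsilon> * (dh x \<bullet> embed e (A x)) * (dh x \<bullet> embed e (B x)) \<partial>\<mu>)"

lemma a_form_eq: "a_form e \<epsilon> dh u v = director_form e \<epsilon> dh (grad u) (grad v)"
  by (simp add: a_form_def director_form_def)

lemma director_form_commute: "director_form e \<epsilon> dh A B = director_form e \<epsilon> dh B A"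
  by (simp add: director_form_def inner_commute mult_ac)

lemma square_integrable_embed:
  fixes A :: "real ^ 'n \<Rightarrow> real ^ 'n"
  assumes e: "inj e" and A: "square_integrable Omega A"
  shows "square_integrable Omega (\<lambda>x. embed e (A x))"
proof (rule square_integrable_bound[OF A])
  have "embed e \<in> borel_measurable borel"
    by (intro borel_measurable_continuous_onI linear_continuous_on)
      (simp add: linear_conv_bounded_linear[symmetric] linear_embed)
  then show "(\<lambda>x. embed e (A x)) \<in> borel_measurable \<mu>"
    using square_integrable_measurable[OF A] by (rule measurable_compose[rotated])
qed (simp add: norm_embed[OF e])

locale director =
  fixes e :: "'n::finite \<Rightarrow> 3" and \<epsilon> :: real and dh :: "real ^ 'n \<Rightarrow> real ^ 3"
  assumes inj: "inj e" and eps: "\<epsilon> > -1"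
    and dh_measurable: "dh \<in> borel_measurable \<mu>"
    and dh_le_1: "\<And>x. norm (dh x) \<le> 1"
begin

abbreviation form where "form \<equiv> director_form e \<epsilon> dh"

lemma inner_dh_le: "\<bar>dh x \<bullet> embed e v\<bar> \<le> norm v"
proof -
  have "\<bar>dh x \<bullet> embed e v\<bar> \<le> norm (dh x) * norm (embed e v)"
    by (rule Cauchy_Schwarz_ineq2)
  also have "\<dots> \<le> 1 * norm v"
    using dh_le_1 by (intro mult_mono) (auto simp: norm_embed[OF inj])
  finally show ?thesis by simp
qed

lemma square_integrable_dh:
  assumes A: "square_integrable Omega A"
  shows "square_integrable Omega (\<lambda>x. dh x \<bullet> embed e (A x))"
proof (rule square_integrable_bound[OF A])
  show "(\<lambda>x. dh x \<bullet> embed e (A x)) \<in> borel_measurable \<mu>"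
    using dh_measurable square_integrable_measurable[OF square_integrable_embed[OF inj A]] by simp
  show "AE x in \<mu>. norm (dh x \<bullet> embed e (A x)) \<le> norm (A x)"
    using inner_dh_le by simp
qed

lemma form_integrable:
  assumes "square_integrable Omega A" "square_integrable Omega B"
  shows "integrable \<mu> (\<lambda>x. A x \<bullet> B x)"
    "integrable \<mu> (\<lambda>x. (dh x \<bullet> embed e (A x)) * (dh x \<bullet> embed e (B x)))"
  using assms by (auto intro!: square_integrable_inner square_integrable_mult square_integrable_dh)

lemma form_eq:
  assumes "square_integrable Omega A" "square_integrable Omega B"
  shows "form A B = (\<integral>x. A x \<bullet> B x \<partial>\<mu>)
    + \<epsilon> * (\<integral>x. (dh x \<bullet> embed e (A x)) * (dh x \<bullet> embed e (B x)) \<partial>\<mu>)"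
  using form_integrable[OF assms] by (simp add: director_form_def mult.assoc)

lemma form_add:
  assumes "square_integrable Omega A" "square_integrable Omega A'" "square_integrable Omega B"
  shows "form (\<lambda>x. A x + A' x) B = form A B + form A' B"
  using form_integrable[OF assms(1,3)] form_integrable[OF assms(2,3)]
  by (simp add: form_eq assms square_integrable_add linear_add[OF linear_embed] inner_add_left inner_add_right algebra_simps)

lemma form_diff:
  assumes "square_integrable Omega A" "square_integrable Omega A'" "square_integrable Omega B"
  shows "form (\<lambda>x. A x - A' x) B = form A B - form A' B"
  using form_integrable[OF assms(1,3)] form_integrable[OF assms(2,3)]
  by (simp add: form_eq assms square_integrable_diff linear_diff[OF linear_embed] inner_diff_left inner_diff_right algebra_simps)

lemma form_scale:
  assumes "square_integrable Omega A" "square_integrable Omega B"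
  shows "form (\<lambda>x. c *\<^sub>R A x) B = c * form A B"
  using form_integrable[OF assms]
  by (simp add: form_eq assms square_integrable_scaleR linear_scale[OF linear_embed] mult.assoc algebra_simps)

lemma form_cong_AE:
  assumes "square_integrable Omega A" "square_integrable Omega A'" "square_integrable Omega B"
    and "AE x in \<mu>. A x = A' x"
  shows "form A B = form A' B"
  unfolding director_form_def
proof (rule integral_cong_AE)
  show "(\<lambda>x. A x \<bullet> B x + \<epsilon> * (dh x \<bullet> embed e (A x)) * (dh x \<bullet> embed e (B x))) \<in> borel_measurable \<mu>"
    using form_integrable[OF assms(1,3)] by (simp add: mult.assoc)
  show "(\<lambda>x. A' x \<bullet> B x + \<epsilon> * (dh x \<bullet> embed e (A' x)) * (dh x \<bullet> embed e (B x))) \<in> borel_measurable \<mu>"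
    using form_integrable[OF assms(2,3)] by (simp add: mult.assoc)
  show "AE x in \<mu>. A x \<bullet> B x + \<epsilon> * (dh x \<bullet> embed e (A x)) * (dh x \<bullet> embed e (B x))
      = A' x \<bullet> B x + \<epsilon> * (dh x \<bullet> embed e (A' x)) * (dh x \<bullet> embed e (B x))"
    using assms(4) by eventually_elim simp
qed

lemma integral_dh_le:
  assumes "square_integrable Omega A"
  shows "(\<integral>x. (norm (dh x \<bullet> embed e (A x)))\<^sup>2 \<partial>\<mu>) \<le> sqnorm A"
  unfolding L2_norm_power2
proof (rule integral_mono)
  show "integrable \<mu> (\<lambda>x. (norm (dh x \<bullet> embed e (A x)))\<^sup>2)"
    using square_integrable_integrable[OF square_integrable_dh[OF assms]] .
  show "integrable \<mu> (\<lambda>x. (norm (A x))\<^sup>2)"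
    using square_integrable_integrable[OF assms] .
  show "(norm (dh x \<bullet> embed e (A x)))\<^sup>2 \<le> (norm (A x))\<^sup>2" for x
    using inner_dh_le[of x "A x"] by (intro power_mono) auto
qed

lemma form_bound:
  assumes A: "square_integrable Omega A" and B: "square_integrable Omega B" and s: "s > 0"
  shows "2 * \<bar>form A B\<bar> \<le> (1 + \<bar>\<epsilon>\<bar>) * (s * sqnorm A + sqnorm B / s)"
proof -
  let ?X = "s * sqnorm A + sqnorm B / s"
  let ?a = "\<integral>x. A x \<bullet> B x \<partial>\<mu>"
  let ?b = "\<integral>x. (dh x \<bullet> embed e (A x)) * (dh x \<bullet> embed e (B x)) \<partial>\<mu>"
  have 1: "2 * \<bar>?a\<bar> \<le> ?X"
    using integral_young[OF A B s] by (simp add: L2_norm_power2)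
  have "2 * \<bar>?b\<bar> \<le> s * (\<integral>x. (norm (dh x \<bullet> embed e (A x)))\<^sup>2 \<partial>\<mu>)
      + (\<integral>x. (norm (dh x \<bullet> embed e (B x)))\<^sup>2 \<partial>\<mu>) / s"
    using integral_young[OF square_integrable_dh[OF A] square_integrable_dh[OF B] s] by simp
  also have "\<dots> \<le> ?X"
    using s integral_dh_le[OF A] integral_dh_le[OF B] by (intro add_mono mult_left_mono divide_right_mono) auto
  finally have 2: "\<bar>\<epsilon>\<bar> * (2 * \<bar>?b\<bar>) \<le> \<bar>\<epsilon>\<bar> * ?X" by (intro mult_left_mono) auto
  have "\<bar>form A B\<bar> \<le> \<bar>?a\<bar> + \<bar>\<epsilon>\<bar> * \<bar>?b\<bar>"
    unfolding form_eq[OF A B] using abs_triangle_ineq[of ?a "\<epsilon> * ?b"] by (simp add: abs_mult)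
  moreover have "2 * f \<le> (1 + t) * X" if "f \<le> a + t * b" "2 * a \<le> X" "t * (2 * b) \<le> t * X" for f a b t X :: real
    using that by (simp add: algebra_simps)
  ultimately show ?thesis using 1 2 by blast
qed

text \<open>As the director has length at most 1, its squared product with \<open>A x\<close> lies
  between 0 and the squared norm of \<open>A x\<close>. A negative \<open>\<epsilon>\<close>
  therefore takes away at most the fraction \<open>- \<epsilon>\<close>, which is less than
  1.\<close>

lemma form_coercive:
  assumes A: "square_integrable Omega A"
  shows "min 1 (1 + \<epsilon>) * sqnorm A \<le> form A A"
proof -
  have "min 1 (1 + \<epsilon>) * (norm (A x))\<^sup>2 \<le> A x \<bullet> A x + \<epsilon> * (dh x \<bullet> embed e (A x)) * (dh x \<bullet> embed e (A x))" for x
  proof -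
    define q where "q = (dh x \<bullet> embed e (A x))\<^sup>2"
    have q: "0 \<le> q" "q \<le> (norm (A x))\<^sup>2"
      using power_mono[OF inner_dh_le[of x "A x"], of 2] by (auto simp: q_def)
    have "min 1 (1 + \<epsilon>) * (norm (A x))\<^sup>2 \<le> (norm (A x))\<^sup>2 + \<epsilon> * q"
    proof (cases "\<epsilon> \<ge> 0")
      case True
      then show ?thesis using q by simp
    next
      case False
      then have "- \<epsilon> * q \<le> - \<epsilon> * (norm (A x))\<^sup>2" using q by (intro mult_left_mono) auto
      then show ?thesis using False by (simp add: algebra_simps)
    qed
    moreover have "A x \<bullet> A x = (norm (A x))\<^sup>2" by (rule dot_square_norm)
    moreover have "\<epsilon> * (dh x \<bullet> embed e (A x)) * (dh x \<bullet> embed e (A x)) = \<epsilon> * q"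
      by (simp add: q_def power2_eq_square)
    ultimately show ?thesis by argo
  qed
  then have "(\<integral>x. min 1 (1 + \<epsilon>) * (norm (A x))\<^sup>2 \<partial>\<mu>) \<le> form A A"
    unfolding director_form_def
    using form_integrable[OF A A] square_integrable_integrable[OF A]
    by (intro integral_mono) (auto simp: mult.assoc)
  then show ?thesis using square_integrable_integrable[OF A] by (simp add: L2_norm_power2)
qed

end

text \<open>Of the form \<open>2 * R + 2\<close>, where \<open>R\<close> is the constant for
  \<open>grad u\<close> and the doubling comes from \<open>\<phi> = u + g\<close>. In
  \<open>R\<close>, the denominator is the square of the coercivity constant,
  \<open>1 + \<bar>\<epsilon>\<bar>\<close> is the continuity constant of the form, and 8 is twice
  the Poincare constant 4.\<close>

definition elliptic_const :: "real \<Rightarrow> real"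
  where "elliptic_const \<epsilon> = 2 * ((8 + 2 * (1 + \<bar>\<epsilon>\<bar>)\<^sup>2) / (min 1 (1 + \<epsilon>))\<^sup>2) + 2"

lemma elliptic_const_ge: "2 \<le> elliptic_const \<epsilon>"
  by (simp add: elliptic_const_def)

lemma L2_norm_power2_add_le:
  assumes "square_integrable S u" "square_integrable S v"
  shows "(L2_norm S (\<lambda>x. u x + v x))\<^sup>2 \<le> 2 * (L2_norm S u)\<^sup>2 + 2 * (L2_norm S v)\<^sup>2"
proof -
  have "(L2_norm S (\<lambda>x. u x + v x))\<^sup>2 \<le> (\<integral>x. 2 * (norm (u x))\<^sup>2 + 2 * (norm (v x))\<^sup>2 \<partial>lebesgue_on S)"
    unfolding L2_norm_power2
    using square_integrable_integrable[OF square_integrable_add[OF assms]] square_integrable_integrable[OF assms(1)]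
      square_integrable_integrable[OF assms(2)] norm_add_power2_le
    by (intro integral_mono) auto
  then show ?thesis
    using square_integrable_integrable[OF assms(1)] square_integrable_integrable[OF assms(2)]
    by (simp add: L2_norm_power2)
qed

locale galerkin = mesh \<T> + director e \<epsilon> dh
  for \<T> :: "(real ^ 'n::finite) set set" and e :: "'n \<Rightarrow> 3" and \<epsilon> :: real and dh :: "real ^ 'n \<Rightarrow> real ^ 3" +
  fixes f g u :: "real ^ 'n \<Rightarrow> real"
  assumes f: "square_integrable Omega f" and g: "sobolev g" and u: "u \<in> V \<T>"
    and weak: "\<And>v. v \<in> V \<T> \<Longrightarrow> form (grad u) (grad v) = (\<integral>x. f x * v x \<partial>\<mu>) - form (grad g) (grad v)"
begin

definition \<phi> where "\<phi> = (\<lambda>x. u x + g x)"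

lemma square_integrables:
  "square_integrable Omega (grad u)" "square_integrable Omega (grad g)" "square_integrable Omega (grad \<phi>)"
  "square_integrable Omega u"
  using sobolev_V[OF u] g sobolev_add[OF sobolev_V[OF u] g] by (auto simp: sobolev_def \<phi>_def)

lemma grad_\<phi>: "AE x in \<mu>. grad \<phi> x = grad u x + grad g x"
  unfolding \<phi>_def by (rule sobolev_grad_add[OF sobolev_V[OF u] g])

lemma form_\<phi>:
  assumes B: "square_integrable Omega B"
  shows "form (grad \<phi>) B = form (grad u) B + form (grad g) B"
proof -
  have "form (grad \<phi>) B = form (\<lambda>x. grad u x + grad g x) B"
    by (rule form_cong_AE[OF _ _ B grad_\<phi>]) (use square_integrables in \<open>auto intro: square_integrable_add\<close>)
  then show ?thesis using form_add[OF square_integrables(1,2) B] by simp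
qed

lemma galerkin_orthogonality:
  assumes "v \<in> V \<T>"
  shows "form (grad \<phi>) (grad v) = (\<integral>x. f x * v x \<partial>\<mu>)"
  using form_\<phi>[of "grad v"] weak[OF assms] sobolev_V[OF assms] by (simp add: sobolev_def)

lemma poincare_V: "sqnorm u \<le> 4 * sqnorm (grad u)"
proof -
  obtain L where "L-lipschitz_on UNIV u" using V_lipschitz[OF u] by blast
  then show ?thesis using V_outside[OF u] sobolev_V[OF u] by (rule poincare)
qed

lemma grad_u_le:
  "sqnorm (grad u)
    \<le> (elliptic_const \<epsilon> / 2 - 1) * (sqnorm f + sqnorm (grad g))"
proof -
  define X F H where "X = sqnorm (grad u)" and "F = sqnorm f"
    and "H = sqnorm (grad g)"
  define c c' where "c = min 1 (1 + \<epsilon>)" and "c' = 1 + \<bar>\<epsilon>\<bar>"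
  have c: "c > 0" "c' > 0" using eps by (auto simp: c_def c'_def)
  have nonneg: "0 \<le> X" "0 \<le> F" "0 \<le> H" by (auto simp: X_def F_def H_def)
  have "c * X \<le> (\<integral>x. f x * u x \<partial>\<mu>) - form (grad g) (grad u)"
    using form_coercive[OF square_integrables(1)] weak[OF u] by (simp add: X_def c_def)
  \<comment> \<open>The weights \<open>8 / c\<close> here and \<open>2 * c' / c\<close> below are
    chosen such that each of the two terms contributes half of \<open>c * X\<close>, against
    \<open>2 * (c * X)\<close> on the left.\<close>
  moreover have "2 * \<bar>\<integral>x. f x * u x \<partial>\<mu>\<bar> \<le> (8 / c) * F + 4 * X / (8 / c)"
  proof -
    have "2 * \<bar>\<integral>x. f x \<bullet> u x \<partial>\<mu>\<bar> \<le> (8 / c) * F + sqnorm u / (8 / c)"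
      using integral_young[OF f square_integrables(4), of "8 / c"] c by (simp add: F_def L2_norm_power2)
    also have "\<dots> \<le> (8 / c) * F + 4 * X / (8 / c)"
      using poincare_V c by (intro add_left_mono divide_right_mono) (auto simp: X_def)
    finally show ?thesis by simp
  qed
  moreover have "2 * \<bar>form (grad g) (grad u)\<bar> \<le> c' * ((2 * c' / c) * H + X / (2 * c' / c))"
    using form_bound[OF square_integrables(2,1), of "2 * c' / c"] c by (simp add: X_def H_def c'_def)
  ultimately have "2 * (c * X) \<le> (8 / c) * F + 4 * X / (8 / c) + c' * ((2 * c' / c) * H + X / (2 * c' / c))"
    by linarith
  also have "\<dots> = (8 / c) * F + c * X + (2 * c'\<^sup>2 / c) * H"
    using c by (simp add: field_simps power2_eq_square)
  finally have "c * X \<le> (8 / c) * F + (2 * c'\<^sup>2 / c) * H" by linarith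
  then have "X \<le> ((8 / c) * F + (2 * c'\<^sup>2 / c) * H) / c"
    using c by (simp add: pos_le_divide_eq mult.commute)
  also have "\<dots> = (8 / c\<^sup>2) * F + (2 * c'\<^sup>2 / c\<^sup>2) * H"
    by (simp add: add_divide_distrib power2_eq_square)
  also have "\<dots> \<le> ((8 + 2 * c'\<^sup>2) / c\<^sup>2) * F + ((8 + 2 * c'\<^sup>2) / c\<^sup>2) * H"
    using nonneg c by (intro add_mono mult_right_mono divide_right_mono) auto
  also have "\<dots> = (elliptic_const \<epsilon> / 2 - 1) * (F + H)"
  proof -
    have "(2 * R + 2) / 2 - 1 = R" for R :: real by (simp add: field_simps)
    then show ?thesis by (simp only: elliptic_const_def c_def c'_def distrib_left)
  qed
  finally show ?thesis by (simp add: X_def F_def H_def)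
qed

lemma elliptic_estimate:
  "sqnorm (grad u) \<le> elliptic_const \<epsilon> * (sqnorm f + sqnorm (grad g))"
  "sqnorm (grad \<phi>) \<le> elliptic_const \<epsilon> * (sqnorm f + sqnorm (grad g))"
proof -
  let ?Z = "sqnorm f + sqnorm (grad g)"
  have "(elliptic_const \<epsilon> / 2 - 1) * ?Z \<le> elliptic_const \<epsilon> * ?Z"
    using elliptic_const_ge[of \<epsilon>] by (intro mult_right_mono) auto
  then show "sqnorm (grad u) \<le> elliptic_const \<epsilon> * ?Z"
    using grad_u_le by linarith
  have "L2_norm Omega (grad \<phi>) = L2_norm Omega (\<lambda>x. grad u x + grad g x)"
    using grad_\<phi> square_integrables square_integrable_add[OF square_integrables(1,2)]
    by (intro L2_norm_cong_AE) (auto simp: square_integrable_def elim: eventually_mono)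
  then have "sqnorm (grad \<phi>) \<le> 2 * sqnorm (grad u) + 2 * sqnorm (grad g)"
    using L2_norm_power2_add_le[OF square_integrables(1,2)] by simp
  also have "\<dots> \<le> 2 * ((elliptic_const \<epsilon> / 2 - 1) * ?Z) + 2 * ?Z"
    using grad_u_le by (intro add_mono mult_left_mono) auto
  also have "\<dots> = elliptic_const \<epsilon> * ?Z" by (simp add: algebra_simps)
  finally show "sqnorm (grad \<phi>) \<le> elliptic_const \<epsilon> * ?Z" .
qed

definition Q where "Q = form (grad \<phi>) (grad \<phi>) - 2 * form (grad \<phi>) (grad g)"

text \<open>One argument \<open>\<phi>\<close> is split into \<open>u + g\<close>, and the equation
  is tested with \<open>u\<close>. In this form, linear in the data, the mixed terms of two time
  levels can be matched.\<close>

lemma Q_eq: "Q = (\<integral>x. f x * u x \<partial>\<mu>) - form (grad \<phi>) (grad g)"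
  using form_\<phi>[OF square_integrables(3)] galerkin_orthogonality[OF u]
    director_form_commute[of e \<epsilon> dh "grad u" "grad \<phi>"] director_form_commute[of e \<epsilon> dh "grad g" "grad \<phi>"]
  by (simp add: Q_def)

lemma Q_bound:
  "\<bar>Q\<bar> \<le> 3 * (1 + \<bar>\<epsilon>\<bar>) * elliptic_const \<epsilon> * (sqnorm f + sqnorm (grad g))"
proof -
  define Z P H where "Z = sqnorm f + sqnorm (grad g)"
    and "P = sqnorm (grad \<phi>)" and "H = sqnorm (grad g)"
  have "\<bar>Q\<bar> \<le> \<bar>form (grad \<phi>) (grad \<phi>)\<bar> + 2 * \<bar>form (grad \<phi>) (grad g)\<bar>"
    by (simp add: Q_def)
  also have "\<dots> \<le> (1 + \<bar>\<epsilon>\<bar>) * (2 * P + H)"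
    using form_bound[OF square_integrables(3,3), of 1] form_bound[OF square_integrables(3,2), of 1]
    by (simp add: P_def H_def algebra_simps)
  also have "\<dots> \<le> (1 + \<bar>\<epsilon>\<bar>) * (2 * (elliptic_const \<epsilon> * Z) + elliptic_const \<epsilon> * Z)"
  proof -
    have "H \<le> Z" by (simp add: H_def Z_def)
    also have "\<dots> \<le> elliptic_const \<epsilon> * Z"
      using elliptic_const_ge[of \<epsilon>] mult_right_mono[of 1 "elliptic_const \<epsilon>" Z] by (simp add: Z_def)
    finally show ?thesis using elliptic_estimate(2) by (intro mult_left_mono add_mono) (auto simp: P_def Z_def)
  qed
  finally show ?thesis by (simp add: Z_def algebra_simps)
qed

end

subsection \<open>Increments of the director form\<close>

lemma sum_of_increments:
  fixes x :: "nat \<Rightarrow> real"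
  assumes "\<And>m. m < M \<Longrightarrow> x (Suc m) = x m + y m"
  shows "x M = x 0 + (\<Sum>m<M. y m)"
  using assms by (induction M) auto

text \<open>The product of the gradients does not see the director and cancels. What remains is the
  quantity whose increment the electric term of the scheme represents.\<close>

lemma form_difference:
  assumes D0: "director e \<epsilon> dh" and D1: "director e \<epsilon> dh'"
    and A: "square_integrable Omega A" and B: "square_integrable Omega B"
  shows "director_form e \<epsilon> dh' A B - director_form e \<epsilon> dh A B
    = \<epsilon> * ((\<integral>x. (dh' x \<bullet> embed e (A x)) * (dh' x \<bullet> embed e (B x)) \<partial>\<mu>)
      - (\<integral>x. (dh x \<bullet> embed e (A x)) * (dh x \<bullet> embed e (B x)) \<partial>\<mu>))"
  unfolding director.form_eq[OF D0 A B] director.form_eq[OF D1 A B] by (simp add: algebra_simps)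

text \<open>After crosswise testing, the left-hand side pairs data of one level with the solution of
  the other. Adding and subtracting the pairs at equal level, which make up \<open>Q\<close> by
  \<open>Q_eq\<close>, leaves differences of the data only.\<close>

lemma form_increment:
  fixes e :: "'n::finite \<Rightarrow> 3"
  assumes G0: "galerkin \<T> e \<epsilon> dh f g u" and G1: "galerkin \<T> e \<epsilon> dh' f' g' u'"
  defines "\<phi> \<equiv> galerkin.\<phi> g u" and "\<phi>' \<equiv> galerkin.\<phi> g' u'"
  shows "director_form e \<epsilon> dh' (grad \<phi>) (grad \<phi>') - director_form e \<epsilon> dh (grad \<phi>) (grad \<phi>')
    = galerkin.Q e \<epsilon> dh g u - galerkin.Q e \<epsilon> dh' g' u'
      + (\<integral>x. (f' x - f x) * (u x + u' x) \<partial>\<mu>)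
      - director_form e \<epsilon> dh' (grad \<phi>') (\<lambda>x. grad g' x - grad g x)
      - director_form e \<epsilon> dh (grad \<phi>) (\<lambda>x. grad g' x - grad g x)"
proof -
  interpret G0: galerkin \<T> e \<epsilon> dh f g u by (rule G0)
  interpret G1: galerkin \<T> e \<epsilon> dh' f' g' u' by (rule G1)
  have \<phi>: "\<phi> = G0.\<phi>" "\<phi>' = G1.\<phi>" by (simp_all add: \<phi>_def \<phi>'_def)
  note com = director_form_commute[of e \<epsilon>]
  note si = G0.square_integrables G1.square_integrables
  let ?F = "\<lambda>f u. \<integral>x. f x * u x \<partial>\<mu>"
  have "G1.form (grad \<phi>) (grad \<phi>') = ?F f' u + G1.form (grad \<phi>') (grad g)"
  proof -
    have "G1.form (grad \<phi>) (grad \<phi>') = G1.form (\<lambda>x. grad u x + grad g x) (grad \<phi>')"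
      unfolding \<phi> by (rule G1.form_cong_AE[OF _ _ _ G0.grad_\<phi>]) (use si in \<open>auto intro: square_integrable_add\<close>)
    also have "\<dots> = G1.form (grad u) (grad \<phi>') + G1.form (grad g) (grad \<phi>')"
      unfolding \<phi> by (rule G1.form_add) (use si in auto)
    finally show ?thesis
      using G1.galerkin_orthogonality[OF G0.u] com[of dh' "grad u"] com[of dh' "grad g"] by (simp add: \<phi>)
  qed
  moreover have "G0.form (grad \<phi>) (grad \<phi>') = ?F f u' + G0.form (grad \<phi>) (grad g')"
  proof -
    have "G0.form (grad \<phi>') (grad \<phi>) = G0.form (\<lambda>x. grad u' x + grad g' x) (grad \<phi>)"
      unfolding \<phi> by (rule G0.form_cong_AE[OF _ _ _ G1.grad_\<phi>]) (use si in \<open>auto intro: square_integrable_add\<close>)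
    also have "\<dots> = G0.form (grad u') (grad \<phi>) + G0.form (grad g') (grad \<phi>)"
      unfolding \<phi> by (rule G0.form_add) (use si in auto)
    finally show ?thesis
      using G0.galerkin_orthogonality[OF G1.u] com[of dh "grad u'"] com[of dh "grad g'"] com[of dh "grad \<phi>'"]
      by (simp add: \<phi>)
  qed
  moreover have "G1.form (grad \<phi>') (\<lambda>x. grad g' x - grad g x) = G1.form (grad \<phi>') (grad g') - G1.form (grad \<phi>') (grad g)"
    using G1.form_diff[of "grad g'" "grad g" "grad \<phi>'"] si com[of dh' "grad \<phi>'"] by (simp add: \<phi>)
  moreover have "G0.form (grad \<phi>) (\<lambda>x. grad g' x - grad g x) = G0.form (grad \<phi>) (grad g') - G0.form (grad \<phi>) (grad g)"
    using G0.form_diff[of "grad g'" "grad g" "grad \<phi>"] si com[of dh "grad \<phi>"] by (simp add: \<phi>)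
  moreover have "(\<integral>x. (f' x - f x) * (u x + u' x) \<partial>\<mu>) = ?F f' u + ?F f' u' - ?F f u - ?F f u'"
  proof -
    have "integrable \<mu> (\<lambda>x. f' x * u x)" "integrable \<mu> (\<lambda>x. f' x * u' x)"
      "integrable \<mu> (\<lambda>x. f x * u x)" "integrable \<mu> (\<lambda>x. f x * u' x)"
      using si G0.f G1.f by (auto intro: square_integrable_mult)
    then show ?thesis by (simp add: algebra_simps)
  qed
  ultimately show ?thesis
    using G0.Q_eq G1.Q_eq by (simp add: \<phi>)
qed

text \<open>Each data difference is \<open>dt\<close> times a difference quotient, so Young's
  inequality produces squared quotients while the factor \<open>dt\<close> stays outside and makes
  the later sum a time integral. The solutions are estimated by the data through the elliptic
  estimate and not by the energy.\<close>

lemma form_increment_bound: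
  fixes e :: "'n::finite \<Rightarrow> 3"
  assumes G0: "galerkin \<T> e \<epsilon> dh f g u" and G1: "galerkin \<T> e \<epsilon> dh' f' g' u'" and dt: "dt > 0"
  defines "\<phi> \<equiv> galerkin.\<phi> g u" and "\<phi>' \<equiv> galerkin.\<phi> g' u'"
  defines "Z \<equiv> sqnorm f + sqnorm (grad g)"
    and "Z' \<equiv> sqnorm f' + sqnorm (grad g')"
    and "Df \<equiv> sqnorm (\<lambda>x. (1 / dt) *\<^sub>R (f' x - f x))"
    and "Dg \<equiv> sqnorm (\<lambda>x. (1 / dt) *\<^sub>R (grad g' x - grad g x))"
  shows "\<bar>(\<integral>x. (f' x - f x) * (u x + u' x) \<partial>\<mu>)
      - director_form e \<epsilon> dh' (grad \<phi>') (\<lambda>x. grad g' x - grad g x)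
      - director_form e \<epsilon> dh (grad \<phi>) (\<lambda>x. grad g' x - grad g x)\<bar>
    \<le> dt * (4 * (1 + \<bar>\<epsilon>\<bar>) * elliptic_const \<epsilon> * (Df + Dg + Z + Z'))"
proof -
  interpret G0: galerkin \<T> e \<epsilon> dh f g u by (rule G0)
  interpret G1: galerkin \<T> e \<epsilon> dh' f' g' u' by (rule G1)
  have \<phi>: "\<phi> = G0.\<phi>" "\<phi>' = G1.\<phi>" by (simp_all add: \<phi>_def \<phi>'_def)
  note si = G0.square_integrables G1.square_integrables
  define K c where "K = elliptic_const \<epsilon>" and "c = 1 + \<bar>\<epsilon>\<bar>"
  have K: "K \<ge> 2" and c: "c \<ge> 1" using elliptic_const_ge by (auto simp: K_def c_def)
  define df where "df = (\<lambda>x. (1 / dt) *\<^sub>R (f' x - f x))"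
  define dg where "dg = (\<lambda>x. (1 / dt) *\<^sub>R (grad g' x - grad g x))"
  have sdf: "square_integrable Omega df"
    unfolding df_def by (intro square_integrable_scaleR square_integrable_diff G0.f G1.f)
  have sdg: "square_integrable Omega dg"
    unfolding dg_def by (intro square_integrable_scaleR square_integrable_diff si)
  have nn: "0 \<le> Df" "0 \<le> Dg" "0 \<le> Z" "0 \<le> Z'"
    by (auto simp: Df_def Dg_def Z_def Z'_def)
  have Df: "Df = sqnorm df" and Dg: "Dg = sqnorm dg"
    by (simp_all add: Df_def Dg_def df_def dg_def)
  have f_eq: "(\<integral>x. (f' x - f x) * (u x + u' x) \<partial>\<mu>)
      = dt * ((\<integral>x. df x * u x \<partial>\<mu>) + (\<integral>x. df x * u' x \<partial>\<mu>))"
  proof -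
    have "(\<integral>x. (f' x - f x) * (u x + u' x) \<partial>\<mu>)
        = (\<integral>x. dt * (df x * u x + df x * u' x) \<partial>\<mu>)"
      using dt by (intro Bochner_Integration.integral_cong) (auto simp: df_def field_simps)
    also have "\<dots> = dt * ((\<integral>x. df x * u x \<partial>\<mu>) + (\<integral>x. df x * u' x \<partial>\<mu>))"
      using square_integrable_mult[OF sdf si(4)] square_integrable_mult[OF sdf si(8)] by simp
    finally show ?thesis .
  qed
  have gdt: "(\<lambda>x. grad g' x - grad g x) = (\<lambda>x. dt *\<^sub>R dg x)"
    using dt by (simp add: dg_def)
  have g1: "G1.form (grad \<phi>') (\<lambda>x. grad g' x - grad g x) = dt * G1.form dg (grad \<phi>')"
    unfolding gdt \<phi> director_form_commute[of e \<epsilon> dh' "grad G1.\<phi>" "\<lambda>x. dt *\<^sub>R dg x"]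
    by (rule G1.form_scale[OF sdg si(7)])
  have g0: "G0.form (grad \<phi>) (\<lambda>x. grad g' x - grad g x) = dt * G0.form dg (grad \<phi>)"
    unfolding gdt \<phi> director_form_commute[of e \<epsilon> dh "grad G0.\<phi>" "\<lambda>x. dt *\<^sub>R dg x"]
    by (rule G0.form_scale[OF sdg si(3)])
  have 1: "2 * \<bar>\<integral>x. df x * u x \<partial>\<mu>\<bar> \<le> Df + 4 * (K * Z)"
    using integral_young[OF sdf si(4), of 1] G0.poincare_V G0.elliptic_estimate(1)
    by (simp add: Df K_def Z_def L2_norm_power2)
  have 2: "2 * \<bar>\<integral>x. df x * u' x \<partial>\<mu>\<bar> \<le> Df + 4 * (K * Z')"
    using integral_young[OF sdf si(8), of 1] G1.poincare_V G1.elliptic_estimate(1)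
    by (simp add: Df K_def Z'_def L2_norm_power2)
  have 3: "2 * \<bar>G1.form dg (grad \<phi>')\<bar> \<le> c * (Dg + K * Z')"
  proof -
    have "2 * \<bar>G1.form dg (grad \<phi>')\<bar> \<le> c * (Dg + sqnorm (grad \<phi>'))"
      using G1.form_bound[OF sdg si(7), of 1] by (simp add: Dg c_def \<phi>)
    also have "\<dots> \<le> c * (Dg + K * Z')"
      using G1.elliptic_estimate(2) c by (intro mult_left_mono add_left_mono) (auto simp: \<phi> K_def Z'_def)
    finally show ?thesis .
  qed
  have 4: "2 * \<bar>G0.form dg (grad \<phi>)\<bar> \<le> c * (Dg + K * Z)"
  proof -
    have "2 * \<bar>G0.form dg (grad \<phi>)\<bar> \<le> c * (Dg + sqnorm (grad \<phi>))"
      using G0.form_bound[OF sdg si(3), of 1] by (simp add: Dg c_def \<phi>)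
    also have "\<dots> \<le> c * (Dg + K * Z)"
      using G0.elliptic_estimate(2) c by (intro mult_left_mono add_left_mono) (auto simp: \<phi> K_def Z_def)
    finally show ?thesis .
  qed
  let ?S = "(\<integral>x. df x * u x \<partial>\<mu>) + (\<integral>x. df x * u' x \<partial>\<mu>)
    - G1.form dg (grad \<phi>') - G0.form dg (grad \<phi>)"
  have "2 * \<bar>a + b - a' - b'\<bar> \<le> 2 * \<bar>a\<bar> + 2 * \<bar>b\<bar> + 2 * \<bar>a'\<bar> + 2 * \<bar>b'\<bar>" for a b a' b' :: real
    using abs_triangle_ineq4[of "a + b - a'" b'] abs_triangle_ineq4[of "a + b" a'] abs_triangle_ineq[of a b]
    by linarith
  then have "2 * \<bar>?S\<bar> \<le> (Df + 4 * (K * Z)) + (Df + 4 * (K * Z')) + c * (Dg + K * Z') + c * (Dg + K * Z)"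
    using 1 2 3 4 by (rule order_trans[OF _ add_mono[OF add_mono[OF add_mono]]])
  also have "\<dots> = 2 * Df + 4 * (K * (Z + Z')) + c * (2 * Dg + K * (Z + Z'))"
    by (simp add: algebra_simps)
  \<comment> \<open>As \<open>c \<ge> 1\<close> and \<open>K \<ge> 2\<close>, the product
    \<open>c * K\<close> dominates 1, \<open>c\<close> and \<open>K\<close>. The largest multiple of
    it that occurs is then 5, within the 8 on the right.\<close>
  also have "\<dots> \<le> 2 * (4 * c * K * (Df + Dg + Z + Z'))"
  proof -
    have cK: "1 \<le> c * K" "K \<le> c * K" "c \<le> c * K"
      using K c mult_mono[of 1 c 1 K] mult_right_mono[of 1 c K] mult_left_mono[of 1 K c] by auto
    have "Df \<le> c * K * Df" "K * (Z + Z') \<le> c * K * (Z + Z')" "c * Dg \<le> c * K * Dg"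
      using mult_right_mono[OF cK(1) nn(1)] mult_right_mono[OF cK(2), of "Z + Z'"]
        mult_right_mono[OF cK(3) nn(2)] nn by auto
    moreover have "0 \<le> c * K * Df" "0 \<le> c * K * Dg" "0 \<le> c * K * (Z + Z')"
      using nn K c by auto
    ultimately show ?thesis by (simp add: algebra_simps)
  qed
  finally have S: "\<bar>?S\<bar> \<le> 4 * c * K * (Df + Dg + Z + Z')"
    by (simp only: mult_le_cancel_left_pos zero_less_numeral)
  have "(\<integral>x. (f' x - f x) * (u x + u' x) \<partial>\<mu>)
      - G1.form (grad \<phi>') (\<lambda>x. grad g' x - grad g x) - G0.form (grad \<phi>) (\<lambda>x. grad g' x - grad g x) = dt * ?S"
    unfolding f_eq g0 g1 by (simp add: algebra_simps)
  then show ?thesis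
    using S dt by (simp add: abs_mult K_def c_def)
qed

text \<open>Polarisation: the midpoint combination that couples the director equation to the electric
  field is the increment of the form \<open>(d \<bullet> A) * (d \<bullet> B)\<close>.\<close>

lemma midpoint_polarisation:
  fixes a b A B :: "'a::real_inner"
  shows "((B \<bullet> mid a b) *\<^sub>R A + (A \<bullet> mid a b) *\<^sub>R B) \<bullet> (b - a)
    = (b \<bullet> A) * (b \<bullet> B) - (a \<bullet> A) * (a \<bullet> B)"
proof -
  have "((B \<bullet> mid a b) *\<^sub>R A + (A \<bullet> mid a b) *\<^sub>R B) \<bullet> (b - a)
      = ((a \<bullet> B + b \<bullet> B) / 2) * (b \<bullet> A - a \<bullet> A) + ((a \<bullet> A + b \<bullet> A) / 2) * (b \<bullet> B - a \<bullet> B)"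
    by (simp add: inner_add_left inner_add_right inner_diff_right inner_commute)
  then show ?thesis by (simp add: field_simps)
qed

text \<open>The directors are constant on each cell, so the increment moves under the integral and
  \<open>midpoint_polarisation\<close> applies pointwise with \<open>d i\<close> and
  \<open>d1 i\<close>.\<close>

lemma sum_cell_coupling:
  fixes A B :: "real ^ 'n \<Rightarrow> real ^ 3"
  assumes N: "N \<ge> 1" and A: "square_integrable Omega A" and B: "square_integrable Omega B"
  shows "(\<Sum>i\<in>interior_indices N.
      (\<integral>x. (B x \<bullet> mid (d i) (d1 i)) *\<^sub>R A x + (A x \<bullet> mid (d i) (d1 i)) *\<^sub>R B x
        \<partial>lebesgue_on (cell N i)) \<bullet> (d1 i - d i))
    = (\<integral>x. (piecewise_const N d1 x \<bullet> A x) * (piecewise_const N d1 x \<bullet> B x) \<partial>\<mu>)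
      - (\<integral>x. (piecewise_const N d x \<bullet> A x) * (piecewise_const N d x \<bullet> B x) \<partial>\<mu>)"
proof -
  have sqi: "square_integrable S (\<lambda>x. v \<bullet> U x)" if "square_integrable S U"
    for S :: "(real^'n) set" and U and v :: "real^3"
  proof -
    have "\<bar>v \<bullet> y\<bar> \<le> norm (norm v *\<^sub>R y)" for y
      using Cauchy_Schwarz_ineq2[of v y] by simp
    then show ?thesis
      by (intro square_integrable_bound[OF square_integrable_scaleR[OF that, of "norm v"]])
        (use square_integrable_measurable[OF that] in auto)
  qed
  have pci: "integrable \<mu> (\<lambda>x. (piecewise_const N a x \<bullet> A x) * (piecewise_const N a x \<bullet> B x))" for a
  proof -
    obtain R where R: "\<And>x. norm (piecewise_const N a x) \<le> R" "0 \<le> R"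
    proof
      show "norm (piecewise_const N a x) \<le> (\<Sum>i\<in>interior_indices N. norm (a i))" for x
        by (rule piecewise_const_norm_le[OF N])
          (auto intro: member_le_sum[where f="\<lambda>i. norm (a i)"] sum_nonneg)
    qed (simp add: sum_nonneg)
    have "square_integrable Omega (\<lambda>x. piecewise_const N a x \<bullet> U x)" if U: "square_integrable Omega U" for U :: "real ^ 'n \<Rightarrow> real ^ 3"
    proof (rule square_integrable_bound[OF square_integrable_scaleR[OF U, of R]])
      show "(\<lambda>x. piecewise_const N a x \<bullet> U x) \<in> borel_measurable \<mu>"
        using square_integrable_measurable[OF U] by simp
      have "\<bar>piecewise_const N a x \<bullet> y\<bar> \<le> R * norm y" for x y
        using Cauchy_Schwarz_ineq2[of "piecewise_const N a x" y] mult_right_mono[OF R(1)[of x] norm_ge_zero[of y]] by linarith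
      then show "AE x in \<mu>. norm (piecewise_const N a x \<bullet> U x) \<le> norm (R *\<^sub>R U x)"
        using R(2) by simp
    qed
    then show ?thesis using A B by (intro square_integrable_mult)
  qed
  have pc: "(\<integral>x. (piecewise_const N a x \<bullet> A x) * (piecewise_const N a x \<bullet> B x) \<partial>\<mu>)
      = (\<Sum>i\<in>interior_indices N. \<integral>x. (a i \<bullet> A x) * (a i \<bullet> B x) \<partial>lebesgue_on (cell N i))" for a
    unfolding integral_cells[OF N pci]
    by (intro sum.cong refl Bochner_Integration.integral_cong) (auto simp: piecewise_const_cell[OF N])
  have cell: "(\<integral>x. (B x \<bullet> mid (d i) (d1 i)) *\<^sub>R A x + (A x \<bullet> mid (d i) (d1 i)) *\<^sub>R B x
        \<partial>lebesgue_on (cell N i)) \<bullet> (d1 i - d i)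
      = (\<integral>x. (d1 i \<bullet> A x) * (d1 i \<bullet> B x) \<partial>lebesgue_on (cell N i))
        - (\<integral>x. (d i \<bullet> A x) * (d i \<bullet> B x) \<partial>lebesgue_on (cell N i))" if i: "i \<in> interior_indices N" for i
  proof -
    let ?M = "lebesgue_on (cell N i)"
    let ?v = "mid (d i) (d1 i)"
    have sA: "square_integrable (cell N i) A" and sB: "square_integrable (cell N i) B"
      using A B i by (auto intro: square_integrable_cell)
    have int: "integrable ?M (\<lambda>x. (W x \<bullet> v) *\<^sub>R U x)"
      if U: "square_integrable (cell N i) U" and W: "square_integrable (cell N i) W" for U W :: "real^'n \<Rightarrow> real^3" and v
    proof -
      have "integrable ?M (\<lambda>x. norm (v \<bullet> W x) * norm (U x))"
        by (intro square_integrable_mult square_integrable_norm sqi U W)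
      then show ?thesis
        by (rule Bochner_Integration.integrable_bound)
          (use square_integrable_measurable[OF U] square_integrable_measurable[OF W] in \<open>auto simp: inner_commute\<close>)
    qed
    have "(\<integral>x. (B x \<bullet> ?v) *\<^sub>R A x + (A x \<bullet> ?v) *\<^sub>R B x \<partial>?M) \<bullet> (d1 i - d i)
        = (\<integral>x. ((B x \<bullet> ?v) *\<^sub>R A x + (A x \<bullet> ?v) *\<^sub>R B x) \<bullet> (d1 i - d i) \<partial>?M)"
      by (intro integral_inner_left[symmetric] Bochner_Integration.integrable_add int sA sB)
    also have "\<dots> = (\<integral>x. (d1 i \<bullet> A x) * (d1 i \<bullet> B x) - (d i \<bullet> A x) * (d i \<bullet> B x) \<partial>?M)"
      unfolding midpoint_polarisation ..
    also have "\<dots> = (\<integral>x. (d1 i \<bullet> A x) * (d1 i \<bullet> B x) \<partial>?M) - (\<integral>x. (d i \<bullet> A x) * (d i \<bullet> B x) \<partial>?M)"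
      by (intro Bochner_Integration.integral_diff square_integrable_mult sqi sA sB)
    finally show ?thesis .
  qed
  show ?thesis
    unfolding pc sum_subtractf[symmetric] by (intro sum.cong refl cell)
qed

subsection \<open>The energy estimate\<close>

text \<open>\<open>\<gamma>\<close> converts the electric coefficient of the balance into the
  coefficient of the form. Relating it to the parameters by a product instead of a quotient also
  covers \<open>\<epsilon>\<^sub>2 = 0\<close>.\<close>

locale scheme = mesh \<T>
  for \<T> :: "(real ^ 'n::finite) set set" +
  fixes e :: "'n \<Rightarrow> 3" and k \<sigma> \<alpha> \<epsilon>\<^sub>1 \<epsilon>\<^sub>2 \<gamma> dt :: real and N\<^sub>T N :: nat
    and f g :: "real \<Rightarrow> real ^ 'n \<Rightarrow> real"
    and d\<^sub>0 w\<^sub>0 :: "real ^ 'n \<Rightarrow> real ^ 3" and Gd\<^sub>0 :: "real ^ 'n \<Rightarrow> (real ^ 3) ^ 'n"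
    and d w :: "nat \<Rightarrow> ('n \<Rightarrow> nat) \<Rightarrow> real ^ 3" and \<phi> :: "nat \<Rightarrow> real ^ 'n \<Rightarrow> real"
  assumes inj: "inj e" and k: "k \<ge> 0" and \<sigma>: "\<sigma> \<ge> 0" and \<alpha>: "\<alpha> \<ge> 0"
    and eps: "\<epsilon>\<^sub>2 > -1" and \<gamma>: "\<epsilon>\<^sub>1 / 2 = \<gamma> * \<epsilon>\<^sub>2"
    and dt: "dt > 0" and N: "N \<ge> 1"
    and f: "\<And>m. m \<le> N\<^sub>T \<Longrightarrow> square_integrable Omega (f (real m * dt))"
    and d\<^sub>0: "H1_with_gradient d\<^sub>0 Gd\<^sub>0" "AE x in \<mu>. norm (d\<^sub>0 x) = 1"
    and w\<^sub>0: "square_integrable Omega w\<^sub>0"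
    and solution: "scheme_solution e k \<sigma> \<alpha> \<epsilon>\<^sub>1 \<epsilon>\<^sub>2 dt N\<^sub>T N \<T> f g d\<^sub>0 w\<^sub>0 d w \<phi>"
begin

abbreviation (input) F where "F m \<equiv> f (real m * dt)"
abbreviation (input) G where "G m \<equiv> interpolant \<T> (g (real m * dt))"
abbreviation (input) dh where "dh m \<equiv> piecewise_const N (d m)"
abbreviation (input) E where "E m x \<equiv> embed e (grad (\<phi> m) x)"

definition energy where "energy m = (\<sigma> / 2) * (step N ^ CARD('n) * (\<Sum>i\<in>interior_indices N. (norm (w m i))\<^sup>2))
  + (k / 2) * (step N ^ CARD('n) * (\<Sum>i\<in>interior_indices N. \<Sum>j\<in>UNIV. (norm (forward_diff N j (d m) i))\<^sup>2))"

definition dissipation where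
  "dissipation m = step N ^ CARD('n) * (\<Sum>i\<in>interior_indices N. (norm (mid (w m i) (w (m + 1) i)))\<^sup>2)"

definition coupling where
  "coupling m i = (\<integral>x. (E (m + 1) x \<bullet> mid (d m i) (d (m + 1) i)) *\<^sub>R E m x
    + (E m x \<bullet> mid (d m i) (d (m + 1) i)) *\<^sub>R E (m + 1) x \<partial>lebesgue_on (cell N i))"

lemma d_step:
  assumes "m < N\<^sub>T" "i \<in> interior_indices N"
  shows "(1 / dt) *\<^sub>R (d (m + 1) i - d m i)
    = cross3 (mid (d m i) (d (m + 1) i)) (mid (w m i) (w (m + 1) i))"
  using solution assms by (auto simp: scheme_solution_def Let_def time_diff_def midpoint_avg_def)

lemma w_step:
  assumes "m < N\<^sub>T" "i \<in> interior_indices N"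
  shows "\<sigma> *\<^sub>R ((1 / dt) *\<^sub>R (w (m + 1) i - w m i)) =
    k *\<^sub>R cross3 (discrete_laplacian N (\<lambda>i. mid (d m i) (d (m + 1) i)) i) (mid (d m i) (d (m + 1) i))
    - \<alpha> *\<^sub>R mid (w m i) (w (m + 1) i)
    + (\<epsilon>\<^sub>1 / (2 * step N ^ CARD('n))) *\<^sub>R cross3 (coupling m i) (mid (d m i) (d (m + 1) i))"
  using solution assms unfolding scheme_solution_def Let_def time_diff_def midpoint_avg_def
    measure_cell[OF N] coupling_def by blast

lemma neumann_d:
  assumes m: "m \<le> N\<^sub>T" shows "neumann N (d m)"
proof -
  have bc: "(i j = 0 \<longrightarrow> d m i = d m (i(j := i j + 1))) \<and> (i j = N \<longrightarrow> d m (i(j := i j + 1)) = d m i)"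
    if "i \<in> all_indices N" for i j
    using solution m that unfolding scheme_solution_def by blast
  show ?thesis
    unfolding neumann_def
  proof (intro ballI allI conjI impI)
    fix i :: "'n \<Rightarrow> nat" and j assume i: "i \<in> interior_indices N"
    \<comment> \<open>At the lower end the condition of the scheme is read at the ghost index, at
      the upper end at the last interior index.\<close>
    { assume ij: "i j = 1"
      have "i(j := 0) \<in> all_indices N" using interior_indicesD[OF i] by (auto simp: all_indices_def le_SucI)
      from bc[OF this, of j] have "d m (i(j := 0)) = d m (i(j := 1))" by simp
      also have "i(j := 1) = i" using ij by (simp add: fun_upd_idem)
      finally show "d m (i(j := 0)) = d m i" . }
    { assume ij: "i j = N"
      have "i \<in> all_indices N" using interior_indicesD[OF i] by (auto simp: all_indices_def le_SucI)
      from bc[OF this, of j] show "d m (i(j := N + 1)) = d m i" using ij by simp }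
  qed
qed

lemma norm_d_le_1:
  assumes "m \<le> N\<^sub>T" "i \<in> interior_indices N" shows "norm (d m i) \<le> 1"
  using assms
proof (induction m)
  case 0
  then have "d 0 i = cell_average N d\<^sub>0 i" using solution by (simp add: scheme_solution_def)
  then show ?case
    using norm_cell_average_le_1[OF N _ 0(2) d\<^sub>0(2)] d\<^sub>0(1) by (simp add: H1_with_gradient_def)
next
  case (Suc m)
  then have "norm (d (m + 1) i) = norm (d m i)"
    by (intro midpoint_cross_norm[OF dt d_step]) auto
  then show ?case using Suc by simp
qed

text \<open>The scheme asserts the homogeneous part separately for each level; a fixed choice makes
  it available as a test function at the neighbouring level.\<close>

definition u where "u m = (SOME u. u \<in> V \<T> \<and>
  (\<forall>v\<in>V \<T>. a_form e \<epsilon>\<^sub>2 (dh m) u v = (\<integral>x. F m x * v x \<partial>\<mu>) - a_form e \<epsilon>\<^sub>2 (dh m) (G m) v) \<and>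
  \<phi> m = (\<lambda>x. u x + G m x))"

lemma u:
  assumes "m \<le> N\<^sub>T"
  shows "u m \<in> V \<T>"
    "\<And>v. v \<in> V \<T> \<Longrightarrow> a_form e \<epsilon>\<^sub>2 (dh m) (u m) v = (\<integral>x. F m x * v x \<partial>\<mu>) - a_form e \<epsilon>\<^sub>2 (dh m) (G m) v"
    "\<phi> m = (\<lambda>x. u m x + G m x)"
proof -
  have "\<exists>u. u \<in> V \<T> \<and>
    (\<forall>v\<in>V \<T>. a_form e \<epsilon>\<^sub>2 (dh m) u v = (\<integral>x. F m x * v x \<partial>\<mu>) - a_form e \<epsilon>\<^sub>2 (dh m) (G m) v) \<and>
    \<phi> m = (\<lambda>x. u x + G m x)"
    using solution assms unfolding scheme_solution_def Let_def by blast
  from someI_ex[OF this, folded u_def] show "u m \<in> V \<T>"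
    "\<And>v. v \<in> V \<T> \<Longrightarrow> a_form e \<epsilon>\<^sub>2 (dh m) (u m) v = (\<integral>x. F m x * v x \<partial>\<mu>) - a_form e \<epsilon>\<^sub>2 (dh m) (G m) v"
    "\<phi> m = (\<lambda>x. u m x + G m x)"
    by blast+
qed

lemma galerkin:
  assumes m: "m \<le> N\<^sub>T"
  shows "galerkin \<T> e \<epsilon>\<^sub>2 (dh m) (F m) (G m) (u m)"
proof
  show "norm (dh m x) \<le> 1" for x
    by (rule piecewise_const_norm_le[OF N]) (use norm_d_le_1[OF m] in auto)
qed (use inj eps f[OF m] u[OF m] sobolev_interpolant in \<open>auto simp: a_form_eq\<close>)

lemma galerkin_\<phi>: "m \<le> N\<^sub>T \<Longrightarrow> galerkin.\<phi> (G m) (u m) = \<phi> m"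
  using galerkin.\<phi>_def[OF galerkin] u(3) by simp

definition Z where "Z m = sqnorm (F m) + sqnorm (grad (G m))"

definition D where "D m = sqnorm (\<lambda>x. (1 / dt) *\<^sub>R (F (m + 1) x - F m x))
  + sqnorm (\<lambda>x. (1 / dt) *\<^sub>R (grad (G (m + 1)) x - grad (G m) x))"

text \<open>One constant for the elliptic estimate, the bound on \<open>Q\<close> with its factor 3,
  and the bound on the increments with its factor 4.\<close>

definition K where "K = 4 * (1 + \<bar>\<epsilon>\<^sub>2\<bar>) * elliptic_const \<epsilon>\<^sub>2"

lemma K_ge: "elliptic_const \<epsilon>\<^sub>2 \<le> K" "0 \<le> K"
proof -
  have "1 * elliptic_const \<epsilon>\<^sub>2 \<le> (4 * (1 + \<bar>\<epsilon>\<^sub>2\<bar>)) * elliptic_const \<epsilon>\<^sub>2"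
    using elliptic_const_ge[of \<epsilon>\<^sub>2] by (intro mult_right_mono) auto
  then show "elliptic_const \<epsilon>\<^sub>2 \<le> K" by (simp add: K_def)
  then show "0 \<le> K" using elliptic_const_ge[of \<epsilon>\<^sub>2] by linarith
qed

lemma Z_nonneg: "0 \<le> Z m"
  by (simp add: Z_def)

lemma grad_\<phi>_le: "m \<le> N\<^sub>T \<Longrightarrow> sqnorm (grad (\<phi> m)) \<le> K * Z m"
  using galerkin.elliptic_estimate(2)[OF galerkin, of m] galerkin_\<phi>[of m]
    mult_right_mono[OF K_ge(1) Z_nonneg[of m]] by (simp add: Z_def)

definition Q where "Q m = galerkin.Q e \<epsilon>\<^sub>2 (dh m) (G m) (u m)"

lemma Q_bound: "m \<le> N\<^sub>T \<Longrightarrow> \<bar>Q m\<bar> \<le> K * Z m"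
proof -
  assume m: "m \<le> N\<^sub>T"
  have "\<bar>Q m\<bar> \<le> 3 * (1 + \<bar>\<epsilon>\<^sub>2\<bar>) * elliptic_const \<epsilon>\<^sub>2 * Z m"
    unfolding Q_def Z_def by (rule galerkin.Q_bound[OF galerkin[OF m]])
  also have "\<dots> \<le> K * Z m"
    unfolding K_def using elliptic_const_ge[of \<epsilon>\<^sub>2] Z_nonneg[of m] by (intro mult_right_mono) auto
  finally show ?thesis .
qed

text \<open>\<open>S\<close> collects the terms with data differences. Only its absolute bound is
  passed on, as neither \<open>S\<close> nor \<open>\<gamma>\<close> has a definite sign.\<close>

lemma energy_step:
  assumes m: "m < N\<^sub>T"
  shows "\<exists>S. energy (Suc m) = energy m + (- \<alpha> * dt * dissipation m + \<gamma> * (Q m - Q (Suc m) + S))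
    \<and> \<bar>S\<bar> \<le> dt * (K * (D m + Z m + Z (m + 1)))"
proof -
  have m': "m \<le> N\<^sub>T" "m + 1 \<le> N\<^sub>T" using m by auto
  note G0 = galerkin[OF m'(1)] and G1 = galerkin[OF m'(2)]
  have d0: "director e \<epsilon>\<^sub>2 (dh m)" and d1: "director e \<epsilon>\<^sub>2 (dh (m + 1))"
    using G0 G1 by (auto simp: galerkin_def)
  have sq: "square_integrable Omega (grad (\<phi> l))" if "l \<le> N\<^sub>T" for l
    using galerkin.square_integrables(3)[OF galerkin[OF that]] galerkin_\<phi>[OF that] by simp
  have v: "step N ^ CARD('n) > 0" using cell_volume_pos[OF N] .
  define J where "J = (\<Sum>i\<in>interior_indices N. coupling m i \<bullet> (d (m + 1) i - d m i))"
  define W W' A A' B where "W = (\<Sum>i\<in>interior_indices N. (norm (w m i))\<^sup>2)"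
    and "W' = (\<Sum>i\<in>interior_indices N. (norm (w (m + 1) i))\<^sup>2)"
    and "A = (\<Sum>i\<in>interior_indices N. \<Sum>j\<in>UNIV. (norm (forward_diff N j (d m) i))\<^sup>2)"
    and "A' = (\<Sum>i\<in>interior_indices N. \<Sum>j\<in>UNIV. (norm (forward_diff N j (d (m + 1)) i))\<^sup>2)"
    and "B = (\<Sum>i\<in>interior_indices N. (norm (mid (w m i) (w (m + 1) i)))\<^sup>2)"
  have "(\<sigma> / 2) * W' + (k / 2) * A' = (\<sigma> / 2) * W + (k / 2) * A - \<alpha> * dt * B + (\<epsilon>\<^sub>1 / (2 * step N ^ CARD('n))) * J"
    unfolding W_def W'_def A_def A'_def B_def J_def
    by (rule discrete_energy[OF dt neumann_d[OF m'(1)] neumann_d[OF m'(2)] d_step[OF m] w_step[OF m]])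
  \<comment> \<open>Multiplication by the cell volume turns sums over cells into squared L2 norms
    and cancels the volume in the denominator of the electric coefficient.\<close>
  then have "step N ^ CARD('n) * ((\<sigma> / 2) * W' + (k / 2) * A')
      = step N ^ CARD('n) * ((\<sigma> / 2) * W + (k / 2) * A - \<alpha> * dt * B + (\<epsilon>\<^sub>1 / (2 * step N ^ CARD('n))) * J)"
    by simp
  moreover have "p * (\<epsilon>\<^sub>1 / (2 * p) * J) = \<epsilon>\<^sub>1 / 2 * J" if "p > 0" for p
    using that by simp
  from this[OF v] have "step N ^ CARD('n) * ((\<epsilon>\<^sub>1 / (2 * step N ^ CARD('n))) * J) = \<epsilon>\<^sub>1 / 2 * J" .
  ultimately have en: "energy (m + 1) = energy m - \<alpha> * dt * dissipation m + \<epsilon>\<^sub>1 / 2 * J"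
    unfolding energy_def dissipation_def W_def[symmetric] W'_def[symmetric] A_def[symmetric] A'_def[symmetric] B_def[symmetric]
    by (simp only: distrib_left right_diff_distrib mult_ac)
  have "J = (\<integral>x. (dh (m + 1) x \<bullet> E m x) * (dh (m + 1) x \<bullet> E (m + 1) x) \<partial>\<mu>)
      - (\<integral>x. (dh m x \<bullet> E m x) * (dh m x \<bullet> E (m + 1) x) \<partial>\<mu>)"
    unfolding J_def coupling_def
    by (rule sum_cell_coupling[OF N]) (use sq m' inj in \<open>auto intro: square_integrable_embed\<close>)
  then have "\<epsilon>\<^sub>1 / 2 * J = \<gamma> * (director_form e \<epsilon>\<^sub>2 (dh (m + 1)) (grad (\<phi> m)) (grad (\<phi> (m + 1)))
      - director_form e \<epsilon>\<^sub>2 (dh m) (grad (\<phi> m)) (grad (\<phi> (m + 1))))"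
    using form_difference[OF d0 d1 sq[OF m'(1)] sq[OF m'(2)]] \<gamma> by simp
  then show ?thesis
    using en form_increment[OF G0 G1] form_increment_bound[OF G0 G1 dt]
    unfolding galerkin_\<phi>[OF m'(1)] galerkin_\<phi>[OF m'(2)] Q_def K_def D_def Z_def
    by (intro exI[of _ "(\<integral>x. (F (m + 1) x - F m x) * (u m x + u (m + 1) x) \<partial>\<mu>)
      - director_form e \<epsilon>\<^sub>2 (dh (m + 1)) (grad (\<phi> (m + 1))) (\<lambda>x. grad (G (m + 1)) x - grad (G m) x)
      - director_form e \<epsilon>\<^sub>2 (dh m) (grad (\<phi> m)) (\<lambda>x. grad (G (m + 1)) x - grad (G m) x)"])
      (simp add: add_ac)
qed

text \<open>Since the differences of \<open>Q\<close> telescope, \<open>Q\<close> enters at the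
  first and the last time only, where it is bounded by data. No energy at intermediate times is left
  on the right.\<close>

lemma energy_bound:
  assumes M: "M \<le> N\<^sub>T"
  shows "energy M + \<alpha> * dt * (\<Sum>m<M. dissipation m)
    \<le> energy 0 + \<bar>\<gamma>\<bar> * K * (Z 0 + Z M + dt * (\<Sum>m<M. D m + Z m + Z (m + 1)))"
proof -
  have "\<forall>m. \<exists>S. m < N\<^sub>T \<longrightarrow> energy (Suc m) = energy m + (- \<alpha> * dt * dissipation m + \<gamma> * (Q m - Q (Suc m) + S))
    \<and> \<bar>S\<bar> \<le> dt * (K * (D m + Z m + Z (m + 1)))"
    using energy_step by blast
  then obtain S where S: "\<And>m. m < N\<^sub>T \<Longrightarrow> energy (Suc m) = energy m + (- \<alpha> * dt * dissipation m + \<gamma> * (Q m - Q (Suc m) + S m))"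
    "\<And>m. m < N\<^sub>T \<Longrightarrow> \<bar>S m\<bar> \<le> dt * (K * (D m + Z m + Z (m + 1)))"
    by metis
  have "energy M = energy 0 + (\<Sum>m<M. - \<alpha> * dt * dissipation m + \<gamma> * (Q m - Q (Suc m) + S m))"
    using M by (intro sum_of_increments S) simp
  also have "\<dots> = energy 0 - \<alpha> * dt * (\<Sum>m<M. dissipation m) + \<gamma> * (Q 0 - Q M + (\<Sum>m<M. S m))"
  proof -
    have "(\<Sum>m<M. - \<alpha> * dt * dissipation m + \<gamma> * (Q m - Q (Suc m) + S m))
        = - \<alpha> * dt * (\<Sum>m<M. dissipation m) + \<gamma> * ((\<Sum>m<M. Q m - Q (Suc m)) + (\<Sum>m<M. S m))"
      by (simp only: sum.distrib sum_distrib_left[symmetric])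
    then show ?thesis by (simp add: sum_lessThan_telescope')
  qed
  finally have "energy M + \<alpha> * dt * (\<Sum>m<M. dissipation m) = energy 0 + \<gamma> * (Q 0 - Q M + (\<Sum>m<M. S m))"
    by simp
  also have "\<gamma> * (Q 0 - Q M + (\<Sum>m<M. S m)) \<le> \<bar>\<gamma>\<bar> * \<bar>Q 0 - Q M + (\<Sum>m<M. S m)\<bar>"
    using abs_ge_self[of "\<gamma> * (Q 0 - Q M + (\<Sum>m<M. S m))"] by (simp add: abs_mult)
  also have "\<bar>Q 0 - Q M + (\<Sum>m<M. S m)\<bar> \<le> K * (Z 0 + Z M + dt * (\<Sum>m<M. D m + Z m + Z (m + 1)))"
  proof -
    have "\<bar>\<Sum>m<M. S m\<bar> \<le> (\<Sum>m<M. \<bar>S m\<bar>)" by (rule sum_abs)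
    also have "\<dots> \<le> (\<Sum>m<M. dt * (K * (D m + Z m + Z (m + 1))))"
      using M by (intro sum_mono S) simp
    also have "\<dots> = K * (dt * (\<Sum>m<M. D m + Z m + Z (m + 1)))"
      by (simp only: sum_distrib_left mult_ac)
    finally have "\<bar>Q 0\<bar> + \<bar>Q M\<bar> + \<bar>\<Sum>m<M. S m\<bar> \<le> K * Z 0 + K * Z M + K * (dt * (\<Sum>m<M. D m + Z m + Z (m + 1)))"
      using Q_bound[of 0] Q_bound[OF M] by simp
    moreover have "\<bar>a - b + c\<bar> \<le> \<bar>a\<bar> + \<bar>b\<bar> + \<bar>c\<bar>" for a b c :: real
      by linarith
    ultimately show ?thesis by (simp only: distrib_left)
  qed
  finally show ?thesis by (simp add: mult_left_mono mult.assoc)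
qed

text \<open>The coefficient \<open>2 * k\<close> is \<open>k / 2\<close> times the 4 of
  \<open>discrete_gradient_cell_average\<close>.\<close>

lemma energy_initial: "energy 0 \<le> 2 * k * sqnorm Gd\<^sub>0 + \<sigma> / 2 * sqnorm w\<^sub>0"
proof -
  have init: "d 0 i = cell_average N d\<^sub>0 i" "w 0 i = cell_average N w\<^sub>0 i" if "i \<in> interior_indices N" for i
    using solution that by (auto simp: scheme_solution_def)
  have "(\<sigma> / 2) * (step N ^ CARD('n) * (\<Sum>i\<in>interior_indices N. (norm (w 0 i))\<^sup>2)) \<le> (\<sigma> / 2) * sqnorm w\<^sub>0"
    using \<sigma> init by (intro mult_left_mono L2_norm_cell_average_le N w\<^sub>0) auto
  moreover have "(k / 2) * (step N ^ CARD('n) * (\<Sum>i\<in>interior_indices N. \<Sum>j\<in>UNIV. (norm (forward_diff N j (d 0) i))\<^sup>2))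
      \<le> (k / 2) * (4 * sqnorm Gd\<^sub>0)"
    using k init discrete_gradient_cell_average[OF N d\<^sub>0(1) neumann_d[of 0]] by (intro mult_left_mono) auto
  ultimately show ?thesis by (simp add: energy_def)
qed

end

section \<open>Collecting the data terms and the claimed estimate\<close>

lemma H1_norm_power2: "(H1_norm u)\<^sup>2 = sqnorm u + sqnorm (grad u)"
  by (simp add: H1_norm_def)

text \<open>The energy balance contains the dissipation with the factor \<open>\<alpha>\<close>; the factor \<open>2 * \<alpha>\<close> comes from
  doubling the balance, which is possible since the energy is nonnegative.\<close>

lemma (in scheme) estimate:
  assumes M: "M \<le> N\<^sub>T" and dt1: "dt < 1"
  defines "F2 \<equiv> \<lambda>m. sqnorm (F m)" and "H2 \<equiv> \<lambda>m. (H1_norm (G m))\<^sup>2"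
    and "c \<equiv> 4 * k + \<sigma> + 1 + 2 * K + 6 * \<bar>\<gamma>\<bar> * K"
  shows "energy M + sqnorm (grad (\<phi> M)) + 2 * \<alpha> * (dt * (\<Sum>m<M. dissipation m))
    \<le> c * (H2 M + F2 M) + c * (dt * (\<Sum>m<M. F2 m))
      + c * (sqnorm Gd\<^sub>0 + sqnorm w\<^sub>0 + F2 0 + H2 0)
      + c * (dt * (\<Sum>m<M. D m)) + c * (dt * (\<Sum>m\<le>M. H2 m))"
proof -
  define p where "p = \<bar>\<gamma>\<bar> * K"
  have p: "0 \<le> p" using K_ge by (simp add: p_def)
  have nn: "0 \<le> F2 m" "0 \<le> H2 m" for m by (simp_all add: F2_def H2_def)
  have ZFH: "Z m \<le> F2 m + H2 m" for m by (simp add: Z_def F2_def H2_def H1_norm_power2)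
  define sF where "sF = dt * (\<Sum>m<M. F2 m)"
  define sH where "sH = dt * (\<Sum>m\<le>M. H2 m)"
  define sD where "sD = dt * (\<Sum>m<M. D m)"
  have s0: "0 \<le> sF" "0 \<le> sH" "0 \<le> sD"
    using dt nn by (auto simp: sF_def sH_def sD_def D_def intro!: mult_nonneg_nonneg sum_nonneg)
  have sZ: "dt * (\<Sum>m<M. Z m) \<le> sF + sH"
  proof -
    have "(\<Sum>m<M. Z m) \<le> (\<Sum>m<M. F2 m) + (\<Sum>m<M. H2 m)"
      unfolding sum.distrib[symmetric] by (intro sum_mono ZFH)
    also have "(\<Sum>m<M. H2 m) \<le> (\<Sum>m\<le>M. H2 m)"
      using nn by (intro sum_mono2) auto
    finally show ?thesis using dt by (simp add: sF_def sH_def distrib_left[symmetric])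
  qed
  \<comment> \<open>The shifted sum reaches time \<open>M\<close>. In the claim the sum for
    \<open>g\<close> does so too, but that for \<open>f\<close> stops one step earlier, so
    \<open>dt * F2 M\<close> is left over. It is absorbed by the separate term at the final time;
    this is where \<open>dt < 1\<close> enters.\<close>
  have sZ1: "dt * (\<Sum>m<M. Z (m + 1)) \<le> F2 M + sF + sH"
  proof -
    have shift: "(\<Sum>m<M. x (m + 1)) \<le> x M + (\<Sum>m<M. x m)" if "0 \<le> x 0" for x :: "nat \<Rightarrow> real"
      using that by (induction M) auto
    have "(\<Sum>m<M. Z (m + 1)) \<le> (\<Sum>m<M. F2 (m + 1)) + (\<Sum>m<M. H2 (m + 1))"
      unfolding sum.distrib[symmetric] by (intro sum_mono ZFH)
    also have "\<dots> \<le> (F2 M + (\<Sum>m<M. F2 m)) + (\<Sum>m\<le>M. H2 m)"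
    proof (intro add_mono shift nn)
      have "(\<Sum>m<M. H2 (m + 1)) \<le> H2 M + (\<Sum>m<M. H2 m)" by (rule shift[OF nn(2)])
      also have "\<dots> = (\<Sum>m\<le>M. H2 m)" by (simp add: lessThan_Suc_atMost[symmetric])
      finally show "(\<Sum>m<M. H2 (m + 1)) \<le> (\<Sum>m\<le>M. H2 m)" .
    qed
    finally have "dt * (\<Sum>m<M. Z (m + 1)) \<le> dt * ((F2 M + (\<Sum>m<M. F2 m)) + (\<Sum>m\<le>M. H2 m))"
      using dt by (intro mult_left_mono) auto
    also have "\<dots> = dt * F2 M + sF + sH" by (simp add: sF_def sH_def distrib_left)
    also have "dt * F2 M \<le> 1 * F2 M" using dt1 nn by (intro mult_right_mono) auto
    finally show ?thesis by simp
  qed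
  have "dt * (\<Sum>m<M. D m + Z m + Z (m + 1)) = sD + dt * (\<Sum>m<M. Z m) + dt * (\<Sum>m<M. Z (m + 1))"
    by (simp add: sD_def sum.distrib distrib_left)
  also have "\<dots> \<le> sD + (sF + sH) + (F2 M + sF + sH)"
    using sZ sZ1 by linarith
  finally have sum: "Z 0 + Z M + dt * (\<Sum>m<M. D m + Z m + Z (m + 1))
      \<le> (F2 0 + H2 0) + (2 * F2 M + H2 M) + sD + 2 * sF + 2 * sH"
    using ZFH[of 0] ZFH[of M] by linarith
  have "energy M + \<alpha> * dt * (\<Sum>m<M. dissipation m)
      \<le> energy 0 + p * (Z 0 + Z M + dt * (\<Sum>m<M. D m + Z m + Z (m + 1)))"
    unfolding p_def by (rule energy_bound[OF M])
  also have "p * (Z 0 + Z M + dt * (\<Sum>m<M. D m + Z m + Z (m + 1)))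
      \<le> p * ((F2 0 + H2 0) + (2 * F2 M + H2 M) + sD + 2 * sF + 2 * sH)"
    using sum p by (intro mult_left_mono) auto
  finally have 1: "energy M + \<alpha> * dt * (\<Sum>m<M. dissipation m)
      \<le> energy 0 + p * ((F2 0 + H2 0) + (2 * F2 M + H2 M) + sD + 2 * sF + 2 * sH)"
    by simp
  have 2: "sqnorm (grad (\<phi> M)) \<le> K * (F2 M + H2 M)"
    using grad_\<phi>_le[OF M] mult_left_mono[OF ZFH[of M] K_ge(2)] by linarith
  have e0: "0 \<le> energy M"
    using k \<sigma> by (auto simp: energy_def intro!: add_nonneg_nonneg mult_nonneg_nonneg sum_nonneg)
  define g0 w0 where "g0 = sqnorm Gd\<^sub>0" and "w0 = sqnorm w\<^sub>0"
  have gw: "0 \<le> g0" "0 \<le> w0" by (simp_all add: g0_def w0_def)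
  have "energy M + sqnorm (grad (\<phi> M)) + 2 * \<alpha> * (dt * (\<Sum>m<M. dissipation m))
      \<le> 2 * (2 * k * g0 + \<sigma> / 2 * w0 + p * ((F2 0 + H2 0) + (2 * F2 M + H2 M) + sD + 2 * sF + 2 * sH))
        + K * (F2 M + H2 M)"
    using 1 2 e0 energy_initial unfolding g0_def[symmetric] w0_def[symmetric] by (simp add: mult.assoc)
  also have "\<dots> = (4 * k) * g0 + \<sigma> * w0 + (2 * p) * (F2 0 + H2 0)
      + (2 * p + K) * H2 M + (4 * p + K) * F2 M + (2 * p) * sD + (4 * p) * sF + (4 * p) * sH"
    by (simp add: algebra_simps)
  \<comment> \<open>\<open>c\<close> is the sum of 1 and upper bounds for all these coefficients:
    \<open>4 * k\<close>, \<open>\<sigma>\<close>, and at most \<open>4 * p + K\<close> for the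
    rest.\<close>
  also have "\<dots> \<le> c * g0 + c * w0 + c * (F2 0 + H2 0) + c * H2 M + c * F2 M + c * sD + c * sF + c * sH"
    using p K_ge(2) k \<sigma> nn gw s0 by (intro add_mono mult_right_mono) (auto simp: c_def p_def)
  also have "\<dots> = c * (H2 M + F2 M) + c * sF + c * (g0 + w0 + F2 0 + H2 0) + c * sD + c * sH"
    by (simp add: algebra_simps)
  finally show ?thesis by (simp add: sF_def sH_def sD_def g0_def w0_def)
qed

theorem lemma2p2:
  fixes e :: "'n::finite \<Rightarrow> 3"
    and k \<sigma> \<alpha> \<epsilon>\<^sub>0 \<epsilon>\<^sub>a \<epsilon>\<^sub>p \<epsilon>\<^sub>1 \<epsilon>\<^sub>2 :: real
  assumes dim: "CARD('n) \<in> {1, 2, 3}" and e: "inj e"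
    and k: "k > 0"
    and coeffs: "(\<sigma> > 0 \<and> \<alpha> \<ge> 0) \<or> (\<alpha> > 0 \<and> \<sigma> \<ge> 0)"
    and eps: "\<epsilon>\<^sub>0 > 0" "\<epsilon>\<^sub>p \<noteq> 0" "\<epsilon>\<^sub>1 = \<epsilon>\<^sub>0 * \<epsilon>\<^sub>a" "\<epsilon>\<^sub>2 = \<epsilon>\<^sub>a * inverse \<epsilon>\<^sub>p"
    and eps2: "\<epsilon>\<^sub>2 > -1"
  shows "\<exists>\<tau>>0. \<exists>C>0. \<forall>T dt N\<^sub>T N \<T> f g d\<^sub>0 Gd\<^sub>0 d\<^sub>1 w\<^sub>0 d w \<phi> M D.
    T > 0 \<and> dt > 0 \<and> dt < \<tau> \<and> T / dt = real N\<^sub>T \<and> N \<ge> 1 \<and>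
    uniform_triangulations \<T> \<and>
    W12_L2 T f \<and> Linf_H1 T g \<and> W12_H1 T g \<and>
    H1_with_gradient d\<^sub>0 Gd\<^sub>0 \<and> (AE x in lebesgue_on Omega. norm (d\<^sub>0 x) = 1) \<and>
    square_integrable Omega d\<^sub>1 \<and> w\<^sub>0 = (\<lambda>x. cross3 (d\<^sub>1 x) (d\<^sub>0 x)) \<and>
    scheme_solution e k \<sigma> \<alpha> \<epsilon>\<^sub>1 \<epsilon>\<^sub>2 dt N\<^sub>T N (\<T> N) f g d\<^sub>0 w\<^sub>0 d w \<phi> \<and>
    real M * dt \<le> T \<and> D \<in> {forward_diff, backward_diff}
    \<longrightarrow>
    (let t = (\<lambda>m. real m * dt);
         g\<^sub>m = (\<lambda>m. interpolant (\<T> N) (g (t m)));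
         Gd\<^sub>h = piecewise_in_time dt (\<lambda>m. piecewise_const N (\<lambda>i. \<chi> j. D N j (d m) i));
         w\<^sub>h = piecewise_in_time dt (\<lambda>m. piecewise_const N (w m));
         w\<^sub>h' = piecewise_in_time dt (\<lambda>m. piecewise_const N (\<lambda>i. midpoint_avg (\<lambda>m. w m i) m));
         \<phi>\<^sub>h = piecewise_in_time dt \<phi>;
         g\<^sub>h = piecewise_in_time dt g\<^sub>m
     in k / 2 * (L2_norm Omega (Gd\<^sub>h (t M)))\<^sup>2 + \<sigma> / 2 * (L2_norm Omega (w\<^sub>h (t M)))\<^sup>2
          + (L2_norm Omega (grad (\<phi>\<^sub>h (t M))))\<^sup>2
        \<le> C * ((H1_norm (g\<^sub>h (t M)))\<^sup>2 + (L2_norm Omega (f (t M)))\<^sup>2)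
          + C * exp (C * t M) * dt * (\<Sum>m<M. (L2_norm Omega (f (t m)))\<^sup>2)
          + C * (t M * exp (C * t M) + 1) *
              ((L2_norm Omega Gd\<^sub>0)\<^sup>2 + (L2_norm Omega w\<^sub>0)\<^sup>2 + (L2_norm Omega (grad (\<phi> 0)))\<^sup>2
                + (L2_norm Omega (f 0))\<^sup>2 + (H1_norm (g\<^sub>m 0))\<^sup>2)
          + C * (1 + t M * exp (C * t M)) * dt *
              ((\<Sum>m<M. (L2_norm Omega (\<lambda>x. time_diff dt (\<lambda>m. f (t m) x) m))\<^sup>2)
                + (\<Sum>m<M. (L2_norm Omega (\<lambda>x. time_diff dt (\<lambda>m. grad (g\<^sub>h (t m)) x) m))\<^sup>2))
          + C * exp (C * t M) * (1 + t M) * dt * (\<Sum>m\<le>M. (H1_norm (g\<^sub>h (t m)))\<^sup>2)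
          - 2 * \<alpha> * (L2_norm ({0..<t M} \<times> Omega) (\<lambda>(s, x). w\<^sub>h' s x))\<^sup>2)"
proof -
  \<comment> \<open>If \<open>\<epsilon>\<^sub>2 = 0\<close>, then also \<open>\<epsilon>\<^sub>1 = 0\<close>, and \<open>\<gamma> = 0\<close> since \<open>x / 0 = 0\<close>.\<close>
  define \<gamma> where "\<gamma> = \<epsilon>\<^sub>1 / (2 * \<epsilon>\<^sub>2)"
  have \<gamma>: "\<epsilon>\<^sub>1 / 2 = \<gamma> * \<epsilon>\<^sub>2"
    using eps by (cases "\<epsilon>\<^sub>a = 0") (auto simp: \<gamma>_def field_simps)
  \<comment> \<open>The constant \<open>K\<close> of the locale, written out so that
    \<open>C\<close> can be fixed before the mesh, the step size and the data are
    quantified.\<close>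
  define \<kappa> where "\<kappa> = 4 * (1 + \<bar>\<epsilon>\<^sub>2\<bar>) * elliptic_const \<epsilon>\<^sub>2"
  define C where "C = 4 * k + \<sigma> + 1 + 2 * \<kappa> + 6 * \<bar>\<gamma>\<bar> * \<kappa>"
  have nonneg: "0 \<le> \<sigma>" "0 \<le> \<alpha>" using coeffs by auto
  have "0 \<le> \<kappa>" using elliptic_const_ge[of \<epsilon>\<^sub>2] by (simp add: \<kappa>_def)
  then have C: "C > 0" using k nonneg by (simp add: C_def add_nonneg_pos add_pos_nonneg)
  show ?thesis
  \<comment> \<open>The threshold 1 for the step size is the one that \<open>estimate\<close> asks
    for.\<close>
  proof (rule exI[of _ 1], rule conjI[OF zero_less_one], rule exI[of _ C], rule conjI[OF C], intro allI impI, elim conjE, goal_cases)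
    case (1 T dt N\<^sub>T N \<T> f g d\<^sub>0 Gd\<^sub>0 d\<^sub>1 w\<^sub>0 d w \<phi> M D)
    note dt = 1(2) and dt_less = 1(3) and N\<^sub>T = 1(4) and N = 1(5) and tri = 1(6) and f = 1(7)
      and d\<^sub>0 = 1(10,11) and d\<^sub>1 = 1(12) and w\<^sub>0 = 1(13) and sol = 1(14) and MT = 1(15) and D = 1(16)
    have Tdt: "T = real N\<^sub>T * dt" using N\<^sub>T dt by (simp add: field_simps)
    have M: "M \<le> N\<^sub>T" using MT dt unfolding Tdt by simp
    have w\<^sub>0_sq: "square_integrable Omega w\<^sub>0"
    proof (rule square_integrable_bound[OF d\<^sub>1])
      have "(\<lambda>p. cross3 (fst p) (snd p)) \<in> borel_measurable borel"
        by (intro borel_measurable_continuous_onI continuous_on_cross continuous_intros)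
      moreover have "(\<lambda>x. (d\<^sub>1 x, d\<^sub>0 x)) \<in> borel_measurable \<mu>"
        using d\<^sub>1 d\<^sub>0(1) by (auto simp: H1_with_gradient_def square_integrable_def)
      ultimately show "w\<^sub>0 \<in> borel_measurable \<mu>"
        unfolding w\<^sub>0 by (auto dest: measurable_compose[rotated])
      show "AE x in \<mu>. norm (w\<^sub>0 x) \<le> norm (d\<^sub>1 x)"
        using d\<^sub>0(2)
      proof eventually_elim
        case (elim x)
        \<comment> \<open>Lagrange's identity; the unit length of \<open>d\<^sub>0\<close> reduces
          the right-hand side to \<open>d\<^sub>1\<close>.\<close>
        have "(norm (w\<^sub>0 x))\<^sup>2 + (d\<^sub>1 x \<bullet> d\<^sub>0 x)\<^sup>2 = (norm (d\<^sub>1 x))\<^sup>2"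
          using norm_cross_dot[of "d\<^sub>1 x" "d\<^sub>0 x"] elim unfolding w\<^sub>0 by simp
        then have "(norm (w\<^sub>0 x))\<^sup>2 \<le> (norm (d\<^sub>1 x))\<^sup>2"
          using zero_le_power2[of "d\<^sub>1 x \<bullet> d\<^sub>0 x"] by linarith
        then show ?case by (rule power2_le_imp_le) simp
      qed
    qed
    interpret scheme "\<T> N" e k \<sigma> \<alpha> \<epsilon>\<^sub>1 \<epsilon>\<^sub>2 \<gamma> dt N\<^sub>T N f g d\<^sub>0 w\<^sub>0 Gd\<^sub>0 d w \<phi>
    proof
      show "triangulation (\<T> N)" "\<Union> (\<T> N) = Omega"
        using tri N by (auto simp: uniform_triangulations_def)
      show "square_integrable Omega (f (real m * dt))" if "m \<le> N\<^sub>T" for m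
        using f that dt unfolding W12_L2_def continuous_in_L2_def Tdt by (auto intro!: mult_right_mono)
    qed (use e k nonneg eps2 \<gamma> dt N d\<^sub>0 w\<^sub>0_sq sol in auto)
    define F2 where "F2 m = sqnorm (f (real m * dt))" for m
    define H2 where "H2 m = (H1_norm (interpolant (\<T> N) (g (real m * dt))))\<^sup>2" for m
    define R\<^sub>0 where "R\<^sub>0 = sqnorm Gd\<^sub>0 + sqnorm w\<^sub>0 + F2 0 + H2 0"
    define s where "s = real M * dt"
    define W where "W = (\<Sum>m<M. dissipation m)"
    define sD where "sD = (\<Sum>m<M. scheme.D (\<T> N) dt f g m)"
    have s: "0 \<le> s" using dt by (simp add: s_def)
    have Ke: "scheme.K \<epsilon>\<^sub>2 = \<kappa>" by (simp add: K_def \<kappa>_def)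
    have grad_d: "sqnorm (piecewise_const N (\<lambda>i. \<chi> j. D N j (d M) i))
        = step N ^ CARD('n) * (\<Sum>i\<in>interior_indices N. \<Sum>j\<in>UNIV. (norm (forward_diff N j (d M) i))\<^sup>2)"
    proof -
      have "(\<Sum>i\<in>interior_indices N. \<Sum>j\<in>UNIV. (norm (D N j (d M) i))\<^sup>2)
          = (\<Sum>i\<in>interior_indices N. \<Sum>j\<in>UNIV. (norm (forward_diff N j (d M) i))\<^sup>2)"
      proof (cases "D = forward_diff")
        case False
        then have "D = backward_diff" using D by simp
        then show ?thesis
          using sum_backward_eq_forward[OF neumann_d[OF M]] by (subst (1 2) sum.swap) simp
      qed simp
      then show ?thesis
        unfolding L2_norm_piecewise_const[OF N] norm_vec_power2 by simp
    qed
    have E: "k / 2 * sqnorm (piecewise_const N (\<lambda>i. \<chi> j. D N j (d M) i))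
        + \<sigma> / 2 * sqnorm (piecewise_const N (w M)) = energy M"
      unfolding grad_d L2_norm_piecewise_const[OF N] energy_def by simp
    have diss: "(L2_norm ({0..<s} \<times> Omega)
        (\<lambda>(r, x). piecewise_in_time dt (\<lambda>m. piecewise_const N (\<lambda>i. midpoint_avg (\<lambda>m. w m i) m)) r x))\<^sup>2 = dt * W"
      unfolding s_def W_def L2_norm_space_time[OF N dt] dissipation_def midpoint_avg_def ..
    have main: "energy M + sqnorm (grad (\<phi> M)) + 2 * \<alpha> * (dt * W)
        \<le> C * (H2 M + F2 M) + C * (dt * (\<Sum>m<M. F2 m)) + C * R\<^sub>0 + C * (dt * sD) + C * (dt * (\<Sum>m\<le>M. H2 m))"
      using estimate[OF M dt_less] unfolding Ke C_def[symmetric] F2_def H2_def R\<^sub>0_def W_def sD_def by simp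
    define P where "P = sqnorm (grad (\<phi> 0))"
    \<comment> \<open>In \<open>main\<close> all weights are constant. The exponential weights of
      the claim are reached because each is at least 1 for \<open>s \<ge> 0\<close>, and the
      nonnegative \<open>P\<close> completes the initial data.\<close>
    have weights: "C * x \<le> C * exp (C * s) * x" "C * x \<le> C * (s * exp (C * s) + 1) * (x + P)"
      "C * x \<le> C * (1 + s * exp (C * s)) * x" "C * x \<le> C * exp (C * s) * (1 + s) * x" if "0 \<le> x" for x
    proof -
      have ex: "1 \<le> exp (C * s)" using C s by simp
      have "C * x = C * 1 * x" by simp
      also have "\<dots> \<le> C * exp (C * s) * x" using ex C that by (intro mult_right_mono mult_left_mono) auto
      finally show "C * x \<le> C * exp (C * s) * x" .
      have "C * x = C * 1 * x" by simp
      also have "\<dots> \<le> C * (s * exp (C * s) + 1) * (x + P)"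
        using s C that by (intro mult_mono mult_left_mono) (auto simp: P_def)
      finally show "C * x \<le> C * (s * exp (C * s) + 1) * (x + P)" .
      have "C * x = C * 1 * x" by simp
      also have "\<dots> \<le> C * (1 + s * exp (C * s)) * x"
        using s C that by (intro mult_right_mono mult_left_mono) auto
      finally show "C * x \<le> C * (1 + s * exp (C * s)) * x" .
      have "C * x = C * 1 * 1 * x" by simp
      also have "\<dots> \<le> C * exp (C * s) * (1 + s) * x"
        using s C ex that by (intro mult_right_mono mult_mono mult_left_mono) auto
      finally show "C * x \<le> C * exp (C * s) * (1 + s) * x" .
    qed
    have nn: "0 \<le> dt * (\<Sum>m<M. F2 m)" "0 \<le> R\<^sub>0" "0 \<le> dt * sD" "0 \<le> dt * (\<Sum>m\<le>M. H2 m)"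
      using dt by (auto simp: F2_def R\<^sub>0_def H2_def sD_def D_def intro!: mult_nonneg_nonneg sum_nonneg)
    have "energy M + sqnorm (grad (\<phi> M))
        \<le> C * (H2 M + F2 M) + C * exp (C * s) * (dt * (\<Sum>m<M. F2 m)) + C * (s * exp (C * s) + 1) * (R\<^sub>0 + P)
          + C * (1 + s * exp (C * s)) * (dt * sD) + C * exp (C * s) * (1 + s) * (dt * (\<Sum>m\<le>M. H2 m))
          - 2 * \<alpha> * (dt * W)"
      using main weights(1)[OF nn(1)] weights(2)[OF nn(2)] weights(3)[OF nn(3)] weights(4)[OF nn(4)] by linarith
    moreover have "R\<^sub>0 + P = sqnorm Gd\<^sub>0 + sqnorm w\<^sub>0 + sqnorm (grad (\<phi> 0))
        + sqnorm (f 0) + (H1_norm (interpolant (\<T> N) (g (real 0 * dt))))\<^sup>2"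
      by (simp add: R\<^sub>0_def P_def F2_def H2_def)
    moreover have "sD = (\<Sum>m<M. sqnorm (\<lambda>x. time_diff dt (\<lambda>m. f (real m * dt) x) m))
        + (\<Sum>m<M. sqnorm (\<lambda>x. time_diff dt (\<lambda>m. grad (interpolant (\<T> N) (g (real m * dt))) x) m))"
      by (simp only: sD_def D_def time_diff_def sum.distrib)
    ultimately show ?case
      unfolding Let_def piecewise_in_time_node[OF dt]
      unfolding E s_def[symmetric] diss F2_def H2_def
      by (simp only: mult.assoc s_def)
  qed
qed

end
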